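(* Let $M>0$ be fixed. Let $\theta,\tilde\theta$ be fixed parameters satisfying $$\theta\in(-1,\beta),\qquad\tilde\theta\in[\theta,\beta],\qquad\text{with }\tilde\theta-\theta<\beta,$$ and let $y^0\in\mathcal Y_\theta$ be a given initial datum. Then there exists a unique solution $t\mapsto S(t)(y^0)=\{S_n(t)(y^0)\}_{n\in\mathbb Z}\in\mathcal Y_\theta$ to the linear problem $$\frac{dy_n}{dt}=\mathscr L_n(y),\quad n\in\mathbb Z,$$ with initial datum $y^0$, which satisfies the estimate $$\|D^+(S(t)(y^0))\|_{\tilde\theta}\le C_1\|y^0\|_\theta\bigl(1+t^{-\frac{\tilde\theta-\theta}\beta}\bigr)e^{-\nu t}\qquad\text{for all }t>0,$$ where $\nu>0$ is a constant depending only on $M$, and $C_1>0$ depends on $M$, $\theta$ and $\tilde\theta$. Moreover, there exists the limit $S_\infty(t)(y^0):=\lim_{n\to\infty}S_n(t)(y^0)$, satisfying for all $t>0$ $$\|S(t)(y^0)-S_\infty(t)(y^0)\|_{\tilde\theta}\le C_1\|y^0\|_\theta\bigl(1+t^{-\frac{\tilde\theta-\theta}\beta}\bigr)e^{-\nu t}\qquad\text{(if }\tilde\theta>0)$$ (where $S_\infty(t)(y^0)$ is subtracted from every component). Finally, there exists the limit $$D^\beta_\infty S(t)(y^0):=\lim_{n\to\infty}2^{\beta n}\bigl(S_n(t)(y^0)-S_\infty(t)(y^0)\bigr),$$ and one has the identity $$\lim_{n\to\infty}\mathscr L_n(S(t)(y^0))=\frac{2^\beta-1}4\,D^\beta_\infty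 S(t)(y^0).$$
   Context: Kernel functions (fixed throughout; constants may also depend on them without this being mentioned). Let $\alpha\in(0,1)$, $\beta\in(1,2)$, $\bar\alpha,\bar\beta>1$, $k_0,\gamma_0>0$. The function $k\in C([0,\infty))$ is strictly positive with $k(\xi)\sim\xi^{\alpha+1}$ (ratio tending to $1$) as $\xi\to\infty$ and $k(\xi)=k_0+O(\xi^{\bar\alpha})$ as $\xi\to0^+$. The function $\gamma\in C((0,\infty))$ is strictly positive with $\gamma(\xi)\sim\xi^\beta$ as $\xi\to\infty$ and $\gamma(\xi)=\gamma_0+O(\xi^{\bar\beta})$ as $\xi\to0^+$. Stationary coefficients. For $n\in\mathbb Z$ set $\zeta_n:=\frac{\ln2}{2^n}\frac{k(2^n)}{\gamma(2^{n+1})}$ and $\vartheta_n:=\frac{2\zeta_{n+1}}{\zeta_n}$. For $A>0$ let $\alpha_n(A):=e^{-A2^n}\exp\bigl(-2^n\sum_{j=n+1}^\infty2^{-j}\ln\vartheta_{j-1}\bigr)$ and $a_n(A):=2\alpha_n(A)/\zeta_n$. For $M>0$, $A_M$ is the unique $A>0$ with $\sum_{n\in\mathbb Z}2^na_n(A)=M$. Linear operator. For a sequence $y=\{y_n\}_{n\in\mathbb Z}$, $\mathscr L_n(y):=\frac{\gamma(2^n)}4\bigl[y_{n-1}-y_n-\sigma_n(y_n-y_{n+1})\bigr]$ with $\sigma_n:=8\alpha_n(A_M)\frac{\gamma(2^{n+1})}{\gamma(2^n)}$. Spaces. $\mathcal Y:=\{y=\{y_n\}_{n\in\mathbb Z}:\|y\|_{\mathcal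 Y}<\infty\}$ with $\|y\|_{\mathcal Y}:=\sup_{n\le0}2^n|y_n|+\sup_{n>0}|y_n|$. For $\theta\in\mathbb R$, $\mathcal Y_\theta:=\{y\in\mathcal Y:\|y\|_\theta<\infty\}$ with $\|y\|_\theta:=\sup_{n\le0}2^n|y_n|+\sup_{n>0}2^{\theta n}|y_n|$ (in particular $\mathcal Y_0=\mathcal Y$). Discrete derivative: $D^+_n(y):=y_{n+1}-y_n$, $D^+(y):=\{D^+_n(y)\}_{n\in\mathbb Z}$. Semigroup: $S_n(t)(y^0):=y_n(t)$ and $S(t)(y^0):=\{S_n(t)(y^0)\}_{n\in\mathbb Z}$, where $\{y_n(t)\}_{n\in\mathbb Z}$ is the solution of the linear problem at time $t$ with initial datum $y^0$.
   Formalization: For θ>0 the solution is in 𝒴 and only S(t)(y⁰)−S_∞(t)(y⁰) is shown in 𝒴_θ, as S(t)(y⁰) itself generally has a nonzero limit; uniqueness is among solutions whose norm (of 𝒴_θ if θ≤0, of 𝒴 if θ>0) is bounded on bounded time intervals, since without such a bound it fails. *)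

theory Defs
  imports "HOL-Analysis.Analysis" "HOL-Library.Landau_Symbols"
begin

definition zeta :: "(real \<Rightarrow> real) \<Rightarrow> (real \<Rightarrow> real) \<Rightarrow> int \<Rightarrow> real" where
  "zeta k \<gamma> n = ln 2 / 2 powi n * (k (2 powi n) / \<gamma> (2 powi (n + 1)))"

definition vartheta :: "(real \<Rightarrow> real) \<Rightarrow> (real \<Rightarrow> real) \<Rightarrow> int \<Rightarrow> real" where
  "vartheta k \<gamma> n = 2 * zeta k \<gamma> (n + 1) / zeta k \<gamma> n"

definition alpha_coeff :: "(real \<Rightarrow> real) \<Rightarrow> (real \<Rightarrow> real) \<Rightarrow> real \<Rightarrow> int \<Rightarrow> real" where
  "alpha_coeff k \<gamma> A n =
     exp (- A * 2 powi n) *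
     exp (- (2 powi n) * (\<Sum>\<^sub>\<infinity>j\<in>{n+1..}. 2 powi (- j) * ln (vartheta k \<gamma> (j - 1))))"

definition a_coeff :: "(real \<Rightarrow> real) \<Rightarrow> (real \<Rightarrow> real) \<Rightarrow> real \<Rightarrow> int \<Rightarrow> real" where
  "a_coeff k \<gamma> A n = 2 * alpha_coeff k \<gamma> A n / zeta k \<gamma> n"

definition A_of_mass :: "(real \<Rightarrow> real) \<Rightarrow> (real \<Rightarrow> real) \<Rightarrow> real \<Rightarrow> real" where
  "A_of_mass k \<gamma> M = (THE A. A > 0 \<and> ((\<lambda>n::int. 2 powi n * a_coeff k \<gamma> A n) has_sum M) UNIV)"

definition sigma :: "(real \<Rightarrow> real) \<Rightarrow> (real \<Rightarrow> real) \<Rightarrow> real \<Rightarrow> int \<Rightarrow> real" where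
  "sigma k \<gamma> M n =
     8 * alpha_coeff k \<gamma> (A_of_mass k \<gamma> M) n * (\<gamma> (2 powi (n + 1)) / \<gamma> (2 powi n))"

definition lin_op ::
  "(real \<Rightarrow> real) \<Rightarrow> (real \<Rightarrow> real) \<Rightarrow> real \<Rightarrow> (int \<Rightarrow> real) \<Rightarrow> int \<Rightarrow> real" where
  "lin_op k \<gamma> M y n =
     \<gamma> (2 powi n) / 4 * (y (n - 1) - y n - sigma k \<gamma> M n * (y n - y (n + 1)))"

text \<open>The norm is extended-valued, so that an estimate against a finite bound includes the
  finiteness of both suprema. The norm of \<open>\<Y>\<close> is the case \<open>\<theta> = 0\<close>.\<close>

definition ynorm :: "real \<Rightarrow> (int \<Rightarrow> real) \<Rightarrow> ennreal" where
  "ynorm \<theta> y =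
     (SUP n\<in>{..0}. ennreal (2 powi n * \<bar>y n\<bar>)) +
     (SUP n\<in>{0<..}. ennreal (2 powr (\<theta> * real_of_int n) * \<bar>y n\<bar>))"

text \<open>Membership in \<open>\<Y>\<close> is required for every \<open>\<theta>\<close>; for \<open>\<theta> \<le> 0\<close> it is the stronger of the
  two conditions, so that then \<open>\<Y>\<^sub>\<theta> = \<Y>\<close> as a set, with a weaker norm.\<close>

definition Y_space :: "real \<Rightarrow> (int \<Rightarrow> real) set" where
  "Y_space \<theta> = {y. ynorm 0 y < \<infinity> \<and> ynorm \<theta> y < \<infinity>}"

definition Dplus :: "(int \<Rightarrow> real) \<Rightarrow> int \<Rightarrow> real" where
  "Dplus y n = y (n + 1) - y n"

text \<open>Only the values \<open>y t\<close> for \<open>t \<ge> 0\<close> matter; at \<open>t = 0\<close> the derivative is one-sided.\<close>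

definition solves_linear ::
  "(real \<Rightarrow> real) \<Rightarrow> (real \<Rightarrow> real) \<Rightarrow> real \<Rightarrow> (int \<Rightarrow> real) \<Rightarrow> (real \<Rightarrow> int \<Rightarrow> real) \<Rightarrow> bool" where
  "solves_linear k \<gamma> M y0 y \<longleftrightarrow>
     y 0 = y0 \<and>
     (\<forall>t\<ge>0. \<forall>n. ((\<lambda>s. y s n) has_real_derivative lin_op k \<gamma> M (y t) n) (at t within {0..}))"

text \<open>Curves in \<open>\<Y>\<^sub>\<theta>\<close> that are bounded on bounded time intervals. Without the local bound,
  solutions of the linear problem with values in \<open>\<Y>\<close> are not unique: the operator generates a
  birth-death chain for which \<open>+\<infinity>\<close> is an entrance boundary, and the density of the entrance
  law from \<open>+\<infinity>\<close> with respect to the reversible measure is a nonzero solution with zero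
  initial datum that belongs to \<open>\<Y>\<close> at each time.\<close>

definition loc_bounded_in :: "real \<Rightarrow> (real \<Rightarrow> int \<Rightarrow> real) \<Rightarrow> bool" where
  "loc_bounded_in \<theta> y \<longleftrightarrow>
     (\<forall>t\<ge>0. y t \<in> Y_space \<theta>) \<and>
     (\<forall>T::real. \<exists>B::real. \<forall>t\<in>{0..T}. ynorm \<theta> (y t) \<le> ennreal B)"

text \<open>The class in which the linear problem is solved. For \<open>\<theta> \<le> 0\<close> it consists of curves in
  \<open>\<Y>\<^sub>\<theta>\<close>. For \<open>\<theta> > 0\<close> the space is \<open>\<Y>\<close>: a solution starting in \<open>\<Y>\<^sub>\<theta>\<close> has in general a nonzero
  limit as \<open>n \<rightarrow> \<infinity>\<close> at positive times, and only its difference from that limit is in \<open>\<Y>\<^sub>\<theta>\<close>.\<close>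

definition linear_solution ::
  "(real \<Rightarrow> real) \<Rightarrow> (real \<Rightarrow> real) \<Rightarrow> real \<Rightarrow> real \<Rightarrow> (int \<Rightarrow> real) \<Rightarrow> (real \<Rightarrow> int \<Rightarrow> real) \<Rightarrow> bool" where
  "linear_solution k \<gamma> M \<theta> y0 y \<longleftrightarrow> solves_linear k \<gamma> M y0 y \<and> loc_bounded_in (min \<theta> 0) y"

end

theory Submission
  imports Defs
begin

text \<open>
  Let \<open>p\<^sub>n = y\<^sub>n\<^sub>+\<^sub>1 - y\<^sub>n\<close>. If \<open>y\<close> solves the linear problem, then \<open>p\<close> solves a tridiagonal
  system \<open>p' = D p\<close> whose off-diagonal coefficients are nonnegative. Such a system obeys a
  comparison principle (\<open>tri_abs_comparison\<close>): a nonnegative \<open>W\<close> with \<open>W' \<ge> D W\<close> that dominates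
  \<open>\<bar>p\<bar>\<close> at time \<open>0\<close> dominates it at all times, provided \<open>p\<close> grows more slowly in \<open>n\<close> than a fixed
  weight. So each estimate of the theorem comes from an explicit \<open>W\<close>.

  Smoothing. Put \<open>x\<^sub>n = 2\<^bsup>-\<beta>n\<^esup>\<close> and \<open>\<delta> = (\<beta> - \<theta>) / \<beta>\<close>. For \<open>n \<ge> 0\<close> the rescaled difference
  \<open>q\<^sub>n = \<gamma>(2\<^bsup>n+1\<^esup>) p\<^sub>n / 4\<close> satisfies \<open>q\<^sub>n' = \<gamma>(2\<^bsup>n+1\<^esup>) (q\<^sub>n\<^sub>-\<^sub>1 - q\<^sub>n) / 4\<close> up to terms that are at
  most multiples of \<open>\<bar>q\<^sub>n\<bar>\<close> and \<open>\<bar>q\<^sub>n\<^sub>+\<^sub>1\<bar>\<close>, which cost only a factor \<open>e\<^bsup>Kt\<^esup>\<close>. Convexity of \<open>x \<mapsto> x\<^bsup>-\<delta>\<^esup>\<close> makes \<open>(x\<^sub>n + c t)\<^bsup>-\<delta>\<^esup>\<close> a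
  supersolution of this equation for small \<open>c\<close> (\<open>barrier_supersolution\<close>). The corresponding bound for \<open>p\<^sub>n\<close> is comparable with \<open>2\<^bsup>-\<theta>n\<^esup>\<close> at \<open>t = 0\<close>, and for \<open>t > 0\<close> it is at most a
  multiple of \<open>t\<^bsup>-(\<theta>'-\<theta>)/\<beta>\<^esup> 2\<^bsup>-\<theta>'n\<^esup>\<close> for every \<open>\<theta>'\<close> between \<open>\<theta>\<close> and \<open>\<beta>\<close> (\<open>Dplus_smoothing\<close>).

  Decay. One has \<open>4 (D w)\<^sub>n = F\<^sub>n - F\<^sub>n\<^sub>+\<^sub>1\<close> for the flux \<open>F\<^sub>n = \<gamma>(2\<^sup>n) (w\<^sub>n\<^sub>-\<^sub>1 - \<sigma>\<^sub>n w\<^sub>n)\<close>. A positive \<open>w\<close>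
  whose flux increases fast enough satisfies \<open>D w \<le> -\<nu> w\<close>. Such a \<open>w\<close> is \<open>2\<^bsup>-n\<^esup>\<close> for very negative
  \<open>n\<close>, where \<open>\<sigma>\<^sub>n\<close> is close to \<open>8\<close>, constant for large \<open>n\<close>, and in the finite range in between it is
  computed from a prescribed increasing flux (\<open>decay_supersolution\<close>). Smoothing for half a unit of
  time, decay, and smoothing again for half a unit give the estimate with a rate \<open>\<nu>\<close> that depends
  neither on \<open>\<theta>\<close> nor on \<open>\<theta>'\<close> (\<open>Dplus_estimate\<close>).

  Limits. Since \<open>p\<^sub>n = O(2\<^bsup>-\<beta>n\<^esup>)\<close> at positive times, \<open>y\<^sub>n\<close> converges as \<open>n \<rightarrow> \<infinity>\<close>, and summing the
  differences bounds the distance to the limit. The sequence \<open>z = L y\<close> is bounded at positive times and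
  solves the same linear problem, so \<open>z\<^sub>n\<close> converges by the same argument. As \<open>z\<^sub>n\<close> is
  \<open>-\<gamma>(2\<^sup>n) p\<^sub>n\<^sub>-\<^sub>1 / 4\<close> up to a vanishing term, \<open>2\<^bsup>\<beta>n\<^esup> p\<^sub>n\<close> converges, and so does
  \<open>2\<^bsup>\<beta>n\<^esup> (y\<^sub>n - y\<^sub>\<infinity>)\<close>, with the ratio of limits claimed (\<open>flux_at_infinity\<close>).

  Well-posedness. Solutions are limits of solutions of problems truncated to \<open>[-N, N]\<close>, which form
  a Cauchy sequence by comparison (\<open>tri_solution_exists\<close>); uniqueness is comparison with the zero
  supersolution.

  Coefficients. Three facts on \<open>\<sigma>\<close> enter: positivity, \<open>\<sigma>\<^sub>n \<rightarrow> 8\<close> at \<open>-\<infinity>\<close>, and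
  \<open>\<gamma>(2\<^sup>n) \<sigma>\<^sub>n \<rightarrow> 0\<close> at \<open>+\<infinity>\<close>. The last one needs \<open>A\<^sub>M > 0\<close>, hence that the mass equation has a unique
  positive solution: the mass is a continuous, strictly decreasing function of \<open>A\<close> with
  range \<open>(0, \<infinity>)\<close> (\<open>mass_equation_unique_solution\<close>).
\<close>

section \<open>Tridiagonal systems: comparison and existence\<close>

definition tri :: "(int \<Rightarrow> real) \<Rightarrow> (int \<Rightarrow> real) \<Rightarrow> (int \<Rightarrow> real) \<Rightarrow> (int \<Rightarrow> real) \<Rightarrow> int \<Rightarrow> real" where
  "tri l m u x n = l n * x (n - 1) - m n * x n + u n * x (n + 1)"

lemma tri_add: "tri l m u (\<lambda>n. x n + y n) n = tri l m u x n + tri l m u y n"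
  and tri_diff: "tri l m u (\<lambda>n. x n - y n) n = tri l m u x n - tri l m u y n"
  and tri_cmult: "tri l m u (\<lambda>n. c * x n) n = c * tri l m u x n"
  by (simp_all add: tri_def algebra_simps)

text \<open>If \<open>v\<close> became negative, a small multiple of \<open>exp (K1 * t) * U n\<close> could be added to make it
  positive far out and keep it negative somewhere. The perturbed sequence then has a first zero, at
  which its time derivative must be nonpositive. But all its neighbours are nonnegative there, so
  the differential inequality forces a positive derivative. The index set \<open>I\<close> allows the inequality to
  be known only in a window, which is how the truncated problems are treated.\<close>

lemma tri_comparison:
  fixes v v' :: "real \<Rightarrow> int \<Rightarrow> real"
  assumes l: "\<And>n. 0 \<le> l n" and u: "\<And>n. 0 \<le> u n"
    and U: "\<And>n. 0 < U n" and KU: "\<And>n. n \<in> I \<Longrightarrow> tri l m u U n \<le> K * U n"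
    and der: "\<And>n t. n \<in> I \<Longrightarrow> 0 \<le> t \<Longrightarrow> ((\<lambda>s. v s n) has_real_derivative v' t n) (at t within {0..})"
    and super: "\<And>n t. n \<in> I \<Longrightarrow> 0 \<le> t \<Longrightarrow> tri l m u (v t) n \<le> v' t n"
    and init: "\<And>n. 0 \<le> v 0 n"
    and outside: "\<And>n t. n \<notin> I \<Longrightarrow> 0 \<le> t \<Longrightarrow> 0 \<le> v t n"
    and far: "\<And>T \<epsilon>. 0 \<le> T \<Longrightarrow> 0 < \<epsilon> \<Longrightarrow>
      \<exists>F. finite F \<and> (\<forall>n\<in>I - F. \<forall>t\<in>{0..T}. - \<epsilon> * U n \<le> v t n)"
    and t: "0 \<le> t"
  shows "0 \<le> v t n"
proof (rule ccontr)
  assume neg: "\<not> 0 \<le> v t n"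
  define K1 where "K1 = max K 0 + 1"
  \<comment> \<open>half of what would make the perturbed value at \<open>(t, n)\<close> vanish\<close>
  define \<epsilon> where "\<epsilon> = - v t n / (2 * exp (K1 * t) * U n)"
  define z where "z = (\<lambda>s n. v s n + \<epsilon> * exp (K1 * s) * U n)"
  have e0: "0 < \<epsilon>" using neg U[of n] by (simp add: \<epsilon>_def divide_neg_pos)
  have K1: "K < K1" "0 < K1" by (auto simp: K1_def)
  have ztn: "z t n < 0" using neg U[of n] by (simp add: z_def \<epsilon>_def field_simps)
  obtain F where F: "finite F" "\<And>n s. n \<in> I - F \<Longrightarrow> s \<in> {0..t} \<Longrightarrow> - (\<epsilon>/2) * U n \<le> v s n"
    using far[of t "\<epsilon>/2"] t e0 by auto
  have pos_out: "0 < z s n" if "n \<notin> I \<inter> F" "s \<in> {0..t}" for s n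
  proof (cases "n \<in> I")
    case True
    have "- (\<epsilon>/2) * U n \<le> v s n" using F(2) that True by auto
    moreover have "1 * (\<epsilon> * U n) \<le> exp (K1 * s) * (\<epsilon> * U n)"
      using that K1 e0 U[of n] by (intro mult_right_mono) auto
    moreover have "0 < \<epsilon> * U n" using e0 U[of n] by simp
    ultimately show ?thesis by (simp add: z_def mult_ac)
  next
    case False
    then show ?thesis using outside[of n s] that e0 U[of n] by (simp add: z_def add_nonneg_pos)
  qed
  have der_z: "((\<lambda>s. z s n) has_real_derivative (v' s n + \<epsilon> * (K1 * exp (K1 * s)) * U n)) (at s within {0..})"
    if "n \<in> I" "0 \<le> s" for n s
    unfolding z_def by (auto intro!: derivative_eq_intros der that)
  have cont_z: "continuous_on {0..T} (\<lambda>s. z s n)" if "n \<in> I" for n T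
    by (rule continuous_on_subset[of "{0..}"], rule DERIV_continuous_on[OF der_z])
      (use that in auto)
  have z0: "0 < z 0 n" for n using init[of n] e0 U[of n] by (simp add: z_def add_nonneg_pos)
  \<comment> \<open>the set of times at which some component is nonpositive is compact and nonempty\<close>
  define S where "S = (\<Union>n\<in>I \<inter> F. {s\<in>{0..t}. z s n \<le> 0})"
  have "compact {s\<in>{0..t}. z s n \<le> 0}" if "n \<in> I" for n
  proof -
    have "closed {s\<in>{0..t}. z s n \<le> 0}"
      using continuous_closed_preimage[OF cont_z[OF that], of t "{..0}"]
      by (simp add: vimage_def Int_def)
    then show ?thesis
      using compact_Int_closed[of "{0..t}" "{s\<in>{0..t}. z s n \<le> 0}"]
      by (simp add: Int_def conj_ac)
  qed
  then have "compact S" unfolding S_def using F(1) by (intro compact_UN) auto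
  moreover have "t \<in> S"
    unfolding S_def using pos_out[of n t] ztn t by force
  ultimately obtain t' where t': "t' \<in> S" "\<And>s. s \<in> S \<Longrightarrow> t' \<le> s"
    using compact_attains_inf[of S] by auto
  then obtain n' where n': "n' \<in> I" "n' \<in> F" "0 \<le> t'" "t' \<le> t" "z t' n' \<le> 0"
    by (auto simp: S_def)
  have t'pos: "0 < t'" using z0[of n'] n' by (cases "t' = 0") auto
  have before: "0 < z s n" if "0 \<le> s" "s < t'" for s n
  proof (cases "n \<in> I \<inter> F")
    case True
    then show ?thesis using t'(2)[of s] that n' unfolding S_def by force
  next
    case False then show ?thesis using pos_out[of n s] that n' by auto
  qed
  have at: "0 \<le> z t' n" for n
  proof (cases "n \<in> I \<inter> F")
    case True
    show ?thesis
    proof (rule ccontr)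
      assume "\<not> 0 \<le> z t' n"
      then obtain s where "0 \<le> s" "s \<le> t'" "z s n = 0"
        using IVT2'[of "\<lambda>s. z s n" t' 0 0] z0[of n] cont_z[of n t'] t'pos True by fastforce
      moreover from this \<open>\<not> 0 \<le> z t' n\<close> have "s \<noteq> t'" by auto
      ultimately show False using before[of s n] by auto
    qed
  qed (use pos_out[of n t'] n' in auto)
  have "0 < v' t' n' + \<epsilon> * (K1 * exp (K1 * t')) * U n'"
  proof -
    have "0 \<le> tri l m u (z t') n'"
      using at[of "n' - 1"] at[of "n' + 1"] at[of n'] n' l[of n'] u[of n']
      by (simp add: tri_def)
    also have "\<dots> = tri l m u (v t') n' + \<epsilon> * exp (K1 * t') * tri l m u U n'"
      unfolding z_def by (simp add: tri_add tri_cmult)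
    also have "\<dots> \<le> v' t' n' + \<epsilon> * exp (K1 * t') * (K * U n')"
      using super[of n' t'] n' KU[of n'] e0 by (intro add_mono mult_left_mono) auto
    also have "\<dots> < v' t' n' + \<epsilon> * exp (K1 * t') * (K1 * U n')"
      using e0 K1 U[of n'] by simp
    finally show ?thesis by (simp add: mult_ac)
  qed
  from has_real_derivative_pos_inc_left[OF der_z[OF n'(1,3)] this]
  obtain d where d: "d > 0" "\<And>h. 0 < h \<Longrightarrow> t' - h \<in> {0..} \<Longrightarrow> h < d \<Longrightarrow> z (t' - h) n' < z t' n'"
    by auto
  have "z (t' - min (d/2) t') n' < z t' n'" using d t'pos by (intro d) auto
  moreover have "0 < z (t' - min (d/2) t') n'" using d t'pos by (intro before) auto
  ultimately show False using n' by linarith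
qed

text \<open>The comparison principle for \<open>W - x\<close> and \<open>W + x\<close>.\<close>

lemma tri_abs_comparison:
  fixes x x' W W' :: "real \<Rightarrow> int \<Rightarrow> real"
  assumes l: "\<And>n. 0 \<le> l n" and u: "\<And>n. 0 \<le> u n"
    and U: "\<And>n. 0 < U n" and KU: "\<And>n. n \<in> I \<Longrightarrow> tri l m u U n \<le> K * U n"
    and derx: "\<And>n t. n \<in> I \<Longrightarrow> 0 \<le> t \<Longrightarrow> ((\<lambda>s. x s n) has_real_derivative tri l m u (x t) n) (at t within {0..})"
    and derW: "\<And>n t. n \<in> I \<Longrightarrow> 0 \<le> t \<Longrightarrow> ((\<lambda>s. W s n) has_real_derivative W' t n) (at t within {0..})"
    and super: "\<And>n t. n \<in> I \<Longrightarrow> 0 \<le> t \<Longrightarrow> tri l m u (W t) n \<le> W' t n"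
    and W: "\<And>n t. n \<in> I \<Longrightarrow> 0 \<le> t \<Longrightarrow> 0 \<le> W t n"
    and init: "\<And>n. \<bar>x 0 n\<bar> \<le> W 0 n"
    and outside: "\<And>n t. n \<notin> I \<Longrightarrow> 0 \<le> t \<Longrightarrow> \<bar>x t n\<bar> \<le> W t n"
    and far: "\<And>T \<epsilon>. 0 \<le> T \<Longrightarrow> 0 < \<epsilon> \<Longrightarrow>
      \<exists>F. finite F \<and> (\<forall>n\<in>I - F. \<forall>t\<in>{0..T}. \<bar>x t n\<bar> \<le> \<epsilon> * U n)"
    and t: "0 \<le> t"
  shows "\<bar>x t n\<bar> \<le> W t n"
proof -
  have *: "0 \<le> W t n - c * x t n" if c: "c = 1 \<or> c = -1" for c
  proof (rule tri_comparison[where v = "\<lambda>t n. W t n - c * x t n" and I = I and U = U and K = K and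
        v' = "\<lambda>t n. W' t n - c * tri l m u (x t) n", OF l u U KU _ _ _ _ _ t])
    show "\<exists>F. finite F \<and> (\<forall>n\<in>I - F. \<forall>t\<in>{0..T}. - \<epsilon> * U n \<le> W t n - c * x t n)"
      if T: "0 \<le> T" "0 < \<epsilon>" for T \<epsilon>
    proof -
      from far[OF T] obtain F where F: "finite F" "\<And>n t. n \<in> I - F \<Longrightarrow> t\<in>{0..T} \<Longrightarrow> \<bar>x t n\<bar> \<le> \<epsilon> * U n"
        by blast
      have "- \<epsilon> * U n \<le> W t n - c * x t n" if "n \<in> I - F" "t \<in> {0..T}" for n t
        using F(2)[OF that] W[of n t] that c by auto
      then show ?thesis using F(1) by blast
    qed
  qed (use c super init outside in \<open>auto intro!: derivative_eq_intros derx derW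
        simp: tri_diff tri_cmult tri_add abs_le_iff\<close>)
  show ?thesis using *[of 1] *[of "-1"] by auto
qed

text \<open>When the operator is bounded with respect to the weight \<open>w\<close>, the exponential series
  \<open>\<Sum>k. t\<^sup>k / k! * A\<^sup>k x0\<close> converges in each component and may be differentiated term by term.\<close>

lemma tri_bounded_solution:
  fixes w :: "int \<Rightarrow> real"
  assumes w: "\<And>n. 0 < w n"
    and C: "\<And>n. \<bar>l n\<bar> * w (n - 1) + \<bar>m n\<bar> * w n + \<bar>u n\<bar> * w (n + 1) \<le> C * w n"
    and x0: "\<And>n. \<bar>x0 n\<bar> \<le> B * w n"
  obtains x where "\<And>n. x 0 n = x0 n"
    "\<And>t n. ((\<lambda>s. x s n) has_real_derivative tri l m u (x t) n) (at t)"
proof -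
  have "0 \<le> B * w 0" using x0[of 0] by linarith
  then have B: "0 \<le> B" using w[of 0] by (simp add: zero_le_mult_iff)
  have "0 \<le> \<bar>l 0\<bar> * w (0 - 1) + \<bar>m 0\<bar> * w 0 + \<bar>u 0\<bar> * w (0 + 1)"
    using w by (intro add_nonneg_nonneg mult_nonneg_nonneg) (auto intro: less_imp_le)
  also have "\<dots> \<le> C * w 0" by (rule C)
  finally have C0: "0 \<le> C" using w[of 0] by (simp add: zero_le_mult_iff)
  define c where "c = (\<lambda>k. (tri l m u ^^ k) x0)"
  have cSuc: "c (Suc k) n = tri l m u (c k) n" for k n by (simp add: c_def)
  have bnd: "\<bar>c k n\<bar> \<le> (B * w n) * C ^ k" for k n
  proof (induction k arbitrary: n)
    case 0 then show ?case using x0 by (simp add: c_def)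
  next
    case (Suc k)
    have "\<bar>c (Suc k) n\<bar> \<le> \<bar>l n * c k (n - 1)\<bar> + \<bar>m n * c k n\<bar> + \<bar>u n * c k (n + 1)\<bar>"
      unfolding cSuc tri_def by linarith
    also have "\<dots> \<le> \<bar>l n\<bar> * ((B * w (n - 1)) * C ^ k) + \<bar>m n\<bar> * ((B * w n) * C ^ k)
        + \<bar>u n\<bar> * ((B * w (n + 1)) * C ^ k)"
      unfolding abs_mult by (intro add_mono mult_left_mono Suc.IH) auto
    also have "\<dots> = B * C ^ k * (\<bar>l n\<bar> * w (n - 1) + \<bar>m n\<bar> * w n + \<bar>u n\<bar> * w (n + 1))"
      by (simp add: algebra_simps)
    also have "\<dots> \<le> B * C ^ k * (C * w n)"
      using C[of n] B C0 by (intro mult_left_mono) auto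
    finally show ?case by (simp add: mult_ac)
  qed
  have summ: "summable (\<lambda>k. c k n / fact k * t ^ k)" for n and t :: real
  proof (rule summable_comparison_test')
    show "summable (\<lambda>k. (B * w n) * (inverse (fact k) * (C * \<bar>t\<bar>) ^ k))"
      by (intro summable_mult summable_exp)
    show "norm (c k n / fact k * t ^ k) \<le> (B * w n) * (inverse (fact k) * (C * \<bar>t\<bar>) ^ k)" for k
      using mult_right_mono[OF bnd[of k n], of "\<bar>t\<bar> ^ k / fact k"]
      by (simp add: abs_mult power_abs power_mult_distrib field_simps)
  qed
  define x where "x = (\<lambda>t n. \<Sum>k. c k n / fact k * t ^ k)"
  have "((\<lambda>s. x s n) has_real_derivative tri l m u (x t) n) (at t)" for t n
  proof -
    have D: "diffs (\<lambda>k. c k n / fact k) k = tri l m u (c k) n / fact k" for k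
      by (simp add: diffs_def cSuc del: of_nat_Suc)
    have S: "(\<lambda>k. c k n / fact k * t ^ k) sums x t n" for n
      unfolding x_def by (rule summable_sums[OF summ])
    have "(\<lambda>k. l n * (c k (n-1) / fact k * t ^ k) - m n * (c k n / fact k * t ^ k)
          + u n * (c k (n+1) / fact k * t ^ k)) sums tri l m u (x t) n"
      unfolding tri_def by (intro sums_add sums_diff sums_mult S)
    then have "(\<lambda>k. diffs (\<lambda>k. c k n / fact k) k * t ^ k) sums tri l m u (x t) n"
      unfolding D by (rule sums_cong[THEN iffD1, rotated])
        (simp add: tri_def add_divide_distrib diff_divide_distrib algebra_simps)
    then have "(\<Sum>k. diffs (\<lambda>k. c k n / fact k) k * t ^ k) = tri l m u (x t) n"
      by (rule sums_unique[symmetric])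
    then show ?thesis
      using termdiffs_strong_converges_everywhere[of "\<lambda>k. c k n / fact k" t] summ
      by (simp add: x_def)
  qed
  moreover have "x 0 n = x0 n" for n
    using powser_zero[of "\<lambda>k. c k n / fact k"] by (simp add: x_def c_def)
  ultimately show ?thesis by (rule that[rotated])
qed

text \<open>Outside the window \<open>[-N, N]\<close> the truncated solutions stay equal to the initial datum, so two of
  them differ there by at most a multiple of \<open>w\<close>, which is small compared with \<open>U\<close>. Comparison with
  \<open>\<epsilon> * exp (K * t) * U n\<close> carries this smallness into the window. Hence the truncated
  solutions and their time derivatives converge locally uniformly in time.\<close>

lemma tri_solution_exists:
  fixes w U :: "int \<Rightarrow> real"
  assumes l: "\<And>n. 0 \<le> l n" and u: "\<And>n. 0 \<le> u n"
    and w: "\<And>n. 0 < w n" and Kw: "\<And>n. tri l m u w n \<le> K * w n"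
    and U: "\<And>n. 0 < U n" and KU: "\<And>n. tri l m u U n \<le> K * U n"
    and K: "0 \<le> K"
    and far: "\<And>\<epsilon>. 0 < \<epsilon> \<Longrightarrow> finite {n. \<not> w n \<le> \<epsilon> * U n}"
    and x0: "\<And>n. \<bar>x0 n\<bar> \<le> B * w n"
  obtains x where "\<And>n. x 0 n = x0 n"
    "\<And>t n. 0 \<le> t \<Longrightarrow> ((\<lambda>s. x s n) has_real_derivative tri l m u (x t) n) (at t within {0..})"
    "\<And>t n. 0 \<le> t \<Longrightarrow> \<bar>x t n\<bar> \<le> B * exp (K * t) * w n"
proof -
  have "0 \<le> B * w 0" using x0[of 0] by linarith
  then have B: "0 \<le> B" using w[of 0] by (simp add: zero_le_mult_iff)
  define J where "J = (\<lambda>N::nat. {- int N..int N})"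
  define cut where "cut = (\<lambda>N (f::int\<Rightarrow>real) n. if n \<in> J N then f n else 0)"
  define A where "A = (\<lambda>N. tri (cut N l) (cut N m) (cut N u))"
  have A_in: "A N x n = tri l m u x n" if "n \<in> J N" for N x n using that by (simp add: A_def tri_def cut_def)
  have A_out: "A N x n = 0" if "n \<notin> J N" for N x n using that by (simp add: A_def tri_def cut_def)
  have "\<exists>x. (\<forall>n. x 0 n = x0 n) \<and> (\<forall>t n. ((\<lambda>s. x s n) has_real_derivative A N (x t) n) (at t))" for N
  proof -
    define h where "h = (\<lambda>n. (\<bar>l n\<bar> * w (n - 1) + \<bar>m n\<bar> * w n + \<bar>u n\<bar> * w (n + 1)) / w n)"
    have h0: "0 \<le> h n" for n unfolding h_def using w
      by (intro divide_nonneg_pos add_nonneg_nonneg mult_nonneg_nonneg) (auto intro: less_imp_le)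
    have cutb: "\<bar>cut N l n\<bar> * w (n - 1) + \<bar>cut N m n\<bar> * w n + \<bar>cut N u n\<bar> * w (n + 1) \<le> (\<Sum>n\<in>J N. h n) * w n" for n
    proof (cases "n \<in> J N")
      case True
      then have "h n \<le> (\<Sum>n\<in>J N. h n)" using h0 by (intro member_le_sum) (auto simp: J_def)
      then have "h n * w n \<le> (\<Sum>n\<in>J N. h n) * w n" using w[of n] by (intro mult_right_mono) auto
      moreover have "h n * w n = \<bar>l n\<bar> * w (n - 1) + \<bar>m n\<bar> * w n + \<bar>u n\<bar> * w (n + 1)"
        using w[of n] by (simp add: h_def)
      ultimately show ?thesis using True by (simp add: cut_def)
    next
      case False
      then show ?thesis using w[of n] h0 by (simp add: cut_def sum_nonneg)
    qed
    show ?thesis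
    proof (rule tri_bounded_solution[of w "cut N l" "cut N m" "cut N u", OF w cutb x0])
      fix x :: "real \<Rightarrow> int \<Rightarrow> real"
      assume x: "\<And>n. x 0 n = x0 n"
        "\<And>t n. ((\<lambda>s. x s n) has_real_derivative tri (cut N l) (cut N m) (cut N u) (x t) n) (at t)"
      show ?thesis unfolding A_def by (rule exI[of _ x]) (intro conjI allI x)
    qed
  qed
  then have "\<forall>N. \<exists>x. (\<forall>n. x 0 n = x0 n) \<and> (\<forall>t n. ((\<lambda>s. x s n) has_real_derivative A N (x t) n) (at t))"
    by (rule allI)
  from choice[OF this] obtain X where X:
    "\<forall>N. (\<forall>n. X N 0 n = x0 n) \<and> (\<forall>t n. ((\<lambda>s. X N s n) has_real_derivative A N (X N t) n) (at t))"
    by (rule exE)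
  have X0: "X N 0 n = x0 n"
    and dX: "((\<lambda>s. X N s n) has_real_derivative A N (X N t) n) (at t)" for N t n
    using X[rule_format, of N] by simp_all
  have X_out: "X N t n = x0 n" if "n \<notin> J N" for N t n
  proof -
    have "((\<lambda>s. X N s n) has_real_derivative 0) (at t)" for t using dX[of N n t] A_out[OF that] by simp
    then have "\<forall>t. ((\<lambda>s. X N s n) has_real_derivative 0) (at t)" by (rule allI)
    from DERIV_isconst_all[OF this, of t 0] show ?thesis by (simp add: X0)
  qed
  have dX': "((\<lambda>s. X N s n) has_real_derivative tri l m u (X N t) n) (at t within S)"
    if "n \<in> J N" for N t n S
    using dX[of N n t] A_in[OF that] by (auto intro: DERIV_subset)
  have X_bd: "\<bar>X N t n\<bar> \<le> B * exp (K * t) * w n" if t: "0 \<le> t" for N t n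
  proof (rule tri_abs_comparison[where U = U and K = K and I = "J N" and l = l and m = m and u = u
        and W' = "\<lambda>t n. B * (K * exp (K * t)) * w n" and W = "\<lambda>t n. B * exp (K * t) * w n"])
    show "tri l m u (\<lambda>n. B * exp (K * t) * w n) n \<le> B * (K * exp (K * t)) * w n" for t n
      using mult_left_mono[OF Kw[of n], of "B * exp (K * t)"] B
      unfolding tri_cmult by (simp add: mult_ac)
    show "\<bar>X N t n\<bar> \<le> B * exp (K * t) * w n" if "n \<notin> J N" "0 \<le> t" for t n
    proof -
      have "\<bar>X N t n\<bar> \<le> B * 1 * w n" using X_out[OF that(1)] x0 by simp
      also have "\<dots> \<le> B * exp (K * t) * w n"
        using B K that w[of n] by (intro mult_mono) auto
      finally show ?thesis .
    qed
    show "\<exists>F. finite F \<and> (\<forall>n\<in>J N - F. \<forall>t\<in>{0..T}. \<bar>X N t n\<bar> \<le> \<epsilon> * U n)" for T \<epsilon>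
      by (rule exI[of _ "J N"]) (simp add: J_def)
  qed (use l u U KU x0 X0 B w t less_imp_le[OF w] in \<open>auto intro!: derivative_eq_intros dX'\<close>)
  \<comment> \<open>the truncated solutions are Cauchy because the data beyond the truncation is small against U\<close>
  have cau: "\<exists>N0. \<forall>N\<ge>N0. \<forall>M\<ge>N. \<forall>t\<in>{0..T}. \<bar>X N t n - X M t n\<bar> \<le> \<epsilon> * U n"
    if T: "0 \<le> T" and \<epsilon>: "0 < \<epsilon>" for T \<epsilon> n
  proof -
    define \<eta> where "\<eta> = \<epsilon> * exp (- (K * T))"
    have \<eta>: "0 < \<eta>" using \<epsilon> by (simp add: \<eta>_def)
    define \<epsilon>1 where "\<epsilon>1 = \<eta> / (2 * (B + 1))"
    have e1: "0 < \<epsilon>1" using \<eta> B by (simp add: \<epsilon>1_def)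
    have eq1: "2 * (B + 1) * \<epsilon>1 = \<eta>"
      using B unfolding \<epsilon>1_def by (intro nonzero_mult_div_cancel_left[of "2 * (B + 1)", unfolded times_divide_eq_right[symmetric]]) auto
    define N0 where "N0 = nat (Max (insert 0 (abs ` {n. \<not> w n \<le> \<epsilon>1 * U n})))"
    have small: "w n \<le> \<epsilon>1 * U n" if "N0 \<le> N" "n \<notin> J N" for n N
    proof (rule ccontr)
      assume "\<not> ?thesis"
      then have "\<bar>n\<bar> \<le> Max (insert 0 (abs ` {n. \<not> w n \<le> \<epsilon>1 * U n}))"
        using far[OF e1] by (intro Max_ge) auto
      then have "\<bar>n\<bar> \<le> int N0" unfolding N0_def by linarith
      with that show False by (auto simp: J_def)
    qed
    have "\<bar>X N t n - X M t n\<bar> \<le> \<eta> * exp (K * t) * U n"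
      if N: "N0 \<le> N" "N \<le> M" and t: "t \<in> {0..T}" for N M t
    proof -
      have out: "\<bar>X N t n - X M t n\<bar> \<le> \<eta> * exp (K * t) * U n"
        if n: "n \<notin> J N" "0 \<le> t" for n t
      proof -
        have "\<bar>X N t n - X M t n\<bar> \<le> B * exp (K * t) * w n + B * exp (K * t) * w n"
          using X_bd[of t N n] X_bd[of t M n] n by linarith
        also have "\<dots> \<le> 2 * (B + 1) * exp (K * t) * w n" using w[of n] by (simp add: algebra_simps)
        also have "\<dots> \<le> 2 * (B + 1) * exp (K * t) * (\<epsilon>1 * U n)"
          using B small[OF N(1) n(1)] by (intro mult_left_mono) auto
        also have "\<dots> = \<eta> * exp (K * t) * U n"
          unfolding eq1[symmetric] by (simp add: mult_ac)
        finally show ?thesis .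
      qed
      have JNM: "n \<in> J M" if "n \<in> J N" for n using that N by (auto simp: J_def)
      show ?thesis
      proof (rule tri_abs_comparison[where x = "\<lambda>t n. X N t n - X M t n" and U = U and K = K and I = "J N"
          and l = l and m = m and u = u
          and W = "\<lambda>t n. \<eta> * exp (K * t) * U n"
          and W' = "\<lambda>t n. \<eta> * (K * exp (K * t)) * U n"])
        show "tri l m u (\<lambda>n. \<eta> * exp (K * t) * U n) n
          \<le> \<eta> * (K * exp (K * t)) * U n" for t n
          using mult_left_mono[OF KU[of n], of "\<eta> * exp (K * t)"] \<eta>
          unfolding tri_cmult by (simp add: mult_ac)
        show "\<exists>F. finite F \<and> (\<forall>n\<in>J N - F. \<forall>t\<in>{0..T}. \<bar>X N t n - X M t n\<bar> \<le> \<epsilon> * U n)" for T \<epsilon>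
          by (rule exI[of _ "J N"]) (simp add: J_def)
      qed (use l u U KU X0 \<eta> t out less_imp_le[OF U] in \<open>auto intro!: derivative_eq_intros dX' JNM simp: tri_diff\<close>)
    qed
    moreover have "\<eta> * exp (K * t) * U n \<le> \<epsilon> * U n" if "t \<in> {0..T}" for t
    proof -
      have "exp (- (K * T)) * exp (K * t) \<le> 1"
        using that K by (simp add: exp_minus divide_simps mult_left_mono flip: exp_diff)
      then have "(\<epsilon> * U n) * (exp (- (K * T)) * exp (K * t)) \<le> (\<epsilon> * U n) * 1"
        using \<epsilon> U[of n] by (intro mult_left_mono) auto
      then show ?thesis by (simp add: \<eta>_def mult_ac)
    qed
    ultimately show ?thesis by (meson order_trans)
  qed
  have unif: "uniformly_convergent_on {0..T} (\<lambda>N t. X N t n)" if T: "0 \<le> T" for T n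
    unfolding uniformly_convergent_eq_Cauchy uniformly_Cauchy_on_def
  proof (intro allI impI)
    fix e :: real assume e: "0 < e"
    obtain N0 where N0: "\<And>N M t. N0 \<le> N \<Longrightarrow> N \<le> M \<Longrightarrow> t \<in> {0..T} \<Longrightarrow> \<bar>X N t n - X M t n\<bar> \<le> e / (2 * U n) * U n"
      using cau[OF T, of "e / (2 * U n)" n] e U[of n] by (meson divide_pos_pos mult_pos_pos zero_less_numeral)
    have "\<bar>X N t n - X M t n\<bar> < e" if "N0 \<le> N" "N0 \<le> M" "t \<in> {0..T}" for N M t
      using N0[of N M t] N0[of M N t] that U[of n] e abs_minus_commute[of "X N t n" "X M t n"] by (cases "N \<le> M") auto
    then show "\<exists>M. \<forall>x\<in>{0..T}. \<forall>m\<ge>M. \<forall>na\<ge>M. dist (X m x n) (X na x n) < e"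
      by (intro exI[of _ N0]) (auto simp: dist_real_def)
  qed
  define x where "x = (\<lambda>t n. lim (\<lambda>N. X N t n))"
  have ulim: "uniform_limit {0..T} (\<lambda>N t. X N t n) (\<lambda>t. x t n) sequentially" if "0 \<le> T" for T n
    using unif[OF that] unfolding uniformly_convergent_uniform_limit_iff x_def by simp
  have xlim: "(\<lambda>N. X N t n) \<longlonglongrightarrow> x t n" if "0 \<le> t" for t n
    using tendsto_uniform_limitI[OF ulim[OF that]] that by auto
  show ?thesis
  proof (rule that)
    show "x 0 n = x0 n" for n using xlim[of 0 n] X0 by (simp add: LIMSEQ_const_iff)
    show "\<bar>x t n\<bar> \<le> B * exp (K * t) * w n" if "0 \<le> t" for t n
      by (rule LIMSEQ_le_const2[OF tendsto_rabs[OF xlim[OF that]]]) (use X_bd[OF that] in auto)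
    show "((\<lambda>s. x s n) has_real_derivative tri l m u (x t) n) (at t within {0..})" if t: "0 \<le> t" for t n
    proof -
      define N1 where "N1 = nat \<bar>n\<bar>"
      have nJ: "n \<in> J (N + N1)" for N by (auto simp: J_def N1_def)
      have ulA: "uniform_limit {0..t+1} (\<lambda>N s. tri l m u (X N s) n) (\<lambda>s. tri l m u (x s) n) sequentially"
        unfolding tri_def using t
        by (intro uniform_limit_add uniform_limit_minus bounded_linear.uniform_limit[OF bounded_linear_mult_right] ulim) auto
      have "\<exists>g. \<forall>s\<in>{0..t+1}. (\<lambda>N. X (N + N1) s n) \<longlonglongrightarrow> g s \<and>
            (g has_derivative (\<lambda>h. tri l m u (x s) n * h)) (at s within {0..t+1})"
      proof (rule has_derivative_sequence[where ?x0.0 = 0 and l = "x 0 n" and f' = "\<lambda>N s h. tri l m u (X (N + N1) s) n * h"])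
        show "((\<lambda>s. X (N + N1) s n) has_derivative (*) (tri l m u (X (N + N1) s) n)) (at s within {0..t+1})" for N s
          using dX'[OF nJ] by (simp add: has_field_derivative_def)
        show "\<forall>\<^sub>F N in sequentially. \<forall>s\<in>{0..t+1}. \<forall>h. norm (tri l m u (X (N + N1) s) n * h - tri l m u (x s) n * h) \<le> e * norm h"
          if e: "0 < e" for e
        proof -
          have "\<forall>\<^sub>F N in sequentially. \<forall>s\<in>{0..t+1}. dist (tri l m u (X (N + N1) s) n) (tri l m u (x s) n) < e"
            using uniform_limitD[OF ulA e]
            eventually_sequentially_seg[of "\<lambda>N. \<forall>s\<in>{0..t+1}. dist (tri l m u (X N s) n) (tri l m u (x s) n) < e" N1]
            by blast
          then show ?thesis
            by (rule eventually_mono) (auto simp: dist_real_def abs_mult less_imp_le simp flip: left_diff_distrib intro!: mult_right_mono)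
        qed
        show "(\<lambda>N. X (N + N1) 0 n) \<longlonglongrightarrow> x 0 n" using xlim[of 0 n] by (intro LIMSEQ_ignore_initial_segment) auto
      qed (use t in auto)
      then obtain g where g: "\<And>s. s\<in>{0..t+1} \<Longrightarrow> (\<lambda>N. X (N + N1) s n) \<longlonglongrightarrow> g s"
        "\<And>s. s\<in>{0..t+1} \<Longrightarrow> (g has_derivative (\<lambda>h. tri l m u (x s) n * h)) (at s within {0..t+1})" by blast
      have gx: "g s = x s n" if "s \<in> {0..t+1}" for s
        using g(1)[OF that] LIMSEQ_ignore_initial_segment[OF xlim[of s n], where k = N1] that by (auto intro: LIMSEQ_unique)
      have "((\<lambda>s. x s n) has_derivative (\<lambda>h. tri l m u (x t) n * h)) (at t within {0..t+1})"
        by (rule has_derivative_transform[OF _ _ g(2)]) (use gx t in auto)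
      then have "((\<lambda>s. x s n) has_real_derivative tri l m u (x t) n) (at t within {0..t+1})"
        by (simp add: has_field_derivative_def)
      moreover have "at t within {0..t+1} = at t within {0..}"
        by (rule at_within_nhd[of _ "{..<t+1}"]) auto
      ultimately show ?thesis by simp
    qed
  qed
qed

section \<open>Two-sided sequences and weights\<close>

lemma int_finite_of_eventually:
  fixes P :: "int \<Rightarrow> bool"
  assumes "eventually P at_top" "eventually P at_bot"
  shows "finite {n. \<not> P n}"
proof -
  obtain a b where "\<And>n. a \<le> n \<Longrightarrow> P n" "\<And>n. n \<le> b \<Longrightarrow> P n"
    using assms by (auto simp: eventually_at_top_linorder eventually_at_bot_linorder)
  then have "{n. \<not> P n} \<subseteq> {b..a}" by (intro subsetI) (simp, meson linear)
  then show ?thesis by (rule finite_subset) simp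
qed

lemma pos_bounds_finite:
  fixes f :: "int \<Rightarrow> real"
  assumes pos: "\<And>n. n \<in> S \<Longrightarrow> 0 < f n" and fin: "finite {n \<in> S. \<not> (a \<le> f n \<and> f n \<le> b)}" and a: "0 < a"
  obtains c C where "0 < c" "0 < C" "\<And>n. n \<in> S \<Longrightarrow> c \<le> f n" "\<And>n. n \<in> S \<Longrightarrow> f n \<le> C"
proof -
  define E where "E = {n \<in> S. \<not> (a \<le> f n \<and> f n \<le> b)}"
  define c where "c = Min (insert a (f ` E))"
  define C where "C = Max (insert a (insert b (f ` E)))"
  have E: "finite E" using fin by (simp add: E_def)
  show ?thesis
  proof (rule that[of c C])
    show "0 < c" unfolding c_def using E a pos by (subst Min_gr_iff) (auto simp: E_def)
    have "a \<le> C" unfolding C_def using E by (intro Max_ge) auto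
    then show "0 < C" using a by linarith
    show "c \<le> f n" if "n \<in> S" for n
    proof (cases "n \<in> E")
      case True then show ?thesis unfolding c_def using E by (intro Min_le) auto
    next
      case False
      moreover have "c \<le> a" unfolding c_def using E by (intro Min_le) auto
      ultimately show ?thesis using that by (auto simp: E_def)
    qed
    show "f n \<le> C" if "n \<in> S" for n
    proof (cases "n \<in> E")
      case True then show ?thesis unfolding C_def using E by (intro Max_ge) auto
    next
      case False
      moreover have "b \<le> C" unfolding C_def using E by (intro Max_ge) auto
      ultimately show ?thesis using that by (auto simp: E_def)
    qed
  qed
qed

lemma pos_bounds_at_top:
  fixes f :: "int \<Rightarrow> real"
  assumes pos: "\<And>n. 0 < f n" and lim: "(f \<longlongrightarrow> L) at_top" "0 < L"
  obtains c C where "0 < c" "0 < C" "\<And>n. N \<le> n \<Longrightarrow> c \<le> f n" "\<And>n. N \<le> n \<Longrightarrow> f n \<le> C"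
proof -
  obtain b where "\<And>n. b \<le> n \<Longrightarrow> L/2 < f n \<and> f n < 2*L"
    using eventually_conj[OF order_tendstoD(1)[OF lim(1), of "L/2"] order_tendstoD(2)[OF lim(1), of "2*L"]] lim(2)
    by (auto simp: eventually_at_top_linorder)
  then have "{n \<in> {N..}. \<not> (L/2 \<le> f n \<and> f n \<le> 2*L)} \<subseteq> {N..b}"
    by (intro subsetI) (simp, meson linear less_imp_le)
  then have "finite {n \<in> {N..}. \<not> (L/2 \<le> f n \<and> f n \<le> 2*L)}" by (rule finite_subset) simp
  then show ?thesis
  proof (rule pos_bounds_finite[rotated])
    fix c C :: real
    assume "0 < c" "0 < C" "\<And>n. n \<in> {N..} \<Longrightarrow> c \<le> f n" "\<And>n. n \<in> {N..} \<Longrightarrow> f n \<le> C"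
    then show ?thesis using that[of c C] by simp
  qed (use pos lim(2) in auto)
qed

lemma pos_bounds_at_bot:
  fixes f :: "int \<Rightarrow> real"
  assumes pos: "\<And>n. 0 < f n" and lim: "(f \<longlongrightarrow> L) at_bot" "0 < L"
  obtains c C where "0 < c" "0 < C" "\<And>n. n \<le> N \<Longrightarrow> c \<le> f n" "\<And>n. n \<le> N \<Longrightarrow> f n \<le> C"
proof (rule pos_bounds_at_top[of "\<lambda>n. f (- n)" L "- N"])
  show "((\<lambda>n. f (- n)) \<longlongrightarrow> L) at_top" using lim(1) by (simp add: at_bot_mirror filterlim_filtermap)
  fix c C assume "0 < c" "0 < C" and c: "\<And>n. - N \<le> n \<Longrightarrow> c \<le> f (- n)" and C: "\<And>n. - N \<le> n \<Longrightarrow> f (- n) \<le> C"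
  then show ?thesis using that[of c C] c[of "- n" for n] C[of "- n" for n] by simp
qed (use pos lim in auto)

lemma bounded_of_limits:
  fixes f :: "int \<Rightarrow> real"
  assumes "(f \<longlongrightarrow> a) at_top" "(f \<longlongrightarrow> b) at_bot"
  obtains B where "\<And>n. \<bar>f n\<bar> \<le> B"
proof -
  define E where "E = {n. \<not> \<bar>f n\<bar> < \<bar>a\<bar> + \<bar>b\<bar> + 1}"
  have 1: "eventually (\<lambda>n. \<bar>f n\<bar> < \<bar>a\<bar> + \<bar>b\<bar> + 1) at_top"
    by (rule order_tendstoD(2)[OF tendsto_rabs[OF assms(1)]]) linarith
  have 2: "eventually (\<lambda>n. \<bar>f n\<bar> < \<bar>a\<bar> + \<bar>b\<bar> + 1) at_bot"
    by (rule order_tendstoD(2)[OF tendsto_rabs[OF assms(2)]]) linarith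
  have fin: "finite E" unfolding E_def by (rule int_finite_of_eventually[OF 1 2])
  show ?thesis
  proof (rule that)
    fix n
    show "\<bar>f n\<bar> \<le> \<bar>a\<bar> + \<bar>b\<bar> + 1 + (\<Sum>n\<in>E. \<bar>f n\<bar>)"
    proof (cases "n \<in> E")
      case True
      have "\<bar>f n\<bar> \<le> (\<Sum>n\<in>E. \<bar>f n\<bar>)" using fin True by (intro member_le_sum) auto
      then show ?thesis by linarith
    next
      case False
      moreover have "0 \<le> (\<Sum>n\<in>E. \<bar>f n\<bar>)" by (intro sum_nonneg) auto
      moreover have "\<bar>f n\<bar> < \<bar>a\<bar> + \<bar>b\<bar> + 1" using False unfolding E_def by blast
      ultimately show ?thesis by linarith
    qed
  qed
qed

abbreviation "two_to n \<equiv> 2 powr real_of_int n"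

abbreviation "dyad a n \<equiv> 2 powr (a * real_of_int n)"

lemma powr_int_tendsto_0_at_top:
  assumes "0 < a" shows "((\<lambda>n::int. 2 powr (- a * real_of_int n)) \<longlongrightarrow> (0::real)) at_top"
proof -
  have "filterlim (\<lambda>n::int. a * real_of_int n) at_top at_top"
    by (rule filterlim_tendsto_pos_mult_at_top[OF tendsto_const assms filterlim_real_of_int_at_top])
  then have "filterlim (\<lambda>n::int. - (a * real_of_int n)) at_bot at_top"
    by (simp add: filterlim_uminus_at_top)
  from filterlim_compose[OF exp_at_bot filterlim_tendsto_pos_mult_at_bot[OF tendsto_const _ this, of "ln 2"]]
  show ?thesis by (simp add: powr_def mult_ac)
qed

lemma powr_int_tendsto_0_at_bot:
  assumes "0 < a" shows "((\<lambda>n::int. dyad a n) \<longlongrightarrow> (0::real)) at_bot"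
  using powr_int_tendsto_0_at_top[OF assms] by (simp add: at_bot_mirror filterlim_filtermap)

lemma filterlim_int_shift:
  "filterlim (\<lambda>n::int. n + k) at_top at_top" "filterlim (\<lambda>n::int. n + k) at_bot at_bot"
proof -
  have "\<exists>N. \<forall>n\<ge>N. Z \<le> n + k" for Z by (intro exI[of _ "Z - k"]) auto
  then show "filterlim (\<lambda>n::int. n + k) at_top at_top"
    unfolding filterlim_at_top eventually_at_top_linorder by blast
  have "\<exists>N. \<forall>n\<le>N. n + k \<le> Z" for Z by (intro exI[of _ "Z - k"]) auto
  then show "filterlim (\<lambda>n::int. n + k) at_bot at_bot"
    unfolding filterlim_at_bot eventually_at_bot_linorder by blast
qed

lemmas tendsto_int_shift =
  filterlim_compose[OF _ filterlim_int_shift(1)] filterlim_compose[OF _ filterlim_int_shift(2)]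

lemma tendsto_ratio_of_power_like:
  fixes f :: "int \<Rightarrow> real"
  assumes f: "((\<lambda>n. f n / dyad a n) \<longlongrightarrow> 1) at_top"
  shows "((\<lambda>n. f (n + 1) / f n) \<longlongrightarrow> 2 powr a) at_top"
proof -
  have "((\<lambda>n. 2 powr a * (f (n + 1) / dyad a (n + 1)) / (f n / dyad a n)) \<longlongrightarrow> 2 powr a * 1 / 1) at_top"
    by (intro tendsto_mult tendsto_divide tendsto_const tendsto_int_shift(1)[OF f] f) simp
  then show ?thesis by (simp add: distrib_left powr_add)
qed

text \<open>The reciprocal of the weight that defines the norm of \<open>\<Y>\<^sub>\<theta>\<close>.\<close>

definition wt :: "real \<Rightarrow> int \<Rightarrow> real" where
  "wt \<theta> n = (if n \<le> 0 then 2 powr (- real_of_int n) else dyad (- \<theta>) n)"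

lemma wt_pos: "0 < wt \<theta> n"
  by (simp add: wt_def)

abbreviation bounded_upto :: "real \<Rightarrow> real \<Rightarrow> (real \<Rightarrow> int \<Rightarrow> real) \<Rightarrow> bool" where
  "bounded_upto T \<rho> y \<equiv> \<exists>B. \<forall>t\<in>{0..T}. \<forall>n. \<bar>y t n\<bar> \<le> B * wt \<rho> n"

lemma wt_antimono: "\<theta> \<le> \<theta>' \<Longrightarrow> wt \<theta>' n \<le> wt \<theta> n"
  by (simp add: wt_def mult_right_mono)

lemma wt_bound_nonneg:
  assumes "\<And>n. \<bar>y n\<bar> \<le> B * wt \<theta> n"
  shows "0 \<le> (B::real)"
proof -
  have "0 \<le> B * wt \<theta> 0" using assms[of 0] by linarith
  then show ?thesis using wt_pos[of \<theta> 0] by (simp add: zero_le_mult_iff)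
qed

text \<open>A weight that grows faster than every \<open>wt \<rho>\<close> with \<open>\<rho> > -1\<close>, both at \<open>-\<infinity>\<close> and at
  \<open>+\<infinity>\<close>, and is still mapped by the two operators below to at most a multiple of itself.\<close>

definition growth :: "int \<Rightarrow> real" where
  "growth n = (if 0 \<le> n then two_to n else dyad (- 2) n)"

lemma growth_pos: "0 < growth n"
  by (simp add: growth_def)

lemma wt_small_growth:
  assumes \<rho>: "- 1 < \<rho>" and \<epsilon>: "0 < \<epsilon>"
  shows "finite {n. \<not> B * wt \<rho> n \<le> \<epsilon> * growth n}"
proof (rule int_finite_of_eventually)
  have "((\<lambda>n::int. B * dyad (- (1 + \<rho>)) n) \<longlongrightarrow> B * 0) at_top"
    using \<rho> by (intro tendsto_mult tendsto_const powr_int_tendsto_0_at_top) auto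
  then have "eventually (\<lambda>n::int. B * dyad (- (1 + \<rho>)) n < \<epsilon>) at_top"
    using \<epsilon> by (intro order_tendstoD(2)) auto
  then show "eventually (\<lambda>n. B * wt \<rho> n \<le> \<epsilon> * growth n) at_top"
    using eventually_gt_at_top[of 0]
  proof eventually_elim
    case (elim n)
    have "wt \<rho> n = dyad (- (1 + \<rho>)) n * growth n"
      using elim by (simp add: wt_def growth_def algebra_simps flip: powr_add)
    then show ?case using mult_right_mono[of "B * dyad (- (1 + \<rho>)) n" \<epsilon> "growth n"] elim
      by (simp add: growth_pos less_imp_le mult_ac)
  qed
  have "((\<lambda>n::int. B * dyad 1 n) \<longlongrightarrow> B * 0) at_bot"
    by (intro tendsto_mult tendsto_const powr_int_tendsto_0_at_bot) auto
  then have "eventually (\<lambda>n::int. B * dyad 1 n < \<epsilon>) at_bot"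
    using \<epsilon> by (intro order_tendstoD(2)) auto
  then show "eventually (\<lambda>n. B * wt \<rho> n \<le> \<epsilon> * growth n) at_bot"
    using eventually_le_at_bot[of "-1"]
  proof eventually_elim
    case (elim n)
    have "wt \<rho> n = dyad 1 n * growth n"
      using elim by (simp add: wt_def growth_def flip: powr_add)
    then show ?case using mult_right_mono[of "B * dyad 1 n" \<epsilon> "growth n"] elim
      by (simp add: growth_pos less_imp_le mult_ac)
  qed
qed

section \<open>The operator of the linear problem\<close>

text \<open>Here \<open>g n\<close> and \<open>s n\<close> stand for \<open>\<gamma>(2\<^sup>n)\<close> and \<open>\<sigma>\<^sub>n\<close>. The linear operator is the generator of a
  birth-death chain that jumps down at rate \<open>g n / 4\<close> and up at rate \<open>g n * s n / 4\<close>.\<close>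

locale chain =
  fixes g s :: "int \<Rightarrow> real" and \<beta> g0 :: real
  assumes beta: "0 < \<beta>" and g_pos: "\<And>n. 0 < g n" and s_pos: "\<And>n. 0 < s n"
    and g_top: "((\<lambda>n. g n / dyad \<beta> n) \<longlongrightarrow> 1) at_top"
    and g_bot: "(g \<longlongrightarrow> g0) at_bot" and g0: "0 < g0"
    and s_bot: "(s \<longlongrightarrow> 8) at_bot"
    and gs_top: "((\<lambda>n. g n * s n) \<longlongrightarrow> 0) at_top"
begin

definition L :: "(int \<Rightarrow> real) \<Rightarrow> int \<Rightarrow> real" where
  "L = tri (\<lambda>n. g n / 4) (\<lambda>n. (g n + g n * s n) / 4) (\<lambda>n. g n * s n / 4)"

text \<open>The operator that governs the differences of a solution: \<open>D (Dplus y) = Dplus (L y)\<close>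
  (\<open>D_Dplus\<close>).\<close>

definition D :: "(int \<Rightarrow> real) \<Rightarrow> int \<Rightarrow> real" where
  "D = tri (\<lambda>n. g n / 4) (\<lambda>n. (g (n + 1) + g n * s n) / 4) (\<lambda>n. g (n + 1) * s (n + 1) / 4)"

lemma L_eq: "L y n = g n / 4 * (y (n - 1) - y n - s n * (y n - y (n + 1)))"
  by (simp add: L_def tri_def algebra_simps add_divide_distrib diff_divide_distrib)

lemma L_Dplus: "L y n = g n / 4 * (s n * Dplus y n - Dplus y (n - 1))"
  by (simp add: L_eq Dplus_def algebra_simps add_divide_distrib diff_divide_distrib)

lemma D_Dplus: "D (Dplus y) n = L y (n + 1) - L y n"
  by (simp add: L_eq D_def Dplus_def tri_def algebra_simps add_divide_distrib diff_divide_distrib)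

lemma g_bounds_right:
  obtains c C where "0 < c" "0 < C" "\<And>n. 0 \<le> n \<Longrightarrow> c * dyad \<beta> n \<le> g n"
    "\<And>n. 0 \<le> n \<Longrightarrow> g n \<le> C * dyad \<beta> n"
proof -
  have "0 < g n / dyad \<beta> n" for n using g_pos by simp
  from this g_top zero_less_one show ?thesis
  proof (rule pos_bounds_at_top)
    fix c C :: real
    assume "0 < c" "0 < C" "\<And>n. 0 \<le> n \<Longrightarrow> c \<le> g n / dyad \<beta> n"
      "\<And>n. 0 \<le> n \<Longrightarrow> g n / dyad \<beta> n \<le> C"
    then show ?thesis using that[of c C] by (simp add: pos_le_divide_eq pos_divide_le_eq)
  qed
qed

lemma g_bounds_left:
  obtains C where "0 < C" "\<And>n. n \<le> N \<Longrightarrow> g n \<le> C"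
  by (rule pos_bounds_at_bot[OF g_pos g_bot g0, where N = N], rule that)

lemma gs_bounded:
  obtains C where "0 < C" "\<And>n. g n * s n \<le> C"
proof (rule bounded_of_limits[OF gs_top tendsto_mult[OF g_bot s_bot]])
  fix B assume B: "\<And>n. \<bar>g n * s n\<bar> \<le> B"
  have "0 < g 0 * s 0" using g_pos s_pos by simp
  then have "0 < B" using B[of 0] by linarith
  moreover have "g n * s n \<le> B" for n using B[of n] by linarith
  ultimately show ?thesis using that by blast
qed

lemmas g_ratio = tendsto_ratio_of_power_like[OF g_top]

lemma g_half_succ: obtains K where "0 \<le> K" "\<And>n. 0 < n \<Longrightarrow> g n / 2 - g (n + 1) \<le> K"
proof -
  have "1/2 < 2 powr \<beta>" using ge_one_powr_ge_zero[of 2 \<beta>] beta by simp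
  then have "eventually (\<lambda>n. 1/2 < g (n + 1) / g n) at_top" by (rule order_tendstoD[OF g_ratio])
  then obtain b where b: "\<And>n. b \<le> n \<Longrightarrow> 1/2 < g (n + 1) / g n" by (auto simp: eventually_at_top_linorder)
  obtain C where C: "0 < C" "\<And>n. n \<le> b \<Longrightarrow> g n \<le> C" using g_bounds_left[of b] by blast
  have "g n / 2 - g (n + 1) \<le> C" for n
  proof (cases "n \<le> b")
    case True then show ?thesis using C(2)[OF True] g_pos[of n] g_pos[of "n+1"] by linarith
  next
    case False then show ?thesis using b[of n] g_pos[of n] C(1) by (simp add: field_simps)
  qed
  then show ?thesis using that C(1) less_imp_le by blast
qed

definition tame :: "real \<Rightarrow> (int \<Rightarrow> real) \<Rightarrow> bool" where
  "tame R w \<longleftrightarrow> (\<forall>n. 0 \<le> w n) \<and> (\<forall>n. w (n + 1) \<le> R * w n) \<and> (\<forall>n\<le>0. w (n - 1) \<le> R * w n)"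

text \<open>The coefficients are bounded on the left half line and the upward rate is bounded everywhere. So
  for a tame weight only the downward jumps from \<open>n > 0\<close> are not controlled by a multiple of the
  weight.\<close>

lemma crude_bound:
  assumes R: "0 \<le> R"
  obtains K where "0 \<le> K"
    "\<And>w n. tame R w \<Longrightarrow> L w n \<le> K * w n + (if 0 < n then g n / 4 * (w (n - 1) - w n) else 0)"
    "\<And>w n. tame R w \<Longrightarrow> D w n \<le> K * w n + (if 0 < n then g n / 4 * w (n - 1) - g (n + 1) / 4 * w n else 0)"
proof -
  obtain Cg where Cg: "0 < Cg" "\<And>n. n \<le> 0 \<Longrightarrow> g n \<le> Cg" using g_bounds_left[of 0] by blast
  obtain Cs where Cs: "0 < Cs" "\<And>n. g n * s n \<le> Cs" using gs_bounded by blast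
  define K where "K = Cg * R + Cs * R"
  have up: "g j * s j / 4 * w (n + 1) \<le> Cs * R * w n"
    if "\<And>n. 0 \<le> w n" "w (n + 1) \<le> R * w n" for w :: "int \<Rightarrow> real" and n j
  proof -
    have "g j * s j / 4 * w (n + 1) \<le> Cs * (R * w n)"
      using Cs(2)[of j] Cs(1) that g_pos[of j] s_pos[of j] by (intro mult_mono) auto
    then show ?thesis by (simp add: mult_ac)
  qed
  have down: "g n / 4 * w (n - 1) \<le> Cg * R * w n"
    if "\<And>n. 0 \<le> w n" "w (n - 1) \<le> R * w n" "n \<le> 0" for w :: "int \<Rightarrow> real" and n
  proof -
    have "g n / 4 * w (n - 1) \<le> Cg * (R * w n)"
      using Cg(2)[OF that(3)] Cg(1) that g_pos[of n] by (intro mult_mono) auto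
    then show ?thesis by (simp add: mult_ac)
  qed
  show ?thesis
  proof (rule that[of K])
    show "0 \<le> K" using Cg Cs R by (simp add: K_def)
    fix w :: "int \<Rightarrow> real" and n
    assume "tame R w"
    then have w: "\<And>n. 0 \<le> w n" "w (n + 1) \<le> R * w n" "n \<le> 0 \<Longrightarrow> w (n - 1) \<le> R * w n"
      by (simp_all add: tame_def)
    have p: "0 \<le> g n * s n * w n" "0 \<le> g n * w n" "0 \<le> g (n + 1) * w n" "0 \<le> Cg * R * w n"
      using w(1) g_pos[of n] g_pos[of "n+1"] s_pos[of n] Cg R by auto
    have Leq: "L w n = g n / 4 * w (n - 1) - g n * w n / 4 - g n * s n * w n / 4 + g n * s n / 4 * w (n + 1)"
      by (simp add: L_def tri_def field_simps)
    have Deq: "D w n = g n / 4 * w (n - 1) - g (n + 1) * w n / 4 - g n * s n * w n / 4 + g (n + 1) * s (n + 1) / 4 * w (n + 1)"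
      by (simp add: D_def tri_def field_simps)
    have Keq: "K * w n = Cg * R * w n + Cs * R * w n" by (simp add: K_def algebra_simps)
    show "L w n \<le> K * w n + (if 0 < n then g n / 4 * (w (n - 1) - w n) else 0)"
      using up[OF w(1,2), of n] down[OF w(1,3)] p unfolding Leq Keq
      by (cases "0 < n") (auto simp: right_diff_distrib)
    show "D w n \<le> K * w n + (if 0 < n then g n / 4 * w (n - 1) - g (n + 1) / 4 * w n else 0)"
      using up[OF w(1,2), of "n + 1"] down[OF w(1,3)] p unfolding Deq Keq
      by (cases "0 < n") auto
  qed
qed

lemma growth_bounds:
  "\<exists>K\<ge>0. \<forall>n. L growth n \<le> K * growth n \<and> D growth n \<le> K * growth n \<and> L (wt 0) n \<le> K * wt 0 n"
proof -
  obtain K1 where K1: "0 \<le> K1"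
    "\<And>w n. tame 4 w \<Longrightarrow> L w n \<le> K1 * w n + (if 0 < n then g n / 4 * (w (n - 1) - w n) else 0)"
    "\<And>w n. tame 4 w \<Longrightarrow> D w n \<le> K1 * w n + (if 0 < n then g n / 4 * w (n - 1) - g (n + 1) / 4 * w n else 0)"
    using crude_bound[of 4] by auto
  obtain K2 where K2: "0 \<le> K2" "\<And>n. 0 < n \<Longrightarrow> g n / 2 - g (n + 1) \<le> K2" using g_half_succ by blast
  have P: "2 powr (x + 1) = 2 * 2 powr x" "2 powr (x - 1) = 2 powr x / 2"
      "2 powr (x + 2) = 4 * 2 powr x" "2 powr (x - 2) = 2 powr x / 4" for x :: real
    by (simp_all add: powr_add powr_diff)
  have e: "- 2 * (real_of_int n + 1) = - 2 * real_of_int n - 2"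
      "- 2 * (real_of_int n - 1) = - 2 * real_of_int n + 2" for n by simp_all
  have pw: "2 powr (real_of_int n + 1) = 2 * two_to n"
      "2 powr (real_of_int n - 1) = two_to n / 2"
      "2 powr (- 2 * (real_of_int n + 1)) \<le> 4 * dyad (- 2) n"
      "2 powr (- 2 * (real_of_int n - 1)) = 4 * dyad (- 2) n"
      "0 < two_to n" "0 < dyad (- 2) n" for n
    unfolding e P by simp_all
  have gr: "growth (n + 1) \<le> 4 * growth n" for n
    using pw[of n] by (cases "0 \<le> n"; cases "n = -1") (auto simp: growth_def)
  have gl: "growth (n - 1) \<le> 4 * growth n" for n
    using pw[of n] order_trans[OF powr_mono[of "real_of_int n - 1" "real_of_int n" 2], of "4 * two_to n"]
    by (cases "0 < n"; cases "n = 0") (auto simp: growth_def)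
  have tame_growth: "tame 4 growth" using gr gl less_imp_le[OF growth_pos] by (auto simp: tame_def)
  have gp: "0 < n \<Longrightarrow> growth (n - 1) = growth n / 2" for n
    by (simp add: growth_def powr_diff)
  have wr: "wt 0 (n + 1) \<le> 4 * wt 0 n" "wt 0 (n - 1) \<le> 4 * wt 0 n" for n
    by (cases "n = 0"; cases "n = 1"; auto simp: wt_def powr_diff powr_add powr_minus field_simps)+
  have wl: "0 < n \<Longrightarrow> wt 0 (n - 1) = wt 0 n" for n
    by (cases "n = 1") (auto simp: wt_def)
  show ?thesis
  proof (intro exI[of _ "K1 + K2"] conjI allI)
    show "L growth n \<le> (K1 + K2) * growth n" for n
    proof -
      have "L growth n \<le> K1 * growth n + (if 0 < n then g n / 4 * (growth (n - 1) - growth n) else 0)"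
        by (rule K1(2)[OF tame_growth])
      also have "\<dots> \<le> K1 * growth n"
        using gp[of n] g_pos[of n] growth_pos[of n] by (auto intro!: mult_nonneg_nonpos)
      finally have "L growth n \<le> K1 * growth n" .
      then show ?thesis using K2(1) growth_pos[of n] by (simp add: distrib_right add_increasing2)
    qed
    show "D growth n \<le> (K1 + K2) * growth n" for n
    proof -
      have "D growth n \<le> K1 * growth n + (if 0 < n then g n / 4 * growth (n - 1) - g (n + 1) / 4 * growth n else 0)"
        by (rule K1(3)[OF tame_growth])
      also have "\<dots> \<le> K1 * growth n + K2 * growth n"
      proof (cases "0 < n")
        case True
        have "g n / 4 * growth (n - 1) - g (n + 1) / 4 * growth n = (g n / 2 - g (n + 1)) * (growth n / 4)"
          using gp[OF True] by (simp add: field_simps)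
        also have "\<dots> \<le> K2 * (growth n / 4)" using K2(2)[OF True] growth_pos[of n] by (intro mult_right_mono) auto
        also have "\<dots> \<le> K2 * growth n" using K2(1) growth_pos[of n] by (intro mult_left_mono) auto
        finally show ?thesis using True by simp
      next
        case False
        then show ?thesis using K2(1) growth_pos[of n] by simp
      qed
      finally show ?thesis by (simp add: distrib_right)
    qed
    show "L (wt 0) n \<le> (K1 + K2) * wt 0 n" for n
    proof -
      have "L (wt 0) n \<le> K1 * wt 0 n + (if 0 < n then g n / 4 * (wt 0 (n - 1) - wt 0 n) else 0)"
        using wr less_imp_le[OF wt_pos] by (intro K1(2)) (auto simp: tame_def)
      also have "\<dots> = K1 * wt 0 n" using wl by simp
      finally show ?thesis using K2(1) wt_pos[of 0 n] by (simp add: distrib_right add_increasing2)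
    qed
  qed (use K1 K2 in auto)
qed

text \<open>Solutions of the linear problem in the growth class to which the comparison principle with the
  weight \<open>growth\<close> applies.\<close>

definition admissible :: "(real \<Rightarrow> int \<Rightarrow> real) \<Rightarrow> bool" where
  "admissible y \<longleftrightarrow>
    (\<forall>t\<ge>0. \<forall>n. ((\<lambda>r. y r n) has_real_derivative L (y t) n) (at t within {0..})) \<and>
    (\<exists>\<rho>>-1. \<forall>T\<ge>0. bounded_upto T \<rho> y)"

lemma admissible_deriv:
  "admissible y \<Longrightarrow> 0 \<le> t \<Longrightarrow> ((\<lambda>r. y r n) has_real_derivative L (y t) n) (at t within {0..})"
  by (simp add: admissible_def)

lemma admissible_shift:
  assumes y: "admissible y" and a: "0 \<le> a"
  shows "admissible (\<lambda>t. y (t + a))"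
  unfolding admissible_def
proof (intro conjI allI impI)
  fix t n assume t: "0 \<le> (t::real)"
  have "((\<lambda>r. y r n) has_real_derivative L (y (t + a)) n) (at (t + a) within (\<lambda>r. r + a) ` {0..})"
    using a by (intro DERIV_subset[OF admissible_deriv[OF y]]) (use t in auto)
  moreover have "((\<lambda>r. r + a) has_real_derivative 1) (at t within {0..})"
    by (auto intro!: derivative_eq_intros)
  ultimately show "((\<lambda>r. y (r + a) n) has_real_derivative L (y (t + a)) n) (at t within {0..})"
    using DERIV_image_chain[of "\<lambda>r. y r n" _ "\<lambda>r. r + a" t "{0..}" 1] by (simp add: o_def)
next
  obtain \<rho> where \<rho>: "\<rho> > -1" "\<And>T. T\<ge>0 \<Longrightarrow> bounded_upto T \<rho> y"
    using y by (auto simp: admissible_def)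
  have "\<exists>B. \<forall>t\<in>{0..T}. \<forall>n. \<bar>y (t + a) n\<bar> \<le> B * wt \<rho> n" if T: "T \<ge> 0" for T
  proof -
    obtain B where B: "\<forall>t\<in>{0..T+a}. \<forall>n. \<bar>y t n\<bar> \<le> B * wt \<rho> n" using \<rho>(2)[of "T + a"] a T by auto
    show ?thesis using B a by (intro exI[of _ B]) auto
  qed
  then show "\<exists>\<rho>>-1. \<forall>T\<ge>0. \<exists>B. \<forall>t\<in>{0..T}. \<forall>n. \<bar>y (t + a) n\<bar> \<le> B * wt \<rho> n"
    using \<rho>(1) by auto
qed

lemma admissible_diff:
  assumes x: "admissible x" and y: "admissible y"
  shows "admissible (\<lambda>t n. x t n - y t n)"
  unfolding admissible_def
proof (intro conjI allI impI)
  fix t n assume "0 \<le> (t::real)"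
  then show "((\<lambda>r. x r n - y r n) has_real_derivative L (\<lambda>n. x t n - y t n) n) (at t within {0..})"
    unfolding L_def tri_diff unfolding L_def[symmetric]
    by (intro DERIV_diff admissible_deriv[OF x] admissible_deriv[OF y])
next
  obtain \<rho>1 where \<rho>1: "\<rho>1 > -1" "\<And>T. T\<ge>0 \<Longrightarrow> bounded_upto T \<rho>1 x"
    using x by (auto simp: admissible_def)
  obtain \<rho>2 where \<rho>2: "\<rho>2 > -1" "\<And>T. T\<ge>0 \<Longrightarrow> bounded_upto T \<rho>2 y"
    using y by (auto simp: admissible_def)
  have "\<exists>B. \<forall>t\<in>{0..T}. \<forall>n. \<bar>x t n - y t n\<bar> \<le> B * wt (min \<rho>1 \<rho>2) n" if T: "0 \<le> T" for T
  proof -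
    obtain B1 where B1: "\<forall>t\<in>{0..T}. \<forall>n. \<bar>x t n\<bar> \<le> B1 * wt \<rho>1 n" using \<rho>1(2)[OF T] by auto
    obtain B2 where B2: "\<forall>t\<in>{0..T}. \<forall>n. \<bar>y t n\<bar> \<le> B2 * wt \<rho>2 n" using \<rho>2(2)[OF T] by auto
    have "\<bar>x t n - y t n\<bar> \<le> (\<bar>B1\<bar> + \<bar>B2\<bar>) * wt (min \<rho>1 \<rho>2) n" if t: "t \<in> {0..T}" for t n
    proof -
      have "B1 * wt \<rho>1 n \<le> \<bar>B1\<bar> * wt (min \<rho>1 \<rho>2) n" "B2 * wt \<rho>2 n \<le> \<bar>B2\<bar> * wt (min \<rho>1 \<rho>2) n"
        using wt_antimono[of "min \<rho>1 \<rho>2" \<rho>1 n] wt_antimono[of "min \<rho>1 \<rho>2" \<rho>2 n] wt_pos less_imp_le[OF wt_pos]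
        by (auto intro!: mult_mono)
      moreover have "\<bar>x t n\<bar> \<le> B1 * wt \<rho>1 n" "\<bar>y t n\<bar> \<le> B2 * wt \<rho>2 n" using B1 B2 t by auto
      ultimately show ?thesis unfolding distrib_right using abs_triangle_ineq4[of "x t n" "y t n"] by linarith
    qed
    then show ?thesis by blast
  qed
  then show "\<exists>\<rho>>-1. \<forall>T\<ge>0. \<exists>B. \<forall>t\<in>{0..T}. \<forall>n. \<bar>x t n - y t n\<bar> \<le> B * wt \<rho> n"
    using \<rho>1(1) \<rho>2(1) by (intro exI[of _ "min \<rho>1 \<rho>2"]) auto
qed

lemma wt_succ:
  assumes \<rho>: "-1 < \<rho>"
  shows "wt \<rho> (n + 1) \<le> 2 * wt \<rho> n"
proof (cases "n < 0")
  case True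
  have "2 powr (- real_of_int (n + 1)) \<le> 2 powr (- real_of_int n)" by (intro powr_mono) auto
  also have "\<dots> \<le> 2 * 2 powr (- real_of_int n)" by simp
  finally show ?thesis using True by (simp add: wt_def)
next
  case False
  have "dyad (- \<rho>) (n + 1) = 2 powr (- \<rho>) * dyad (- \<rho>) n"
    by (simp add: algebra_simps flip: powr_add)
  also have "\<dots> \<le> 2 powr 1 * dyad (- \<rho>) n"
    using \<rho> by (intro mult_right_mono powr_mono) auto
  finally show ?thesis using False by (cases "n = 0") (auto simp: wt_def)
qed

lemma Dplus_wt_bound:
  assumes "-1 < \<rho>" and y: "\<And>n. \<bar>y n\<bar> \<le> B * wt \<rho> n"
  shows "\<bar>Dplus y n\<bar> \<le> 3 * B * wt \<rho> n"
proof -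
  have B: "0 \<le> B" by (rule wt_bound_nonneg[OF y])
  have "\<bar>Dplus y n\<bar> \<le> B * wt \<rho> (n + 1) + B * wt \<rho> n"
    using y[of n] y[of "n + 1"] by (simp add: Dplus_def)
  also have "\<dots> \<le> B * (2 * wt \<rho> n) + B * wt \<rho> n"
    using B wt_succ[OF assms(1)] by (intro add_mono mult_left_mono) auto
  finally show ?thesis by simp
qed

abbreviation "time_factor \<nu> \<theta> \<theta>' t \<equiv> (1 + t powr (- (\<theta>' - \<theta>) / \<beta>)) * exp (- \<nu> * t)"

lemma far_of_bound:
  assumes "-1 < \<rho>" "\<And>t n. t \<in> {0..T} \<Longrightarrow> \<bar>x t n\<bar> \<le> B * wt \<rho> n" "0 < \<epsilon>"
  shows "\<exists>F. finite F \<and> (\<forall>n\<in>UNIV - F. \<forall>t\<in>{0..T}. \<bar>x t n\<bar> \<le> \<epsilon> * growth n)"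
proof (intro exI conjI ballI)
  show "finite {n. \<not> B * wt \<rho> n \<le> \<epsilon> * growth n}" by (rule wt_small_growth[OF assms(1,3)])
  fix n t assume "n \<in> UNIV - {n. \<not> B * wt \<rho> n \<le> \<epsilon> * growth n}" "t \<in> {0..T}"
  then show "\<bar>x t n\<bar> \<le> \<epsilon> * growth n" using assms(2)[of t n] by simp
qed

text \<open>Uniqueness for the linear problem: zero is a supersolution.\<close>

lemma admissible_zero:
  assumes y: "admissible y" and y0: "\<And>n. y 0 n = 0" and t: "0 \<le> t"
  shows "y t n = 0"
proof -
  obtain \<rho> where \<rho>: "\<rho> > -1" "\<And>T. T\<ge>0 \<Longrightarrow> bounded_upto T \<rho> y"
    using y by (auto simp: admissible_def)
  obtain K where K: "\<And>n. L growth n \<le> K * growth n" using growth_bounds by auto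
  have "\<bar>y t n\<bar> \<le> 0"
  proof (rule tri_abs_comparison[where x = y and W = "\<lambda>t n. 0" and W' = "\<lambda>t n. 0" and U = growth and K = K and I = UNIV,
        OF _ _ growth_pos K[unfolded L_def]])
    show "\<exists>F. finite F \<and> (\<forall>n\<in>UNIV - F. \<forall>t\<in>{0..T}. \<bar>y t n\<bar> \<le> \<epsilon> * growth n)"
      if T: "0 \<le> T" "0 < \<epsilon>" for T \<epsilon>
    proof -
      obtain B where B: "\<forall>t\<in>{0..T}. \<forall>n. \<bar>y t n\<bar> \<le> B * wt \<rho> n" using \<rho>(2)[OF T(1)] by auto
      show ?thesis by (rule far_of_bound[OF \<rho>(1) _ T(2), of T y B]) (use B in auto)
    qed
  qed (use g_pos s_pos y0 t admissible_deriv[OF y] in \<open>auto simp: less_imp_le tri_def L_def\<close>)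
  then show ?thesis by simp
qed

lemma Dplus_comparison:
  assumes y: "admissible y"
    and derW: "\<And>n t. 0 \<le> t \<Longrightarrow> ((\<lambda>r. W r n) has_real_derivative W' t n) (at t within {0..})"
    and super: "\<And>n t. 0 \<le> t \<Longrightarrow> D (W t) n \<le> W' t n"
    and W: "\<And>n t. 0 \<le> t \<Longrightarrow> 0 \<le> W t n"
    and init: "\<And>n. \<bar>Dplus (y 0) n\<bar> \<le> W 0 n" and t: "0 \<le> t"
  shows "\<bar>Dplus (y t) n\<bar> \<le> W t n"
proof -
  obtain \<rho> where \<rho>: "\<rho> > -1" "\<And>T. T\<ge>0 \<Longrightarrow> bounded_upto T \<rho> y"
    using y by (auto simp: admissible_def)
  obtain K where K: "\<And>n. D growth n \<le> K * growth n" using growth_bounds by auto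
  show ?thesis
  proof (rule tri_abs_comparison[where x = "\<lambda>t. Dplus (y t)" and W = W and W' = W' and U = growth and K = K and I = UNIV,
        OF _ _ growth_pos K[unfolded D_def] _ derW super[unfolded D_def] W init _ _ t])
    show "((\<lambda>r. Dplus (y r) n) has_real_derivative
      tri (\<lambda>n. g n / 4) (\<lambda>n. (g (n + 1) + g n * s n) / 4) (\<lambda>n. g (n + 1) * s (n + 1) / 4) (Dplus (y t)) n) (at t within {0..})"
      if "0 \<le> t" for n t
      unfolding D_def[symmetric] D_Dplus unfolding Dplus_def
      by (intro DERIV_diff admissible_deriv[OF y] that)
    show "\<exists>F. finite F \<and> (\<forall>n\<in>UNIV - F. \<forall>t\<in>{0..T}. \<bar>Dplus (y t) n\<bar> \<le> \<epsilon> * growth n)"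
      if T: "0 \<le> T" "0 < \<epsilon>" for T \<epsilon>
    proof -
      obtain B where B: "\<forall>t\<in>{0..T}. \<forall>n. \<bar>y t n\<bar> \<le> B * wt \<rho> n" using \<rho>(2)[OF T(1)] by auto
      have "\<bar>Dplus (y t) n\<bar> \<le> (3 * B) * wt \<rho> n" if "t \<in> {0..T}" for t n
        by (rule Dplus_wt_bound[OF \<rho>(1)]) (use B that in auto)
      then show ?thesis by (intro far_of_bound[OF \<rho>(1) _ T(2)])
    qed
  qed (simp_all add: g_pos s_pos less_imp_le)
qed

text \<open>\<open>F\<close> bounds the evolution of the differences of a solution from the norm with exponent \<open>\<theta>\<close> to the one
  with exponent \<open>\<theta>'\<close>. Because the problem is autonomous, such bounds compose
  (\<open>controls_shifted\<close>).\<close>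

definition controls :: "(real \<Rightarrow> real) \<Rightarrow> real \<Rightarrow> real \<Rightarrow> bool" where
  "controls F \<theta> \<theta>' \<longleftrightarrow> (\<forall>y B t n. admissible y \<longrightarrow> (\<forall>n. \<bar>Dplus (y 0) n\<bar> \<le> B * wt \<theta> n) \<longrightarrow>
    0 < t \<longrightarrow> \<bar>Dplus (y t) n\<bar> \<le> F t * B * wt \<theta>' n)"

lemma controlsD:
  assumes "controls F \<theta> \<theta>'" "admissible y" "\<And>n. \<bar>Dplus (y 0) n\<bar> \<le> B * wt \<theta> n" "0 < t"
  shows "\<bar>Dplus (y t) n\<bar> \<le> F t * B * wt \<theta>' n"
  using assms unfolding controls_def by blast

lemma controlsI:
  assumes "\<And>y B t n. admissible y \<Longrightarrow> (\<And>n. \<bar>Dplus (y 0) n\<bar> \<le> B * wt \<theta> n) \<Longrightarrow> 0 \<le> B \<Longrightarrow> 0 < t \<Longrightarrow>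
    \<bar>Dplus (y t) n\<bar> \<le> F t * B * wt \<theta>' n"
  shows "controls F \<theta> \<theta>'"
  unfolding controls_def
proof (intro allI impI)
  fix y B t n assume y: "admissible y" "\<forall>n. \<bar>Dplus (y 0) n\<bar> \<le> B * wt \<theta> n" and t: "0 < (t::real)"
  from y(2) have "0 \<le> B" by (intro wt_bound_nonneg[of "Dplus (y 0)" B \<theta>]) blast
  then show "\<bar>Dplus (y t) n\<bar> \<le> F t * B * wt \<theta>' n" by (intro assms y(1) spec[OF y(2)] t)
qed

lemma controls_shifted:
  assumes "controls F \<theta> \<theta>'" and y: "admissible y" and a: "0 \<le> a" and t: "0 < t"
    and "\<And>n. \<bar>Dplus (y a) n\<bar> \<le> B * wt \<theta> n"
  shows "\<bar>Dplus (y (t + a)) n\<bar> \<le> F t * B * wt \<theta>' n"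
  by (rule controlsD[where y = "\<lambda>r. y (r + a)", OF assms(1) admissible_shift[OF y a] _ t]) (use assms(5) in simp)

end

section \<open>Smoothing\<close>

text \<open>The graph of the convex function \<open>x \<mapsto> x\<^bsup>-\<delta>\<^esup>\<close> lies above its tangent at \<open>b\<close>.\<close>

lemma powr_neg_decrease:
  assumes a: "0 < a" and ab: "a \<le> b" and \<delta>: "0 \<le> \<delta>"
  shows "b powr (- \<delta>) - a powr (- \<delta>) \<le> - \<delta> * (b - a) * b powr (- \<delta> - (1::real))"
proof -
  have b: "0 < b" using a ab by simp
  have "1 + \<delta> * (1 - a / b) \<le> 1 + \<delta> * ln (b / a)"
    using ln_le_minus_one[of "a / b"] a b \<delta> by (intro add_left_mono mult_left_mono) (auto simp: ln_div)
  also have "\<dots> \<le> exp (\<delta> * ln (b / a))" by (rule exp_ge_add_one_self)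
  also have "\<dots> = (b / a) powr \<delta>" using a b by (simp add: powr_def)
  finally have "b powr (- \<delta>) * (1 + \<delta> * (1 - a / b)) \<le> b powr (- \<delta>) * (b / a) powr \<delta>"
    by (intro mult_left_mono) auto
  also have "\<dots> = a powr (- \<delta>)" using a b by (simp add: powr_divide powr_minus divide_simps)
  also have "b powr (- \<delta>) * (1 + \<delta> * (1 - a / b)) = b powr (- \<delta>) + \<delta> * (b - a) * b powr (- \<delta> - 1)"
    using b by (simp add: powr_diff field_simps)
  finally show ?thesis by simp
qed

context chain
begin

definition scale :: "int \<Rightarrow> real" where
  "scale n = (if 0 \<le> n then dyad (- \<beta>) n else 1)"

text \<open>On the right half line this is the sequence for which the downward part of \<open>D\<close> carries a constant
  flux, \<open>g (n + 1) * profile n = 4\<close>.\<close>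

definition profile :: "int \<Rightarrow> real" where
  "profile n = (if 0 \<le> n then 4 / g (n + 1) else 2 powr (- real_of_int n))"

definition barrier :: "real \<Rightarrow> real \<Rightarrow> real \<Rightarrow> int \<Rightarrow> real" where
  "barrier \<delta> c t n = profile n * (scale n + c * t) powr (- \<delta>)"

lemma scale_pos: "0 < scale n" and profile_pos: "0 < profile n"
  using g_pos by (auto simp: scale_def profile_def)

lemma barrier_nonneg: "0 \<le> barrier \<delta> c t n"
  using profile_pos[of n] by (simp add: barrier_def)

lemma scale_succ: "scale n \<le> 2 powr \<beta> * scale (n + 1)"
proof -
  have "1 \<le> 2 powr \<beta>" using beta by (simp add: ge_one_powr_ge_zero)
  moreover have "dyad (- \<beta>) n = 2 powr \<beta> * dyad (- \<beta>) (n + 1)"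
    by (simp add: algebra_simps flip: powr_add)
  ultimately show ?thesis by (cases "0 \<le> n"; cases "n = -1") (auto simp: scale_def)
qed

lemma profile_bounds:
  obtains c C where "0 < c" "0 < C" "\<And>n. 0 \<le> n \<Longrightarrow> c * scale n \<le> profile n" "\<And>n. 0 \<le> n \<Longrightarrow> profile n \<le> C * scale n"
proof (rule g_bounds_right)
  fix c C assume cC: "0 < c" "0 < C" "\<And>n. 0 \<le> n \<Longrightarrow> c * dyad \<beta> n \<le> g n"
    "\<And>n. 0 \<le> n \<Longrightarrow> g n \<le> C * dyad \<beta> n"
  have *: "dyad \<beta> (n + 1) = 2 powr \<beta> / scale n" if "0 \<le> n" for n
    using that by (simp add: scale_def algebra_simps powr_add powr_minus divide_inverse)
  show ?thesis
  proof (rule that[of "4 / (C * 2 powr \<beta>)" "4 / (c * 2 powr \<beta>)"])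
    fix n :: int assume n: "0 \<le> n"
    have "4 / (C * (2 powr \<beta> / scale n)) \<le> 4 / g (n + 1)"
      using cC(4)[of "n + 1"] n g_pos[of "n + 1"] cC(2) scale_pos[of n] unfolding *[OF n]
      by (intro divide_left_mono) auto
    then show "4 / (C * 2 powr \<beta>) * scale n \<le> profile n" using n scale_pos[of n] by (simp add: profile_def)
    have "4 / g (n + 1) \<le> 4 / (c * (2 powr \<beta> / scale n))"
      using cC(3)[of "n + 1"] n g_pos[of "n + 1"] cC(1) scale_pos[of n] unfolding *[OF n]
      by (intro divide_left_mono) auto
    then show "profile n \<le> 4 / (c * 2 powr \<beta>) * scale n" using n scale_pos[of n] by (simp add: profile_def)
  qed (use cC in auto)
qed

lemma profile_ratio:
  obtains R where "1 \<le> R" "\<And>n. profile (n + 1) \<le> R * profile n" "\<And>n. n \<le> 0 \<Longrightarrow> profile (n - 1) \<le> R * profile n"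
proof (rule profile_bounds)
  fix c C assume cC: "0 < c" "0 < C" "\<And>n. 0 \<le> n \<Longrightarrow> c * scale n \<le> profile n"
    "\<And>n. 0 \<le> n \<Longrightarrow> profile n \<le> C * scale n"
  define R where "R = 2 + C / c + profile 0 + 2 / profile 0"
  have R: "2 \<le> R" "C / c \<le> R" "profile 0 \<le> R" "2 / profile 0 \<le> R"
    using cC profile_pos[of 0] by (auto simp: R_def)
  have scale_le: "scale (n + 1) \<le> scale n" if "0 \<le> n" for n
    using that beta by (simp add: scale_def)
  have right: "profile (n + 1) \<le> R * profile n" if n: "0 \<le> n" for n
  proof -
    have "profile (n + 1) \<le> C * scale (n + 1)" using cC(4)[of "n + 1"] n by simp
    also have "\<dots> \<le> C * scale n" using scale_le[OF n] cC(2) by simp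
    also have "\<dots> = (C / c) * (c * scale n)" using cC by simp
    also have "\<dots> \<le> R * profile n"
      using cC R n scale_pos[of n] by (intro mult_mono) auto
    finally show ?thesis .
  qed
  have left: "profile (n + 1) \<le> R * profile n" if n: "n < -1" for n
  proof -
    have "profile (n + 1) \<le> profile n" using n by (simp add: profile_def)
    also have "\<dots> \<le> R * profile n" using R profile_pos[of n] by simp
    finally show ?thesis .
  qed
  have m1: "profile (-1) = 2" by (simp add: profile_def)
  have mid: "profile 0 \<le> R * profile (-1)" using R by (simp add: m1)
  have left': "profile (n - 1) \<le> R * profile n" if n: "n < 0" for n
  proof -
    have "profile (n - 1) = 2 * profile n" using n by (simp add: profile_def powr_diff powr_minus divide_inverse)
    also have "\<dots> \<le> R * profile n" using R profile_pos[of n] by (intro mult_right_mono) auto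
    finally show ?thesis .
  qed
  have mid': "profile (-1) \<le> R * profile 0" using R(4) profile_pos[of 0] by (simp add: m1 pos_divide_le_eq)
  show ?thesis
  proof (rule that[of R])
    show "profile (n + 1) \<le> R * profile n" for n
      using right[of n] left[of n] mid by (cases "0 \<le> n"; cases "n = -1") auto
    show "profile (n - 1) \<le> R * profile n" if "n \<le> 0" for n
      using left'[of n] mid' that by (cases "n = 0") auto
  qed (use R in auto)
qed

lemma barrier_ratio:
  assumes \<delta>: "0 < \<delta>"
  obtains R where "1 \<le> R" "\<And>c t n. 0 \<le> c \<Longrightarrow> 0 \<le> t \<Longrightarrow> barrier \<delta> c t (n + 1) \<le> R * barrier \<delta> c t n"
    "\<And>c t n. 0 \<le> c \<Longrightarrow> 0 \<le> t \<Longrightarrow> n \<le> 0 \<Longrightarrow> barrier \<delta> c t (n - 1) \<le> R * barrier \<delta> c t n"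
proof (rule profile_ratio)
  fix R assume R: "1 \<le> R" "\<And>n. profile (n + 1) \<le> R * profile n" "\<And>n. n \<le> 0 \<Longrightarrow> profile (n - 1) \<le> R * profile n"
  have b1: "1 \<le> 2 powr \<beta>" using beta by (simp add: ge_one_powr_ge_zero)
  have q1: "1 \<le> 2 powr (\<beta> * \<delta>)" using beta \<delta> by (simp add: ge_one_powr_ge_zero)
  have x: "(scale (n + 1) + c * t) powr (- \<delta>) \<le> 2 powr (\<beta> * \<delta>) * (scale n + c * t) powr (- \<delta>)"
    if "0 \<le> c" "0 \<le> t" for c t n
  proof -
    have ct: "0 \<le> c * t" using that by simp
    have "scale n + c * t \<le> 2 powr \<beta> * (scale (n + 1) + c * t)"
      using scale_succ[of n] mult_right_mono[OF b1 ct] by (simp add: distrib_left)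
    moreover have "0 < scale n + c * t" using scale_pos[of n] ct by (rule add_pos_nonneg)
    ultimately have "(2 powr \<beta> * (scale (n + 1) + c * t)) powr (- \<delta>) \<le> (scale n + c * t) powr (- \<delta>)"
      using \<delta> by (intro powr_mono2') auto
    moreover have "(2 powr \<beta> * (scale (n + 1) + c * t)) powr (- \<delta>) = (scale (n + 1) + c * t) powr (- \<delta>) / 2 powr (\<beta> * \<delta>)"
      using scale_pos[of "n + 1"] ct by (simp add: powr_mult powr_powr powr_minus divide_inverse mult.commute)
    ultimately show ?thesis by (simp add: pos_divide_le_eq mult.commute)
  qed
  show ?thesis
  proof (rule that[of "R * 2 powr (\<beta> * \<delta>)"])
    show "1 \<le> R * 2 powr (\<beta> * \<delta>)" using R(1) q1 mult_mono[of 1 R 1 "2 powr (\<beta> * \<delta>)"] by simp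
    fix c t :: real and n :: int assume ct: "0 \<le> c" "0 \<le> t"
    have "barrier \<delta> c t (n + 1) \<le> (R * profile n) * (2 powr (\<beta> * \<delta>) * (scale n + c * t) powr (- \<delta>))"
      unfolding barrier_def using R(1) R(2)[of n] x[OF ct, of n] profile_pos[of n] by (intro mult_mono) auto
    then show "barrier \<delta> c t (n + 1) \<le> R * 2 powr (\<beta> * \<delta>) * barrier \<delta> c t n"
      by (simp add: barrier_def mult_ac)
    assume n: "n \<le> 0"
    have s: "scale (n - 1) = scale n" using n by (simp add: scale_def)
    have "barrier \<delta> c t (n - 1) \<le> (R * profile n) * (2 powr (\<beta> * \<delta>) * (scale n + c * t) powr (- \<delta>))"
      unfolding barrier_def s using R(1) R(3)[OF n] profile_pos[of n]
        mult_right_mono[OF q1, of "(scale n + c * t) powr (- \<delta>)"] by (intro mult_mono) auto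
    then show "barrier \<delta> c t (n - 1) \<le> R * 2 powr (\<beta> * \<delta>) * barrier \<delta> c t n"
      by (simp add: barrier_def mult_ac)
  qed
qed

text \<open>For \<open>n > 0\<close> the normalisation of \<open>profile\<close> turns the downward part of \<open>D\<close> into the difference
  \<open>(scale (n - 1) + c * t)\<^bsup>-\<delta>\<^esup> - (scale n + c * t)\<^bsup>-\<delta>\<^esup>\<close>. By convexity it is at most
  \<open>-\<delta> * (scale (n - 1) - scale n)\<close> times a power with exponent \<open>-\<delta> - 1\<close>, while the time
  derivative of the barrier is only \<open>-\<delta> * c * profile n\<close> times a comparable power. As \<open>profile n\<close>
  is comparable with \<open>scale n\<close>, a small \<open>c\<close> suffices. For \<open>n \<le> 0\<close> all coefficients are bounded.\<close>

lemma barrier_supersolution: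
  assumes \<delta>: "0 < \<delta>"
  obtains c K where "0 < c" "0 \<le> K"
    "\<And>t n. 0 \<le> t \<Longrightarrow> D (barrier \<delta> c t) n \<le>
        profile n * (- \<delta> * c * (scale n + c * t) powr (- \<delta> - 1)) + K * barrier \<delta> c t n"
proof (rule barrier_ratio[OF \<delta>], rule profile_bounds)
  fix R c1 C1 assume R: "1 \<le> R" "\<And>c t n. 0 \<le> c \<Longrightarrow> 0 \<le> t \<Longrightarrow> barrier \<delta> c t (n + 1) \<le> R * barrier \<delta> c t n"
    "\<And>c t n. 0 \<le> c \<Longrightarrow> 0 \<le> t \<Longrightarrow> n \<le> 0 \<Longrightarrow> barrier \<delta> c t (n - 1) \<le> R * barrier \<delta> c t n"
    and C1: "0 < C1" "\<And>n. 0 \<le> n \<Longrightarrow> profile n \<le> C1 * scale n"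
  have R0: "0 \<le> R" using R(1) by simp
  define p where "p = (2 powr \<beta>) powr (- \<delta> - 1)"
  define c where "c = (2 powr \<beta> - 1) * p / C1"
  have b1: "1 < 2 powr \<beta>" using beta powr_less_mono[of 0 \<beta> 2] by simp
  have c0: "0 < c" using b1 C1 by (simp add: c_def p_def)
  show ?thesis
  proof (rule crude_bound[OF R0])
    fix K assume K: "0 \<le> K"
      "\<And>w n. tame R w \<Longrightarrow> D w n \<le> K * w n + (if 0 < n then g n / 4 * w (n - 1) - g (n + 1) / 4 * w n else 0)"
    show ?thesis
    proof (rule that[of c "K + \<delta> * c"])
      show "0 < c" by (rule c0)
      show "0 \<le> K + \<delta> * c" using K(1) \<delta> c0 by simp
      fix t :: real and n :: int assume t: "0 \<le> t"
      define a where "a = scale n + c * t"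
      have a0: "0 < a" using scale_pos[of n] c0 t by (simp add: a_def add_pos_nonneg)
      have Db: "D (barrier \<delta> c t) n \<le> K * barrier \<delta> c t n +
          (if 0 < n then g n / 4 * barrier \<delta> c t (n - 1) - g (n + 1) / 4 * barrier \<delta> c t n else 0)"
        using R c0 t barrier_nonneg by (intro K(2)) (auto simp: tame_def)
      show "D (barrier \<delta> c t) n \<le>
          profile n * (- \<delta> * c * (scale n + c * t) powr (- \<delta> - 1)) + (K + \<delta> * c) * barrier \<delta> c t n"
      proof (cases "0 < n")
        case True
        have sc: "scale (n - 1) = 2 powr \<beta> * scale n"
          using True by (simp add: scale_def algebra_simps flip: powr_add)
        define b where "b = scale (n - 1) + c * t"
        have ba: "b - a = (2 powr \<beta> - 1) * scale n" by (simp add: a_def b_def sc algebra_simps)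
        have ab: "a \<le> b" using ba b1 scale_pos[of n] by (smt (verit) mult_nonneg_nonneg)
        have "c * t \<le> 2 powr \<beta> * (c * t)" using b1 c0 t mult_right_mono[of 1 "2 powr \<beta>" "c * t"] by simp
        then have b2: "b \<le> 2 powr \<beta> * a" by (simp add: a_def b_def sc algebra_simps)
        have bp: "p * a powr (- \<delta> - 1) \<le> b powr (- \<delta> - 1)"
        proof -
          have "(2 powr \<beta> * a) powr (- \<delta> - 1) \<le> b powr (- \<delta> - 1)"
            using b2 a0 ab \<delta> by (intro powr_mono2') auto
          then show ?thesis using a0 by (simp add: powr_mult p_def)
        qed
        have "g n / 4 * barrier \<delta> c t (n - 1) - g (n + 1) / 4 * barrier \<delta> c t n = b powr (- \<delta>) - a powr (- \<delta>)"
          using True g_pos[of n] g_pos[of "n + 1"] by (simp add: barrier_def profile_def a_def b_def)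
        also have "\<dots> \<le> - \<delta> * (b - a) * b powr (- \<delta> - 1)"
          using a0 ab \<delta> by (intro powr_neg_decrease) auto
        also have "\<dots> \<le> - (\<delta> * (b - a) * (p * a powr (- \<delta> - 1)))"
          using bp ab \<delta> by (simp add: mult_left_mono)
        also have "\<dots> \<le> - (profile n * (\<delta> * c * a powr (- \<delta> - 1)))"
        proof -
          have "profile n * c \<le> C1 * scale n * c"
            using C1(2)[of n] True c0 by (intro mult_right_mono) auto
          also have "\<dots> = (b - a) * p" using C1(1) by (simp add: ba c_def)
          finally have "profile n * c * (\<delta> * a powr (- \<delta> - 1)) \<le> (b - a) * p * (\<delta> * a powr (- \<delta> - 1))"
            using \<delta> by (intro mult_right_mono) auto
          then show ?thesis by (simp add: mult_ac)
        qed
        finally have "D (barrier \<delta> c t) n \<le> K * barrier \<delta> c t n + profile n * (- \<delta> * c * a powr (- \<delta> - 1))"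
          using Db True by simp
        moreover have "0 \<le> \<delta> * c * barrier \<delta> c t n" using \<delta> c0 barrier_nonneg by simp
        ultimately show ?thesis by (simp add: a_def distrib_right)
      next
        case False
        have "scale n = 1" using False by (auto simp: scale_def)
        then have "1 \<le> a" using c0 t by (simp add: a_def)
        then have "a powr (- \<delta> - 1) \<le> a powr (- \<delta>)" by (intro powr_mono) auto
        then have "\<delta> * c * (profile n * a powr (- \<delta> - 1)) \<le> \<delta> * c * (profile n * a powr (- \<delta>))"
          using \<delta> c0 profile_pos[of n] by (intro mult_left_mono) auto
        then show ?thesis using Db False by (simp add: barrier_def a_def algebra_simps)
      qed
    qed
  qed
qed

text \<open>With \<open>\<delta> = \<delta>1 + \<delta>2\<close>, where \<open>\<delta>1 = (\<theta>' - \<theta>) / \<beta>\<close> and \<open>\<delta>2 = (\<beta> - \<theta>') / \<beta>\<close>, the factor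
  \<open>(x + c * t)\<^bsup>-\<delta>\<^esup>\<close> is at most \<open>(c * t)\<^bsup>-\<delta>1\<^esup> * x\<^bsup>-\<delta>2\<^esup>\<close>, and \<open>x * x\<^bsup>-\<delta>2\<^esup>\<close> is \<open>wt \<theta>' n\<close>
  when \<open>x = 2\<^bsup>-\<beta>n\<^esup>\<close>. The same barrier thus serves all target weights at once.\<close>

lemma Dplus_smoothing:
  assumes \<theta>: "\<theta> < \<beta>" "\<theta> \<le> \<theta>'" "\<theta>' \<le> \<beta>"
  shows "\<exists>C>0. \<exists>K\<ge>0. controls (\<lambda>t. C * (1 + t powr (- (\<theta>' - \<theta>) / \<beta>)) * exp (K * t)) \<theta> \<theta>'"
proof -
  define \<delta> where "\<delta> = (\<beta> - \<theta>) / \<beta>"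
  define \<delta>1 where "\<delta>1 = (\<theta>' - \<theta>) / \<beta>"
  define \<delta>2 where "\<delta>2 = (\<beta> - \<theta>') / \<beta>"
  have \<delta>: "0 < \<delta>" "0 \<le> \<delta>1" "0 \<le> \<delta>2" "\<delta> = \<delta>1 + \<delta>2"
    using \<theta> beta by (auto simp: \<delta>_def \<delta>1_def \<delta>2_def simp flip: add_divide_distrib)
  show ?thesis
  proof (rule barrier_supersolution[OF \<delta>(1)], rule profile_bounds)
    fix c K c1 C1
    assume c: "0 < c" and K: "0 \<le> K" and
      super: "\<And>t n. 0 \<le> t \<Longrightarrow> D (barrier \<delta> c t) n \<le>
        profile n * (- \<delta> * c * (scale n + c * t) powr (- \<delta> - 1)) + K * barrier \<delta> c t n"
      and C1: "0 < c1" "0 < C1" "\<And>n. 0 \<le> n \<Longrightarrow> c1 * scale n \<le> profile n" "\<And>n. 0 \<le> n \<Longrightarrow> profile n \<le> C1 * scale n"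
    define C0 where "C0 = 1 + 1 / c1"
    define C2 where "C2 = 1 + C1 * c powr (- \<delta>1)"
    have C0: "1 \<le> C0" "1 / c1 \<le> C0" "0 < C0" using C1 by (auto simp: C0_def add_pos_pos)
    have C2: "1 \<le> C2" "C1 * c powr (- \<delta>1) \<le> C2" using C1 by (auto simp: C2_def)
    have sp: "scale n powr r = 2 powr (- (\<beta> * r) * real_of_int n)" if "0 \<le> n" for n r
      using that by (simp add: scale_def powr_powr mult_ac)
    have e: "\<beta> * (1 - \<delta>) = \<theta>" "\<beta> * (1 - \<delta>2) = \<theta>'"
      using beta by (simp_all add: \<delta>_def \<delta>2_def right_diff_distrib diff_divide_distrib)
    have init: "wt \<theta> n \<le> C0 * barrier \<delta> c 0 n" for n
    proof (cases "0 \<le> n")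
      case True
      have "wt \<theta> n = scale n * scale n powr (- \<delta>)"
      proof -
        have "scale n * scale n powr (- \<delta>) = scale n powr (1 - \<delta>)"
          using scale_pos[of n] by (simp add: powr_diff powr_minus divide_inverse)
        also have "\<dots> = wt \<theta> n" using True beta by (cases "n = 0") (auto simp: sp e wt_def)
        finally show ?thesis by simp
      qed
      also have "\<dots> = (1 / c1) * (c1 * scale n * scale n powr (- \<delta>))" using C1 by simp
      also have "\<dots> \<le> C0 * (profile n * scale n powr (- \<delta>))"
        using C0 C1 True scale_pos[of n] by (intro mult_mono mult_right_mono) auto
      finally show ?thesis by (simp add: barrier_def)
    next
      case False
      then show ?thesis using C0 by (simp add: wt_def barrier_def scale_def profile_def)
    qed
    have fin: "barrier \<delta> c t n \<le> C2 * (1 + t powr (- \<delta>1)) * wt \<theta>' n" if t: "0 < t" for t n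
    proof (cases "0 \<le> n")
      case True
      have s0: "0 < scale n" by (rule scale_pos)
      have ct: "0 < c * t" using c t by simp
      have "(scale n + c * t) powr (- \<delta>) = (scale n + c * t) powr (- \<delta>1) * (scale n + c * t) powr (- \<delta>2)"
        by (simp add: \<delta>(4) flip: powr_add)
      also have "\<dots> \<le> (c * t) powr (- \<delta>1) * scale n powr (- \<delta>2)"
        using s0 ct \<delta> by (intro mult_mono powr_mono2') auto
      finally have "barrier \<delta> c t n \<le> (C1 * scale n) * ((c * t) powr (- \<delta>1) * scale n powr (- \<delta>2))"
        unfolding barrier_def using C1 True s0 profile_pos[of n] by (intro mult_mono) auto
      also have "\<dots> = C1 * c powr (- \<delta>1) * t powr (- \<delta>1) * (scale n * scale n powr (- \<delta>2))"
        using c t by (simp add: powr_mult mult_ac)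
      also have "scale n * scale n powr (- \<delta>2) = wt \<theta>' n"
      proof -
        have "scale n * scale n powr (- \<delta>2) = scale n powr (1 - \<delta>2)"
          using scale_pos[of n] by (simp add: powr_diff powr_minus divide_inverse)
        also have "\<dots> = wt \<theta>' n" using True beta by (cases "n = 0") (auto simp: sp e wt_def)
        finally show ?thesis by simp
      qed
      also have "C1 * c powr (- \<delta>1) * t powr (- \<delta>1) * wt \<theta>' n \<le> C2 * (1 + t powr (- \<delta>1)) * wt \<theta>' n"
        using C2 C1 wt_pos[of \<theta>' n] by (intro mult_right_mono mult_mono) auto
      finally show ?thesis .
    next
      case False
      have "1 \<le> 1 + c * t" using c t by simp
      then have "(1 + c * t) powr (- \<delta>) \<le> 1"
        using powr_mono[of "- \<delta>" 0 "1 + c * t"] \<delta>(1) c t by (auto split: if_splits)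
      then have "barrier \<delta> c t n \<le> wt \<theta>' n"
        using False by (simp add: barrier_def scale_def profile_def wt_def)
      also have "\<dots> = 1 * 1 * wt \<theta>' n" by simp
      also have "\<dots> \<le> C2 * (1 + t powr (- \<delta>1)) * wt \<theta>' n"
        using C2 wt_pos[of \<theta>' n] by (intro mult_right_mono mult_mono) auto
      finally show ?thesis .
    qed
    have "controls (\<lambda>t. C0 * C2 * (1 + t powr (- (\<theta>' - \<theta>) / \<beta>)) * exp (K * t)) \<theta> \<theta>'"
    proof (rule controlsI)
      fix y :: "real \<Rightarrow> int \<Rightarrow> real" and B t :: real and n :: int
      assume y: "admissible y" and y0: "\<And>n. \<bar>Dplus (y 0) n\<bar> \<le> B * wt \<theta> n" and B: "0 \<le> B" and t: "0 < t"
      define W where "W = (\<lambda>t n. B * C0 * exp (K * t) * barrier \<delta> c t n)"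
      define W' where "W' = (\<lambda>t n. B * C0 * exp (K * t) *
        (profile n * (- \<delta> * c * (scale n + c * t) powr (- \<delta> - 1)) + K * barrier \<delta> c t n))"
      have "\<bar>Dplus (y t) n\<bar> \<le> W t n"
      proof (rule Dplus_comparison[OF y, where W' = W'])
        show "((\<lambda>r. W r n) has_real_derivative W' t n) (at t within {0..})" if "0 \<le> t" for t n
        proof -
          have "0 < scale n + c * t" using scale_pos[of n] c that by (simp add: add_pos_nonneg)
          then show ?thesis unfolding W_def W'_def barrier_def
            by (auto intro!: derivative_eq_intros simp: algebra_simps)
        qed
        show "D (W t) n \<le> W' t n" if "0 \<le> t" for t n
        proof -
          have "D (W t) n = B * C0 * exp (K * t) * D (barrier \<delta> c t) n"
            unfolding W_def D_def by (rule tri_cmult)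
          also have "\<dots> \<le> W' t n" unfolding W'_def using B C0 super[OF that, of n] by (intro mult_left_mono) auto
          finally show ?thesis .
        qed
        show "0 \<le> W t n" for t n using B C0 barrier_nonneg by (simp add: W_def)
        show "\<bar>Dplus (y 0) n\<bar> \<le> W 0 n" for n
          using order_trans[OF y0 mult_left_mono[OF init B]] by (simp add: W_def mult_ac)
      qed (use t in auto)
      also have "\<dots> \<le> B * C0 * exp (K * t) * (C2 * (1 + t powr (- \<delta>1)) * wt \<theta>' n)"
        unfolding W_def using B C0 fin[OF t] by (intro mult_left_mono) auto
      finally show "\<bar>Dplus (y t) n\<bar> \<le> C0 * C2 * (1 + t powr (- (\<theta>' - \<theta>) / \<beta>)) * exp (K * t) * B * wt \<theta>' n"
        by (simp add: \<delta>1_def mult_ac minus_divide_left)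
    qed
    moreover have "0 < C0 * C2" using C0 C2 by simp
    ultimately show ?thesis using K by blast
  qed
qed

end

section \<open>Exponential decay\<close>

context chain
begin

definition flux :: "(int \<Rightarrow> real) \<Rightarrow> int \<Rightarrow> real" where
  "flux w n = g n * (w (n - 1) - s n * w n)"

lemma D_eq_flux: "D w n = (flux w n - flux w (n + 1)) / 4"
  by (simp add: D_def flux_def tri_def algebra_simps add_divide_distrib diff_divide_distrib)

text \<open>By \<open>D_eq_flux\<close> it suffices that the flux of \<open>w\<close> increases at least by \<open>4 * \<nu> * w n\<close> at each step.
  For \<open>w n = 2\<^bsup>-n\<^esup>\<close> and \<open>s n\<close> close to \<open>8\<close> the flux is about \<open>-6 * g0 * 2\<^bsup>-n\<^esup>\<close>, with
  increments about \<open>3 * g0 * w n\<close>. For constant \<open>w\<close> and large \<open>n\<close> it is about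
  \<open>2\<^bsup>\<beta>n\<^esup> * w n\<close>, which increases because \<open>\<beta> > 0\<close>. In the finite range in between any negative
  increasing flux can be prescribed: solving \<open>flux w n = \<Phi>\<close> for \<open>w n\<close> keeps \<open>w\<close> positive, and the
  minimum of finitely many positive increments contributes to \<open>\<nu>\<close>.\<close>

lemma decay_supersolution:
  obtains w \<nu> c C where "0 < \<nu>" "0 < c" "0 < C" "\<And>n. D w n \<le> - \<nu> * w n"
    "\<And>n. c * wt 0 n \<le> w n" "\<And>n. w n \<le> C * wt 0 n"
proof -
  define e where "e = (\<lambda>n::int. 2 powr (- real_of_int n))"
  have e_pred: "e (n - 1) = 2 * e n" for n
    using powr_add[of 2 1 "- real_of_int n"] by (simp add: e_def)
  have e_pos: "0 < e n" for n by (simp add: e_def)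
  define G where "G = (\<lambda>n. g n * (2 - s n))"
  have Glim: "(G \<longlongrightarrow> g0 * (2 - 8)) at_bot" unfolding G_def
    by (intro tendsto_mult tendsto_diff tendsto_const g_bot s_bot)
  have "((\<lambda>n. G (n + 1) / 2 - G n) \<longlongrightarrow> g0 * (2 - 8) / 2 - g0 * (2 - 8)) at_bot"
    by (intro tendsto_diff tendsto_divide tendsto_const tendsto_int_shift(2)[OF Glim] Glim) auto
  then have "eventually (\<lambda>n. g0 < G (n + 1) / 2 - G n) at_bot"
    by (rule order_tendstoD(1)) (use g0 in simp)
  moreover have "eventually (\<lambda>n. 2 < s n) at_bot" by (rule order_tendstoD(1)[OF s_bot]) simp
  ultimately have "eventually (\<lambda>n. g0 < G (n + 1) / 2 - G n \<and> 2 < s n) at_bot"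
    by eventually_elim auto
  then obtain m where "\<forall>n\<le>m. g0 < G (n + 1) / 2 - G n \<and> 2 < s n"
    unfolding eventually_at_bot_linorder by (rule exE)
  then have m: "n \<le> m \<Longrightarrow> g0 < G (n + 1) / 2 - G n" "n \<le> m \<Longrightarrow> 2 < s n" for n by auto
  have b1: "1 < 2 powr \<beta>" using beta powr_less_mono[of 0 \<beta> 2] by simp
  define r where "r = (\<lambda>n. g n / dyad \<beta> n)"
  have r: "(r \<longlongrightarrow> 1) at_top" unfolding r_def by (rule g_top)
  have gs: "((\<lambda>n. dyad (- \<beta>) n * (g n * s n)) \<longlongrightarrow> 0 * 0) at_top"
    by (intro tendsto_mult powr_int_tendsto_0_at_top gs_top beta)
  \<comment> \<open>\<open>q\<close> tends to 1 and is the factor by which the flux of a constant sequence deviates from \<open>2\<^bsup>\<beta>n\<^esup>\<close>\<close>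
  define q where "q = (\<lambda>n. r n - dyad (- \<beta>) n * (g n * s n))"
  have q: "(q \<longlongrightarrow> 1) at_top" unfolding q_def using tendsto_diff[OF r gs] by simp
  have q_eq: "g n * (1 - s n) = dyad \<beta> n * q n" for n
  proof -
    have "dyad \<beta> n * r n = g n" by (simp add: r_def)
    moreover have "dyad \<beta> n * dyad (- \<beta>) n = 1" by (simp flip: powr_add)
    ultimately show ?thesis unfolding q_def right_diff_distrib mult.assoc[symmetric] by simp
  qed
  have "((\<lambda>n. 2 powr \<beta> * q (n + 1) - q n) \<longlongrightarrow> 2 powr \<beta> * 1 - 1) at_top"
    by (intro tendsto_diff tendsto_mult tendsto_const tendsto_int_shift(1)[OF q] q)
  then have "eventually (\<lambda>n. (2 powr \<beta> - 1) / 2 < 2 powr \<beta> * q (n + 1) - q n) at_top"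
    by (rule order_tendstoD(1)) (use b1 in simp)
  moreover have "eventually (\<lambda>n. 0 < q n) at_top" by (rule order_tendstoD(1)[OF q]) simp
  moreover have "eventually (\<lambda>n. max 1 (m + 1) \<le> n) at_top" by (rule eventually_ge_at_top)
  ultimately have "eventually (\<lambda>n. (2 powr \<beta> - 1) / 2 < 2 powr \<beta> * q (n + 1) - q n \<and> 0 < q n \<and> max 1 (m + 1) \<le> n) at_top"
    by eventually_elim auto
  then obtain N where N_all: "\<forall>n\<ge>N. (2 powr \<beta> - 1) / 2 < 2 powr \<beta> * q (n + 1) - q n \<and> 0 < q n \<and> max 1 (m + 1) \<le> n"
    unfolding eventually_at_top_linorder by (rule exE)
  have N: "N \<le> n \<Longrightarrow> (2 powr \<beta> - 1) / 2 < 2 powr \<beta> * q (n + 1) - q n"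
    "N \<le> n \<Longrightarrow> 0 < q n" "1 \<le> N" "m < N" for n
    using N_all[rule_format, of n] N_all[rule_format, of N] by auto
  \<comment> \<open>the flux prescribed between m and N: negative and increasing\<close>
  define \<Phi> where "\<Phi> = (\<lambda>i::nat. G m * e m / 2 ^ i)"
  have Gm: "G m < 0" using m(2)[of m] g_pos[of m] by (simp add: G_def mult_pos_neg)
  have \<Phi>: "\<Phi> i < 0" "\<Phi> (Suc i) = \<Phi> i / 2" for i
    using Gm e_pos[of m] by (auto simp: \<Phi>_def divide_neg_pos mult_neg_pos)
  define u where "u = rec_nat (e m) (\<lambda>i x. (x - \<Phi> (Suc i) / g (m + 1 + int i)) / s (m + 1 + int i))"
  have u0: "u 0 = e m" and uS: "u (Suc i) = (u i - \<Phi> (Suc i) / g (m + 1 + int i)) / s (m + 1 + int i)" for i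
    by (simp_all add: u_def)
  have u_pos: "0 < u i" for i
  proof (induction i)
    case (Suc i)
    have "\<Phi> (Suc i) / g (m + 1 + int i) < 0" using \<Phi>(1) g_pos by (intro divide_neg_pos) auto
    then show ?case unfolding uS using Suc s_pos by (intro divide_pos_pos) auto
  qed (simp add: u0 e_pos)
  define w where "w = (\<lambda>n. if n \<le> m then e n else if n \<le> N then u (nat (n - m)) else u (nat (N - m)))"
  define wN where "wN = u (nat (N - m))"
  have wN: "0 < wN" by (simp add: wN_def u_pos)
  have w_pos: "0 < w n" for n by (simp add: w_def e_pos u_pos)
  have w_left: "w n = e n" if "n \<le> m" for n using that by (simp add: w_def)
  have w_right: "w n = wN" if "N \<le> n" for n using that N by (auto simp: w_def wN_def)
  have w_mid: "w n = u (nat (n - m))" if "m \<le> n" "n \<le> N" for n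
    using that by (cases "n = m") (auto simp: w_def u0)
  have F_left: "flux w n = G n * e n" if "n \<le> m" for n
    using that by (simp add: flux_def w_left e_pred G_def algebra_simps)
  have F_mid: "flux w n = \<Phi> (nat (n - m))" if n: "m \<le> n" "n \<le> N" for n
  proof (cases "n = m")
    case True then show ?thesis using F_left[of m] by (simp add: \<Phi>_def)
  next
    case False
    define i where "i = nat (n - m - 1)"
    have i: "nat (n - m) = Suc i" "nat (n - 1 - m) = i" "n = m + 1 + int i" using n False by (auto simp: i_def)
    have "s n * w n = w (n - 1) - \<Phi> (Suc i) / g n"
      using w_mid[of n] w_mid[of "n - 1"] n False uS[of i] s_pos[of n] i by simp
    then have "flux w n = g n * (\<Phi> (Suc i) / g n)" by (simp add: flux_def)
    then show ?thesis using g_pos[of n] i by simp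
  qed
  have F_right: "flux w n = dyad \<beta> n * q n * wN" if "N < n" for n
  proof -
    have "flux w n = (g n * (1 - s n)) * wN"
      using that w_right[of n] w_right[of "n - 1"] by (simp add: flux_def algebra_simps)
    then show ?thesis unfolding q_eq .
  qed
  define \<kappa>1 where "\<kappa>1 = (2 powr \<beta> - 1) / 2"
  have \<kappa>1: "0 < \<kappa>1" using b1 by (simp add: \<kappa>1_def)
  have inc_left: "g0 * w n \<le> flux w (n + 1) - flux w n" if "n < m" for n
  proof -
    have en: "e (n + 1) = e n / 2" using e_pred[of "n + 1"] by simp
    have "flux w (n + 1) - flux w n = (G (n + 1) / 2 - G n) * w n"
    proof -
      have "flux w (n + 1) = G (n + 1) * (e n / 2)" using F_left[of "n + 1"] that by (simp add: en)
      moreover have "flux w n = G n * e n" "w n = e n" using F_left[of n] w_left[of n] that by simp_all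
      ultimately show ?thesis by (simp add: left_diff_distrib)
    qed
    also have "g0 * w n \<le> \<dots>" using m(1)[of n] that w_pos[of n] by (intro mult_right_mono) auto
    finally show ?thesis .
  qed
  have inc_right: "\<kappa>1 * w n \<le> flux w (n + 1) - flux w n" if n: "N < n" for n
  proof -
    have "flux w (n + 1) - flux w n = dyad \<beta> n * ((2 powr \<beta> * q (n + 1) - q n) * wN)"
      using n by (simp add: F_right algebra_simps powr_add)
    moreover have "1 * (\<kappa>1 * wN) \<le> dyad \<beta> n * ((2 powr \<beta> * q (n + 1) - q n) * wN)"
    proof (intro mult_mono ge_one_powr_ge_zero)
      show "\<kappa>1 \<le> 2 powr \<beta> * q (n + 1) - q n" using N(1)[of n] n by (simp add: \<kappa>1_def)
      then show "0 \<le> 2 powr \<beta> * q (n + 1) - q n" using \<kappa>1 by linarith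
    qed (use n wN \<kappa>1 N(3) beta in auto)
    ultimately show ?thesis using w_right[of n] n by simp
  qed
  have inc_mid: "0 < flux w (n + 1) - flux w n" if n: "m \<le> n" "n \<le> N" for n
  proof (cases "n = N")
    case True
    have "0 < flux w (N + 1)" unfolding F_right[of "N + 1", simplified] using N(2)[of "N + 1"] wN by simp
    then show ?thesis using True F_mid[of N] \<Phi>(1)[of "nat (N - m)"] n by simp
  next
    case False
    have "nat (n + 1 - m) = Suc (nat (n - m))" using n by simp
    then show ?thesis using F_mid[of n] F_mid[of "n + 1"] \<Phi>[of "nat (n - m)"] n False by simp
  qed
  obtain \<kappa>2 where \<kappa>2: "0 < \<kappa>2" "\<And>n. n \<in> {m..N} \<Longrightarrow> \<kappa>2 \<le> (flux w (n + 1) - flux w n) / w n"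
  proof (rule pos_bounds_finite[of "{m..N}" "\<lambda>n. (flux w (n + 1) - flux w n) / w n" 1 1])
    fix c C assume "0 < c" "\<And>n. n \<in> {m..N} \<Longrightarrow> c \<le> (flux w (n + 1) - flux w n) / w n"
    then show thesis using that[of c] by simp
  next
    show "finite {n \<in> {m..N}. \<not> (1 \<le> (flux w (n + 1) - flux w n) / w n \<and> (flux w (n + 1) - flux w n) / w n \<le> 1)}"
      by (rule finite_subset[of _ "{m..N}"]) auto
  qed (use inc_mid w_pos in auto)
  define \<nu> where "\<nu> = min (min g0 \<kappa>1) \<kappa>2 / 4"
  have \<nu>: "0 < \<nu>" "4 * \<nu> \<le> g0" "4 * \<nu> \<le> \<kappa>1" "4 * \<nu> \<le> \<kappa>2" using g0 \<kappa>1 \<kappa>2(1) by (auto simp: \<nu>_def)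
  have super: "D w n \<le> - \<nu> * w n" for n
  proof -
    have "4 * \<nu> * w n \<le> flux w (n + 1) - flux w n"
    proof -
      consider "n < m" | "m \<le> n" "n \<le> N" | "N < n" by linarith
      then show ?thesis
      proof cases
        case 1
        have "4 * \<nu> * w n \<le> g0 * w n" using \<nu>(2) w_pos[of n] by (intro mult_right_mono) auto
        then show ?thesis using inc_left[OF 1] by linarith
      next
        case 2
        have "4 * \<nu> * w n \<le> \<kappa>2 * w n" using \<nu>(4) w_pos[of n] by (intro mult_right_mono) auto
        moreover have "\<kappa>2 * w n \<le> flux w (n + 1) - flux w n"
          using \<kappa>2(2)[of n] 2 w_pos[of n] by (simp add: pos_le_divide_eq)
        ultimately show ?thesis by linarith
      next
        case 3
        have "4 * \<nu> * w n \<le> \<kappa>1 * w n" using \<nu>(3) w_pos[of n] by (intro mult_right_mono) auto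
        then show ?thesis using inc_right[OF 3] by linarith
      qed
    qed
    then show ?thesis by (simp add: D_eq_flux)
  qed
  have ratio_pos: "0 < w n / wt 0 n" for n using w_pos wt_pos by simp
  define E where "E = {n \<in> UNIV. \<not> (min 1 wN \<le> w n / wt 0 n \<and> w n / wt 0 n \<le> max 1 wN)}"
  have "E \<subseteq> {min m 0..max N 0}"
  proof
    fix n assume n: "n \<in> E"
    have "w n / wt 0 n = 1" if "\<not> min m 0 \<le> n"
    proof -
      have "n \<le> 0" "n \<le> m" using that by linarith+
      then show ?thesis using w_left[of n] by (simp add: wt_def e_def)
    qed
    moreover have "w n / wt 0 n = wN" if "\<not> n \<le> max N 0"
    proof -
      have "0 < n" "N \<le> n" using that by linarith+
      then show ?thesis using w_right[of n] by (simp add: wt_def)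
    qed
    moreover have "\<not> (w n / wt 0 n = 1 \<or> w n / wt 0 n = wN)" using n by (auto simp: E_def)
    ultimately show "n \<in> {min m 0..max N 0}" by auto
  qed
  then have fin: "finite E"
    by (rule finite_subset) simp
  show ?thesis
  proof (rule pos_bounds_finite[OF _ fin[unfolded E_def]])
    fix c C assume "0 < c" "0 < C" "\<And>n. n \<in> UNIV \<Longrightarrow> c \<le> w n / wt 0 n" "\<And>n. n \<in> UNIV \<Longrightarrow> w n / wt 0 n \<le> C"
    then show ?thesis using that[of \<nu> c C w] \<nu>(1) super wt_pos by (simp add: pos_le_divide_eq pos_divide_le_eq)
  qed (use ratio_pos wN in auto)
qed

lemma Dplus_decay: "\<exists>\<nu>>0. \<exists>C>0. controls (\<lambda>t. C * exp (- \<nu> * t)) 0 0"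
proof (rule decay_supersolution)
  fix w \<nu> c C assume \<nu>: "0 < \<nu>" and c: "0 < c" and C: "0 < C" and super: "\<And>n. D w n \<le> - \<nu> * w n"
    and w: "\<And>n. c * wt 0 n \<le> w n" "\<And>n. w n \<le> C * wt 0 n"
  have w_pos: "0 \<le> w n" for n using w(1)[of n] c wt_pos[of 0 n] by (smt (verit) mult_pos_pos)
  have "controls (\<lambda>t. C / c * exp (- \<nu> * t)) 0 0"
  proof (rule controlsI)
    fix y :: "real \<Rightarrow> int \<Rightarrow> real" and B t :: real and n :: int
    assume y: "admissible y" and y0: "\<And>n. \<bar>Dplus (y 0) n\<bar> \<le> B * wt 0 n" and B: "0 \<le> B" and t: "0 < t"
    define b where "b = B / c"
    have b: "0 \<le> b" using B c by (simp add: b_def)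
    define W where "W = (\<lambda>t n. (b * exp (- \<nu> * t)) * w n)"
    define W' where "W' = (\<lambda>t n. (b * exp (- \<nu> * t)) * (- \<nu> * w n))"
    have "\<bar>Dplus (y t) n\<bar> \<le> W t n"
    proof (rule Dplus_comparison[OF y, where W' = W'])
      show "((\<lambda>r. W r n) has_real_derivative W' t n) (at t within {0..})" for t n
        unfolding W_def W'_def by (auto intro!: derivative_eq_intros)
      show "D (W t) n \<le> W' t n" for t n
        unfolding W_def W'_def D_def tri_cmult
        by (intro mult_left_mono super[unfolded D_def]) (use b in auto)
      show "0 \<le> W t n" for t n using b w_pos by (simp add: W_def)
      show "\<bar>Dplus (y 0) n\<bar> \<le> W 0 n" for n
        using y0[of n] mult_left_mono[OF w(1)[of n] b] c by (simp add: W_def b_def)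
    qed (use t in auto)
    also have "\<dots> \<le> (b * exp (- \<nu> * t)) * (C * wt 0 n)"
      unfolding W_def using b w(2) by (intro mult_left_mono) auto
    finally show "\<bar>Dplus (y t) n\<bar> \<le> C / c * exp (- \<nu> * t) * B * wt 0 n"
      by (simp add: b_def mult_ac)
  qed
  moreover have "0 < C / c" using c C by simp
  ultimately show ?thesis using \<nu> by blast
qed

end

section \<open>Limits at infinity\<close>

lemma tendsto_int_of_nat:
  fixes f :: "int \<Rightarrow> real"
  assumes "(\<lambda>k. f (N + int k)) \<longlonglongrightarrow> l"
  shows "(f \<longlongrightarrow> l) at_top"
proof -
  have "\<exists>M. \<forall>n\<ge>M. Z \<le> nat (n - N)" for Z
    by (intro exI[of _ "N + int Z"]) auto
  then have "filterlim (\<lambda>n. nat (n - N)) at_top at_top"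
    unfolding filterlim_at_top eventually_at_top_linorder by blast
  from filterlim_compose[OF assms this]
  show ?thesis
    by (rule Lim_transform_eventually) (auto intro: eventually_at_top_linorderI[of N])
qed

text \<open>\<open>S - V\<close> increases, \<open>S + V\<close> decreases, and the gap between them tends to zero.\<close>

lemma limit_by_telescoping:
  fixes S V :: "int \<Rightarrow> real"
  assumes diff: "\<And>n. N \<le> n \<Longrightarrow> \<bar>S (n + 1) - S n\<bar> \<le> V n - V (n + 1)"
    and V: "(V \<longlongrightarrow> 0) at_top"
  obtains l where "(S \<longlongrightarrow> l) at_top" "\<And>n. N \<le> n \<Longrightarrow> \<bar>S n - l\<bar> \<le> V n"
proof -
  have lim: "\<exists>l. (S \<longlongrightarrow> l) at_top \<and> \<bar>S M - l\<bar> \<le> V M" if M: "N \<le> M" for M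
  proof -
    define lo where "lo = (\<lambda>k. S (M + int k) - V (M + int k))"
    define hi where "hi = (\<lambda>k. S (M + int k) + V (M + int k))"
    have step: "\<bar>S (M + int (Suc k)) - S (M + int k)\<bar> \<le> V (M + int k) - V (M + int (Suc k))" for k
      using diff[of "M + int k"] M by (simp add: ac_simps)
    have inc: "incseq lo" unfolding lo_def using step by (intro incseq_SucI) (smt (verit))
    have dec: "decseq hi" unfolding hi_def using step by (intro decseq_SucI) (smt (verit))
    have V_seq: "(\<lambda>k. V (M + int k)) \<longlonglongrightarrow> 0"
    proof (rule filterlim_compose[OF V])
      have "\<exists>K. \<forall>k\<ge>K. Z \<le> M + int k" for Z by (intro exI[of _ "nat (Z - M)"]) auto
      then show "filterlim (\<lambda>k. M + int k) at_top sequentially"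
        unfolding filterlim_at_top eventually_sequentially by blast
    qed
    have V0: "0 \<le> V (M + int k)" for k
    proof -
      have "decseq (\<lambda>k. V (M + int k))" using step by (intro decseq_SucI) (smt (verit))
      then show ?thesis using V_seq by (rule decseq_ge)
    qed
    have "lo k \<le> hi 0" for k
      using decseqD[OF dec, of 0 k] V0[of k] by (simp add: lo_def hi_def)
    then obtain l where l: "lo \<longlonglongrightarrow> l" "\<And>k. lo k \<le> l" using incseq_convergent[OF inc, of "hi 0"] by blast
    have Sl: "(\<lambda>k. S (M + int k)) \<longlonglongrightarrow> l"
      using tendsto_add[OF l(1) V_seq] by (simp add: lo_def)
    then have "hi \<longlonglongrightarrow> l" unfolding hi_def using tendsto_add[OF Sl V_seq] by simp
    then have "l \<le> hi 0" by (rule decseq_ge[OF dec])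
    then have "\<bar>S M - l\<bar> \<le> V M" using l(2)[of 0] by (simp add: lo_def hi_def)
    then show ?thesis using tendsto_int_of_nat[OF Sl] by blast
  qed
  obtain l where l: "(S \<longlongrightarrow> l) at_top" using lim[of N] by auto
  have "\<bar>S n - l\<bar> \<le> V n" if n: "N \<le> n" for n
  proof -
    obtain l' where "(S \<longlongrightarrow> l') at_top" "\<bar>S n - l'\<bar> \<le> V n" using lim[OF n] by blast
    moreover from this l have "l' = l" by (intro tendsto_unique[OF trivial_limit_at_top_linorder])
    ultimately show ?thesis by simp
  qed
  then show ?thesis using that l by blast
qed

definition tail_bound :: "real \<Rightarrow> real \<Rightarrow> bool" where
  "tail_bound C \<rho> \<longleftrightarrow> (\<forall>y X. (\<forall>n. \<bar>Dplus y n\<bar> \<le> X * wt \<rho> n) \<longrightarrow>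
    (\<exists>l. (y \<longlongrightarrow> l) at_top \<and> (\<forall>n. \<bar>y n - l\<bar> \<le> C * X * wt \<rho> n)))"

text \<open>\<open>wt \<rho>\<close> is bounded by the decrements of a sequence \<open>V\<close> that is itself at most a multiple of
  \<open>wt \<rho>\<close>: a geometric tail on the right, and \<open>2 * 2\<^bsup>-n\<^esup>\<close> plus a constant on the left.\<close>

lemma limit_of_Dplus_bound:
  assumes \<rho>: "0 < \<rho>"
  shows "\<exists>C>0. tail_bound C \<rho>"
proof -
  define q where "q = 2 powr (- \<rho>)"
  have q: "0 < q" "q < 1" using \<rho> powr_less_mono[of "- \<rho>" 0 2] by (auto simp: q_def)
  define V where "V = (\<lambda>n. if 0 < n then dyad (- \<rho>) n / (1 - q)
    else 2 * 2 powr (- real_of_int n) + q / (1 - q))"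
  have V_succ: "wt \<rho> n \<le> V n - V (n + 1)" for n
  proof -
    consider "0 < n" | "n = 0" | "n < 0" by linarith
    then show ?thesis
    proof cases
      case 1
      define P where "P = dyad (- \<rho>) n"
      have "dyad (- \<rho>) (n + 1) = q * P"
        by (simp add: q_def P_def algebra_simps flip: powr_add)
      then have "V (n + 1) = q * P / (1 - q)" using 1 by (simp add: V_def)
      moreover have "V n = P / (1 - q)" using 1 by (simp add: V_def P_def)
      ultimately have "V n - V (n + 1) = (P - q * P) / (1 - q)" by (simp add: diff_divide_distrib)
      also have "P - q * P = (1 - q) * P" by (simp add: left_diff_distrib)
      finally show ?thesis using 1 q by (simp add: wt_def P_def)
    next
      case 2
      then show ?thesis by (simp add: V_def wt_def q_def)
    next
      case 3
      have "2 powr (- real_of_int n) = 2 * 2 powr (- real_of_int (n + 1))"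
        using powr_add[of 2 1 "- real_of_int (n + 1)"] by simp
      then show ?thesis using 3 by (simp add: V_def wt_def)
    qed
  qed
  have V_le: "V n \<le> (2 + 1 / (1 - q)) * wt \<rho> n" for n
  proof (cases "0 < n")
    case True
    then show ?thesis using q by (simp add: V_def wt_def algebra_simps)
  next
    case False
    have "1 \<le> 2 powr (- real_of_int n)" using False by (intro ge_one_powr_ge_zero) auto
    then have "1 * (q / (1 - q)) \<le> 2 powr (- real_of_int n) * (1 / (1 - q))"
      using q by (intro mult_mono divide_right_mono) auto
    then show ?thesis using False by (simp add: V_def wt_def algebra_simps)
  qed
  have V_lim: "(V \<longlongrightarrow> 0) at_top"
  proof -
    have "((\<lambda>n::int. dyad (- \<rho>) n / (1 - q)) \<longlongrightarrow> 0 / (1 - q)) at_top"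
      using q by (intro tendsto_divide powr_int_tendsto_0_at_top \<rho> tendsto_const) auto
    then have H: "((\<lambda>n::int. dyad (- \<rho>) n / (1 - q)) \<longlongrightarrow> 0) at_top" by simp
    show ?thesis
      by (rule Lim_transform_eventually[OF H], rule eventually_at_top_linorderI[of 1]) (simp add: V_def)
  qed
  show ?thesis unfolding tail_bound_def
  proof (rule exI[of _ "2 + 1 / (1 - q)"], intro conjI allI impI)
    show "0 < 2 + 1 / (1 - q)" using q by (simp add: add_pos_pos)
    fix y X assume "\<forall>n. \<bar>Dplus y n\<bar> \<le> X * wt \<rho> n"
    then have y: "\<bar>Dplus y n\<bar> \<le> X * wt \<rho> n" for n by blast
    have X: "0 \<le> X" by (rule wt_bound_nonneg[OF y])
    have step: "\<bar>y (n + 1) - y n\<bar> \<le> X * V n - X * V (n + 1)" for n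
      using y[of n] mult_left_mono[OF V_succ[of n] X] by (simp add: Dplus_def right_diff_distrib)
    have lim0: "((\<lambda>n. X * V n) \<longlongrightarrow> 0) at_top" using tendsto_mult[OF tendsto_const V_lim, of X] by simp
    have lim: "\<exists>l. (y \<longlongrightarrow> l) at_top \<and> \<bar>y n - l\<bar> \<le> X * V n" for n
    proof (rule limit_by_telescoping[of n y "\<lambda>n. X * V n", OF step lim0])
      fix l assume "(y \<longlongrightarrow> l) at_top" "\<And>k. n \<le> k \<Longrightarrow> \<bar>y k - l\<bar> \<le> X * V k"
      then show ?thesis by blast
    qed
    obtain l where l: "(y \<longlongrightarrow> l) at_top" using lim by blast
    have "\<bar>y n - l\<bar> \<le> (2 + 1 / (1 - q)) * X * wt \<rho> n" for n
    proof -
      obtain l' where l': "(y \<longlongrightarrow> l') at_top" "\<bar>y n - l'\<bar> \<le> X * V n" using lim[of n] by blast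
      have "l' = l" using l'(1) l by (intro tendsto_unique[OF trivial_limit_at_top_linorder])
      then show ?thesis using l'(2) mult_left_mono[OF V_le[of n] X] by (simp add: mult_ac)
    qed
    then have "\<forall>n. \<bar>y n - l\<bar> \<le> (2 + 1 / (1 - q)) * X * wt \<rho> n" by (rule allI)
    with l show "\<exists>l. (y \<longlongrightarrow> l) at_top \<and> (\<forall>n. \<bar>y n - l\<bar> \<le> (2 + 1 / (1 - q)) * X * wt \<rho> n)"
      by (intro exI[of _ l] conjI)
  qed
qed

text \<open>If \<open>2\<^bsup>\<beta>n\<^esup> * Dplus y n\<close> is close to \<open>l\<close>, then adding the geometric tail \<open>l * 2\<^bsup>-\<beta>n\<^esup> / (1 - 2\<^bsup>-\<beta>\<^esup>)\<close> to
  \<open>y\<close> leaves differences that are small multiples of \<open>2\<^bsup>-\<beta>n\<^esup>\<close>, and telescoping applies to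
  the sum.\<close>

lemma scaled_tail_limit:
  fixes y :: "int \<Rightarrow> real"
  assumes \<beta>: "0 < \<beta>"
    and Dy: "((\<lambda>n. dyad \<beta> n * Dplus y n) \<longlongrightarrow> l) at_top" and y: "(y \<longlongrightarrow> yinf) at_top"
  shows "((\<lambda>n. dyad \<beta> n * (y n - yinf)) \<longlongrightarrow> - l / (1 - 2 powr (- \<beta>))) at_top"
proof (rule tendstoI)
  fix \<epsilon> :: real assume \<epsilon>: "0 < \<epsilon>"
  define q where "q = 2 powr (- \<beta>)"
  have q: "0 < q" "q < 1" using \<beta> powr_less_mono[of "- \<beta>" 0 2] by (auto simp: q_def)
  define x where "x = (\<lambda>n::int. dyad (- \<beta>) n)"
  have x_pos: "0 < x n" for n by (simp add: x_def)
  have x_succ: "x (n + 1) = q * x n" for n by (simp add: x_def q_def algebra_simps flip: powr_add)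
  have x_lim: "(x \<longlongrightarrow> 0) at_top" unfolding x_def by (rule powr_int_tendsto_0_at_top[OF \<beta>])
  have inv: "dyad \<beta> n * x n = 1" for n by (simp add: x_def flip: powr_add)
  define e where "e = \<epsilon> / 2 * (1 - q)"
  have e: "0 < e" using \<epsilon> q by (simp add: e_def)
  from tendstoD[OF Dy e] obtain N where
    "\<forall>n\<ge>N. dist (dyad \<beta> n * Dplus y n) l < e"
    unfolding eventually_at_top_linorder by (rule exE)
  then have N: "\<bar>(dyad \<beta> n) * Dplus y n - l\<bar> < e" if "N \<le> n" for n
    using that by (simp add: dist_real_def)
  define R where "R = (\<lambda>n. y n + l * x n / (1 - q))"
  have step: "\<bar>R (n + 1) - R n\<bar> \<le> e * x n / (1 - q) - e * x (n + 1) / (1 - q)" if n: "N \<le> n" for n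
  proof -
    have qx: "c * x n / (1 - q) - c * (q * x n) / (1 - q) = c * x n" for c
    proof -
      have "c * x n / (1 - q) - c * (q * x n) / (1 - q) = (1 - q) * (c * x n) / (1 - q)"
        by (simp add: algebra_simps flip: diff_divide_distrib)
      then show ?thesis using q by simp
    qed
    have "R (n + 1) - R n = Dplus y n - l * x n"
      using qx[of l] by (simp add: R_def Dplus_def x_succ)
    also have "\<dots> = (dyad \<beta> n * Dplus y n - l) * x n"
      using inv[of n] by (simp add: left_diff_distrib)
    finally have "\<bar>R (n + 1) - R n\<bar> = \<bar>(dyad \<beta> n) * Dplus y n - l\<bar> * x n"
      using x_pos[of n] by (simp add: abs_mult)
    also have "\<dots> \<le> e * x n" using N[OF n] x_pos[of n] by (intro mult_right_mono) auto
    finally show ?thesis using qx[of e] by (simp add: x_succ)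
  qed
  have V_lim: "((\<lambda>n. e * x n / (1 - q)) \<longlongrightarrow> 0) at_top"
    using tendsto_mult[OF tendsto_const x_lim, of "e / (1 - q)"] by simp
  have R_lim: "(R \<longlongrightarrow> yinf) at_top"
    using tendsto_add[OF y tendsto_mult[OF tendsto_const x_lim, of "l / (1 - q)"]] by (simp add: R_def)
  have bound: "\<bar>R n - yinf\<bar> \<le> e * x n / (1 - q)" if n: "N \<le> n" for n
  proof (rule limit_by_telescoping[of N R "\<lambda>n. e * x n / (1 - q)", OF step V_lim])
    fix l' assume "(R \<longlongrightarrow> l') at_top" and b: "\<And>n. N \<le> n \<Longrightarrow> \<bar>R n - l'\<bar> \<le> e * x n / (1 - q)"
    then have "l' = yinf" using R_lim by (intro tendsto_unique[OF trivial_limit_at_top_linorder])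
    then show ?thesis using b[OF n] by simp
  qed
  have "dist (dyad \<beta> n * (y n - yinf)) (- l / (1 - 2 powr (- \<beta>))) < \<epsilon>" if n: "N \<le> n" for n
  proof -
    define p where "p = dyad \<beta> n"
    have p: "0 < p" "p * x n = 1" using inv[of n] by (simp_all add: p_def)
    have "p * (y n - yinf) + l / (1 - q) = p * (y n - yinf) + (p * x n) * l / (1 - q)" using p by simp
    also have "\<dots> = p * (R n - yinf)" by (simp add: R_def algebra_simps)
    finally have "\<bar>p * (y n - yinf) + l / (1 - q)\<bar> = p * \<bar>R n - yinf\<bar>" using p by (simp add: abs_mult)
    also have "\<dots> \<le> p * (e * x n / (1 - q))" using bound[OF n] p by (intro mult_left_mono) auto
    also have "\<dots> = (p * x n) * (e / (1 - q))" by simp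
    also have "e / (1 - q) = \<epsilon> / 2"
      unfolding e_def by (rule nonzero_mult_div_cancel_right) (use q in simp)
    also have "p * x n * (\<epsilon> / 2) = \<epsilon> / 2" by (simp add: p)
    also have "\<dots> < \<epsilon>" using \<epsilon> by simp
    finally have "\<bar>p * (y n - yinf) + l / (1 - q)\<bar> < \<epsilon>" .
    moreover have "p * (y n - yinf) - (- l / (1 - q)) = p * (y n - yinf) + l / (1 - q)" by simp
    ultimately show ?thesis unfolding dist_real_def p_def[symmetric] q_def[symmetric] by (simp only:)
  qed
  then show "eventually (\<lambda>n. dist (dyad \<beta> n * (y n - yinf)) (- l / (1 - 2 powr (- \<beta>))) < \<epsilon>) at_top"
    by (rule eventually_at_top_linorderI)
qed

context chain
begin

lemma solution_exists:
  assumes y0: "\<And>n. \<bar>y0 n\<bar> \<le> B * wt 0 n"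
  obtains y K where "admissible y" "\<And>n. y 0 n = y0 n" "0 \<le> K"
    "\<And>t n. 0 \<le> t \<Longrightarrow> \<bar>y t n\<bar> \<le> B * exp (K * t) * wt 0 n"
proof -
  obtain K where K: "0 \<le> K" "\<And>n. L growth n \<le> K * growth n" "\<And>n. L (wt 0) n \<le> K * wt 0 n"
    using growth_bounds by auto
  have far: "finite {n. \<not> wt 0 n \<le> \<epsilon> * growth n}" if "0 < \<epsilon>" for \<epsilon>
    using wt_small_growth[of 0 \<epsilon> 1] that by simp
  have B: "0 \<le> B" by (rule wt_bound_nonneg[OF y0])
  show ?thesis
  proof (rule tri_solution_exists[of "\<lambda>n. g n / 4" "\<lambda>n. g n * s n / 4" "wt 0" "\<lambda>n. (g n + g n * s n) / 4" K growth y0 B,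
        folded L_def])
    fix y assume y: "\<And>n. y 0 n = y0 n"
      "\<And>t n. 0 \<le> t \<Longrightarrow> ((\<lambda>s. y s n) has_real_derivative L (y t) n) (at t within {0..})"
      "\<And>t n. 0 \<le> t \<Longrightarrow> \<bar>y t n\<bar> \<le> B * exp (K * t) * wt 0 n"
    have "\<bar>y t n\<bar> \<le> (B * exp (K * T)) * wt 0 n" if "t \<in> {0..T}" for t T n
    proof -
      have "B * exp (K * t) * wt 0 n \<le> (B * exp (K * T)) * wt 0 n"
        using that B K(1) wt_pos[of 0 n] by (intro mult_right_mono mult_left_mono) (auto intro: mult_left_mono)
      then show ?thesis using y(3)[of t n] that by simp
    qed
    then have "\<forall>T\<ge>0. \<exists>B. \<forall>t\<in>{0..T}. \<forall>n. \<bar>y t n\<bar> \<le> B * wt 0 n" by blast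
    then have "admissible y" unfolding admissible_def using y(2) by (auto intro!: exI[of _ 0])
    then show ?thesis using that y K(1) by blast
  qed (use K g_pos s_pos wt_pos growth_pos far y0 in \<open>auto simp: less_imp_le\<close>)
qed

text \<open>For \<open>t \<le> 1\<close> this is smoothing, the exponential factor being absorbed in the constant. For
  \<open>t > 1\<close> smoothing up to time \<open>1 / 2\<close> puts the differences below \<open>wt 0\<close>, they then decay until time
  \<open>t - 1 / 2\<close>, and smoothing from weight \<open>0\<close> to weight \<open>\<beta>\<close> in the last half unit restores the decay
  in \<open>n\<close>. Only the middle step determines \<open>\<nu>\<close>, so \<open>\<nu>\<close> is chosen before \<open>\<theta>\<close> and \<open>\<theta>'\<close>.\<close>

lemma Dplus_estimate:
  "\<exists>\<nu>>0. \<forall>\<theta> \<theta>'. \<theta> < \<beta> \<and> \<theta> \<le> \<theta>' \<and> \<theta>' \<le> \<beta> \<longrightarrow>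
    (\<exists>C>0. controls (\<lambda>t. C * time_factor \<nu> \<theta> \<theta>' t) \<theta> \<theta>')"
proof -
  obtain \<nu> Cd where \<nu>: "0 < \<nu>" and Cd: "0 < Cd" and decay: "controls (\<lambda>t. Cd * exp (- \<nu> * t)) 0 0"
    using Dplus_decay by auto
  have "\<exists>C>0. controls (\<lambda>t. C * time_factor \<nu> \<theta> \<theta>' t) \<theta> \<theta>'"
    if \<theta>: "\<theta> < \<beta>" "\<theta> \<le> \<theta>'" "\<theta>' \<le> \<beta>" for \<theta> \<theta>'
  proof -
    define T where "T = (\<lambda>t. 1 + t powr (- (\<theta>' - \<theta>) / \<beta>))"
    have T: "1 \<le> T t" for t by (simp add: T_def)
    obtain C1 K1 where C1: "0 < C1" "0 \<le> K1" and sm1: "controls (\<lambda>t. C1 * T t * exp (K1 * t)) \<theta> \<theta>'"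
      using Dplus_smoothing[OF \<theta>] unfolding T_def by auto
    obtain C2 K2 where C2: "0 < C2"
      and sm2: "controls (\<lambda>t. C2 * (1 + t powr (- (\<beta> - \<theta>) / \<beta>)) * exp (K2 * t)) \<theta> \<beta>"
      using Dplus_smoothing[of \<theta> \<beta>] \<theta> by auto
    obtain C3 K3 where C3: "0 < C3"
      and sm3: "controls (\<lambda>t. C3 * (1 + t powr (- (\<beta> - 0) / \<beta>)) * exp (K3 * t)) 0 \<beta>"
      using Dplus_smoothing[of 0 \<beta>] beta by auto
    define h :: real where "h = 1 / 2"
    have h: "0 < h" "0 \<le> h" by (simp_all add: h_def)
    define M2 where "M2 = C2 * (1 + h powr (- (\<beta> - \<theta>) / \<beta>)) * exp (K2 * h)"
    define M3 where "M3 = C3 * (1 + h powr (- (\<beta> - 0) / \<beta>)) * exp (K3 * h)"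
    have M: "0 < M2" "0 < M3" using C2 C3 by (auto simp: M2_def M3_def intro!: mult_pos_pos add_pos_nonneg)
    define CA where "CA = C1 * exp K1 * exp \<nu>"
    define CB where "CB = M3 * Cd * M2 * exp \<nu>"
    have CAB: "0 < CA" "0 < CB" using C1 M Cd by (auto simp: CA_def CB_def)
    have "controls (\<lambda>t. (CA + CB) * (T t * exp (- \<nu> * t))) \<theta> \<theta>'"
    proof (rule controlsI)
      fix y B t n
      assume y: "admissible y" and y0: "\<And>n. \<bar>Dplus (y 0) n\<bar> \<le> B * wt \<theta> n" and B: "0 \<le> B" and t: "0 < (t::real)"
      have main: "\<bar>Dplus (y t) n\<bar> \<le> (CA + CB) * (T t * exp (- \<nu> * t)) * B * wt \<theta>' n"
        if "\<bar>Dplus (y t) n\<bar> \<le> Q * (T t * exp (- \<nu> * t)) * B * wt \<theta>' n" "Q \<le> CA + CB" for Q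
      proof -
        have "Q * (T t * exp (- \<nu> * t)) * B * wt \<theta>' n \<le> (CA + CB) * (T t * exp (- \<nu> * t)) * B * wt \<theta>' n"
          using that(2) B order_trans[OF zero_le_one T] wt_pos[of \<theta>' n] by (intro mult_right_mono) auto
        then show ?thesis using that(1) by linarith
      qed
      show "\<bar>Dplus (y t) n\<bar> \<le> (CA + CB) * (T t * exp (- \<nu> * t)) * B * wt \<theta>' n"
      proof (cases "t \<le> 1")
        case True
        have "exp (K1 * t) \<le> exp (K1 + (\<nu> - \<nu> * t))"
        proof -
          have "K1 * t \<le> K1 * 1" "\<nu> * t \<le> \<nu> * 1" using C1(2) True \<nu> by (intro mult_left_mono; simp)+
          then show ?thesis unfolding exp_le_cancel_iff by linarith
        qed
        also have "\<dots> = exp K1 * (exp \<nu> * exp (- \<nu> * t))" by (simp add: exp_add[symmetric])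
        finally have ex: "exp (K1 * t) \<le> exp K1 * (exp \<nu> * exp (- \<nu> * t))" .
        have "\<bar>Dplus (y t) n\<bar> \<le> C1 * T t * exp (K1 * t) * B * wt \<theta>' n"
          by (rule controlsD[OF sm1 y y0 t])
        also have "\<dots> \<le> C1 * T t * (exp K1 * (exp \<nu> * exp (- \<nu> * t))) * B * wt \<theta>' n"
          using C1 B order_trans[OF zero_le_one T] ex wt_pos[of \<theta>' n] by (intro mult_right_mono mult_left_mono) auto
        also have "\<dots> = CA * (T t * exp (- \<nu> * t)) * B * wt \<theta>' n" by (simp add: CA_def mult_ac)
        finally show ?thesis using CAB by (intro main[of CA]) auto
      next
        case False
        then have t1: "0 < t - 1" "0 \<le> t - 1 + h" using h by simp_all
        have d1: "\<bar>Dplus (y h) n\<bar> \<le> (M2 * B) * wt 0 n" for n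
        proof -
          have "\<bar>Dplus (y h) n\<bar> \<le> (M2 * B) * wt \<beta> n"
            using controlsD[OF sm2 y y0 h(1)] by (simp add: M2_def)
          also have "\<dots> \<le> (M2 * B) * wt 0 n"
            using M B wt_antimono[of 0 \<beta> n] beta by (intro mult_left_mono) auto
          finally show ?thesis .
        qed
        have e: "h + (t - 1 + h) = t" by (simp add: h_def)
        have "\<bar>Dplus (y t) n\<bar> \<le> M3 * (Cd * exp (- \<nu> * (t - 1)) * (M2 * B)) * wt \<beta> n"
          using controls_shifted[OF sm3 y t1(2) h(1) controls_shifted[OF decay y h(2) t1(1) d1]]
          unfolding M3_def e by simp
        also have "exp (- \<nu> * (t - 1)) = exp \<nu> * exp (- \<nu> * t)" by (simp add: algebra_simps flip: exp_add)
        also have "M3 * (Cd * (exp \<nu> * exp (- \<nu> * t)) * (M2 * B)) * wt \<beta> n = CB * (1 * exp (- \<nu> * t)) * B * wt \<beta> n"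
          by (simp add: CB_def mult_ac)
        also have "\<dots> \<le> CB * (T t * exp (- \<nu> * t)) * B * wt \<theta>' n"
          using CAB B T[of t] wt_pos[of \<beta> n] wt_antimono[OF \<theta>(3), of n]
          by (intro mult_mono mult_left_mono mult_right_mono) auto
        finally show ?thesis using CAB by (intro main[of CB]) auto
      qed
    qed
    moreover have "0 < CA + CB" using CAB by simp
    ultimately show ?thesis unfolding T_def by blast
  qed
  note main = this
  show ?thesis by (rule exI[of _ \<nu>], rule conjI[OF \<nu>], intro allI impI, elim conjE, rule main)
qed

text \<open>A difference of size \<open>2\<^bsup>-\<beta>n\<^esup>\<close> compensates the growth of \<open>g\<close> exactly.\<close>

lemma L_bound:
  "\<exists>C>0. \<forall>y X. (\<forall>n. \<bar>Dplus y n\<bar> \<le> X * wt \<beta> n) \<longrightarrow> (\<forall>n. \<bar>L y n\<bar> \<le> C * X * wt 0 n)"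
proof (rule g_bounds_right, rule g_bounds_left[of 0], rule gs_bounded)
  fix c Cr Cl Cs assume Cr: "0 < Cr" "\<And>n. 0 \<le> n \<Longrightarrow> g n \<le> Cr * dyad \<beta> n"
    and Cl: "0 < Cl" "\<And>n. n \<le> 0 \<Longrightarrow> g n \<le> Cl" and Cs: "0 < Cs" "\<And>n. g n * s n \<le> Cs"
  have gw: "g n * wt \<beta> (n - 1) \<le> (Cr * 2 powr \<beta> + 2 * Cl) * wt 0 n" for n
  proof (cases "0 < n")
    case True
    have w: "wt \<beta> (n - 1) = 2 powr \<beta> * dyad (- \<beta>) n"
      using True by (cases "n = 1") (auto simp: wt_def algebra_simps simp flip: powr_add)
    have "g n * wt \<beta> (n - 1) \<le> Cr * dyad \<beta> n * (2 powr \<beta> * dyad (- \<beta>) n)"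
      unfolding w using Cr True by (intro mult_right_mono) auto
    also have "\<dots> = Cr * 2 powr \<beta> * (dyad \<beta> n * dyad (- \<beta>) n)"
      by (simp add: mult_ac)
    also have "dyad \<beta> n * dyad (- \<beta>) n = 1" by (simp flip: powr_add)
    finally show ?thesis using True Cl by (simp add: wt_def)
  next
    case False
    have w: "wt \<beta> (n - 1) = 2 * wt 0 n"
      using False powr_add[of 2 1 "- real_of_int n"] by (simp add: wt_def)
    have "g n * wt \<beta> (n - 1) \<le> Cl * (2 * wt 0 n)"
      unfolding w using Cl False wt_pos[of 0 n] by (intro mult_right_mono) auto
    also have "\<dots> \<le> (Cr * 2 powr \<beta> + 2 * Cl) * wt 0 n"
      using Cr(1) wt_pos[of 0 n] by (simp add: distrib_right)
    finally show ?thesis .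
  qed
  show ?thesis
  proof (intro exI[of _ "Cs + (Cr * 2 powr \<beta> + 2 * Cl)"] conjI allI impI)
    show "0 < Cs + (Cr * 2 powr \<beta> + 2 * Cl)" using Cs Cr Cl by (simp add: add_pos_pos)
    fix y X n assume "\<forall>n. \<bar>Dplus y n\<bar> \<le> X * wt \<beta> n"
    then have y: "\<bar>Dplus y n\<bar> \<le> X * wt \<beta> n" for n by blast
    have X: "0 \<le> X" by (rule wt_bound_nonneg[OF y])
    have "4 * L y n = g n * s n * Dplus y n - g n * Dplus y (n - 1)"
      by (simp add: L_Dplus algebra_simps)
    then have "4 * \<bar>L y n\<bar> \<le> \<bar>g n * s n * Dplus y n\<bar> + \<bar>g n * Dplus y (n - 1)\<bar>"
      by linarith
    also have "\<dots> \<le> Cs * (X * wt 0 n) + X * (g n * wt \<beta> (n - 1))"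
    proof (rule add_mono)
      have "\<bar>g n * s n * Dplus y n\<bar> = (g n * s n) * \<bar>Dplus y n\<bar>" using g_pos[of n] s_pos[of n] by (simp add: abs_mult)
      also have "\<dots> \<le> Cs * (X * wt 0 n)"
        using Cs y[of n] X wt_antimono[of 0 \<beta> n] beta mult_left_mono[of "wt \<beta> n" "wt 0 n" X]
        by (intro mult_mono) auto
      finally show "\<bar>g n * s n * Dplus y n\<bar> \<le> Cs * (X * wt 0 n)" .
      show "\<bar>g n * Dplus y (n - 1)\<bar> \<le> X * (g n * wt \<beta> (n - 1))"
        using mult_left_mono[OF y[of "n - 1"], of "g n"] g_pos[of n] by (simp add: abs_mult mult_ac)
    qed
    also have "\<dots> \<le> Cs * (X * wt 0 n) + X * ((Cr * 2 powr \<beta> + 2 * Cl) * wt 0 n)"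
      using gw[of n] X by (intro add_left_mono mult_left_mono)
    also have "\<dots> = (Cs + (Cr * 2 powr \<beta> + 2 * Cl)) * X * wt 0 n" by (simp add: algebra_simps)
    finally show "\<bar>L y n\<bar> \<le> (Cs + (Cr * 2 powr \<beta> + 2 * Cl)) * X * wt 0 n" by linarith
  qed
qed

text \<open>The time derivative of a solution is again a solution.\<close>

lemma admissible_L:
  assumes y: "admissible y" and bd: "\<And>t n. 0 \<le> t \<Longrightarrow> \<bar>L (y t) n\<bar> \<le> B * wt 0 n"
  shows "admissible (\<lambda>t. L (y t))"
  unfolding admissible_def
proof (intro conjI allI impI)
  fix t n assume t: "0 \<le> (t::real)"
  show "((\<lambda>r. L (y r) n) has_real_derivative L (L (y t)) n) (at t within {0..})"
  proof -
    have "((\<lambda>r. g n / 4 * (y r (n - 1) - y r n - s n * (y r n - y r (n + 1)))) has_real_derivative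
        g n / 4 * (L (y t) (n - 1) - L (y t) n - s n * (L (y t) n - L (y t) (n + 1)))) (at t within {0..})"
      by (intro DERIV_cmult DERIV_diff admissible_deriv[OF y t])
    moreover have "(\<lambda>r. L (y r) n) = (\<lambda>r. g n / 4 * (y r (n - 1) - y r n - s n * (y r n - y r (n + 1))))"
      by (rule ext) (rule L_eq)
    moreover have "L (L (y t)) n = g n / 4 * (L (y t) (n - 1) - L (y t) n - s n * (L (y t) n - L (y t) (n + 1)))"
      by (rule L_eq)
    ultimately show ?thesis by (simp only:)
  qed
next
  show "\<exists>\<rho>>-1. \<forall>T\<ge>0. \<exists>B. \<forall>t\<in>{0..T}. \<forall>n. \<bar>L (y t) n\<bar> \<le> B * wt \<rho> n"
    using bd by (intro exI[of _ 0] conjI allI impI exI[of _ B] ballI) auto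
qed

text \<open>From time \<open>t / 2\<close> on, \<open>L y\<close> is a bounded solution, so at time \<open>t\<close> its differences are summable and
  it has a limit. This limit is, up to sign, the flux
  \<open>g n / 4 * Dplus y (n - 1)\<close> at infinity, which in turn fixes the leading behaviour of
  \<open>y n - yinf\<close>.\<close>

lemma flux_at_infinity:
  assumes \<theta>: "-1 < \<theta>" "\<theta> < \<beta>" and y: "admissible y" and y0: "\<And>n. \<bar>y 0 n\<bar> \<le> B * wt \<theta> n" and t: "0 < t"
    and lim: "(y t \<longlongrightarrow> yinf) at_top"
  shows "\<exists>d. ((\<lambda>n. dyad \<beta> n * (y t n - yinf)) \<longlongrightarrow> d) at_top \<and>
      ((\<lambda>n. L (y t) n) \<longlongrightarrow> (2 powr \<beta> - 1) / 4 * d) at_top"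
proof -
  have B: "0 \<le> B" by (rule wt_bound_nonneg[OF y0])
  obtain \<nu> where \<nu>: "0 < \<nu>" and est: "\<forall>\<theta> \<theta>'. \<theta> < \<beta> \<and> \<theta> \<le> \<theta>' \<and> \<theta>' \<le> \<beta> \<longrightarrow>
    (\<exists>C>0. controls (\<lambda>t. C * time_factor \<nu> \<theta> \<theta>' t) \<theta> \<theta>')"
    using Dplus_estimate by (elim exE conjE)
  obtain C where C: "0 < C" "controls (\<lambda>t. C * time_factor \<nu> \<theta> \<beta> t) \<theta> \<beta>"
    using est[rule_format, of \<theta> \<beta>] \<theta> by auto
  obtain C' where C': "controls (\<lambda>t. C' * time_factor \<nu> 0 \<beta> t) 0 \<beta>"
    using est[rule_format, of 0 \<beta>] beta by auto
  define h where "h = t / 2"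
  have h: "0 < h" "h + h = t" using t by (auto simp: h_def)
  define X where "X = C * (1 + h powr (- (\<beta> - \<theta>) / \<beta>)) * (3 * B)"
  have X: "\<bar>Dplus (y r) n\<bar> \<le> X * wt \<beta> n" if r: "h \<le> r" for r n
  proof -
    have r0: "0 < r" using r h by simp
    have e: "- (\<beta> - \<theta>) / \<beta> \<le> 0" using \<theta> beta by (simp add: divide_le_0_iff)
    have "(1 + r powr (- (\<beta> - \<theta>) / \<beta>)) * exp (- \<nu> * r) \<le> (1 + h powr (- (\<beta> - \<theta>) / \<beta>)) * 1"
      using powr_mono2'[OF e h(1) r] \<nu> r0 by (intro mult_mono) auto
    then have "C * time_factor \<nu> \<theta> \<beta> r * (3 * B) * wt \<beta> n
        \<le> C * ((1 + h powr (- (\<beta> - \<theta>) / \<beta>)) * 1) * (3 * B) * wt \<beta> n"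
      using C(1) B wt_pos[of \<beta> n] by (intro mult_right_mono mult_left_mono) auto
    moreover have "\<bar>Dplus (y r) n\<bar> \<le> C * time_factor \<nu> \<theta> \<beta> r * (3 * B) * wt \<beta> n"
      by (rule controlsD[OF C(2) y Dplus_wt_bound[OF \<theta>(1) y0] r0])
    ultimately show ?thesis unfolding X_def mult_1_right by (rule order_trans[rotated])
  qed
  obtain CL where CL: "0 < CL"
    "\<forall>y X. (\<forall>n. \<bar>Dplus y n\<bar> \<le> X * wt \<beta> n) \<longrightarrow> (\<forall>n. \<bar>L y n\<bar> \<le> CL * X * wt 0 n)"
    using L_bound by (elim exE conjE)
  \<comment> \<open>starting at time \<open>h\<close> avoids the singularity of the bounds at time 0\<close>
  define z where "z = (\<lambda>r. L (y (r + h)))"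
  have z_bd: "\<bar>z r n\<bar> \<le> (CL * X) * wt 0 n" if "0 \<le> r" for r n
    unfolding z_def by (rule CL(2)[rule_format, OF X]) (use that in simp)
  have z_adm: "admissible z" unfolding z_def
    by (rule admissible_L[OF admissible_shift[OF y less_imp_le[OF h(1)]] z_bd[unfolded z_def]])
  have "\<bar>Dplus (z h) n\<bar> \<le> C' * time_factor \<nu> 0 \<beta> h * (3 * (CL * X)) * wt \<beta> n" for n
    by (rule controlsD[OF C' z_adm Dplus_wt_bound[OF _ z_bd[OF order_refl]] h(1)]) simp
  then obtain zinf where zl: "(z h \<longlongrightarrow> zinf) at_top"
    using limit_of_Dplus_bound[OF beta] unfolding tail_bound_def by blast
  have Ll: "(L (y t) \<longlongrightarrow> zinf) at_top" using zl h by (simp add: z_def)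
  have Dlim: "(Dplus (y t) \<longlongrightarrow> 0) at_top"
    unfolding Dplus_def using tendsto_diff[OF tendsto_int_shift(1)[OF lim, of 1] lim] by simp
  \<comment> \<open>the downward part of \<open>L y\<close>, which tends to \<open>- zinf\<close> because the upward part vanishes\<close>
  define F where "F = (\<lambda>n. g n * s n / 4 * Dplus (y t) n - L (y t) n)"
  have F: "g n / 4 * Dplus (y t) (n - 1) = F n" for n by (simp add: F_def L_Dplus algebra_simps)
  have Fl: "(F \<longlongrightarrow> 0 / 4 * 0 - zinf) at_top"
    unfolding F_def by (intro tendsto_diff tendsto_mult tendsto_divide tendsto_const gs_top Dlim Ll) simp
  define r where "r = (\<lambda>n. g n / dyad \<beta> n)"
  have r: "(r \<longlongrightarrow> 1) at_top" unfolding r_def by (rule g_top)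
  have "((\<lambda>n. 4 * 2 powr (- \<beta>) * F (n + 1) / r (n + 1)) \<longlongrightarrow> 4 * 2 powr (- \<beta>) * (0 / 4 * 0 - zinf) / 1) at_top"
    by (intro tendsto_mult tendsto_divide tendsto_const tendsto_int_shift(1)[OF Fl] tendsto_int_shift(1)[OF r]) simp
  moreover have "4 * 2 powr (- \<beta>) * F (n + 1) / r (n + 1) = dyad \<beta> n * Dplus (y t) n" for n
  proof -
    have e: "dyad \<beta> (n + 1) = 2 powr \<beta> * dyad \<beta> n"
      by (simp add: algebra_simps flip: powr_add)
    have f: "F (n + 1) = g (n + 1) / 4 * Dplus (y t) n" using F[of "n + 1"] by simp
    show ?thesis unfolding r_def e f using g_pos[of "n + 1"] by (simp add: powr_minus field_simps)
  qed
  ultimately have "((\<lambda>n. dyad \<beta> n * Dplus (y t) n) \<longlongrightarrow> - (4 * 2 powr (- \<beta>) * zinf)) at_top"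
    by simp
  from scaled_tail_limit[OF beta this lim]
  have d: "((\<lambda>n. dyad \<beta> n * (y t n - yinf)) \<longlongrightarrow> 4 * 2 powr (- \<beta>) * zinf / (1 - 2 powr (- \<beta>))) at_top"
    by simp
  have b1: "1 < 2 powr \<beta>" using beta powr_less_mono[of 0 \<beta> 2] by simp
  have "(2 powr \<beta> - 1) / 4 * (4 * 2 powr (- \<beta>) * zinf / (1 - 2 powr (- \<beta>))) = zinf"
  proof -
    define p where "p = 2 powr \<beta>"
    have "1 < p" using b1 by (simp add: p_def)
    then have "(p - 1) / 4 * (4 * inverse p * zinf / (1 - inverse p)) = zinf" by (simp add: field_simps)
    then show ?thesis by (simp add: powr_minus p_def)
  qed
  then show ?thesis using d Ll by (intro exI[of _ "4 * 2 powr (- \<beta>) * zinf / (1 - 2 powr (- \<beta>))"]) simp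
qed

end

section \<open>The total mass determines the stationary parameter\<close>

lemma two_powi: "(2::real) powi n = two_to n"
  by (rule powr_real_of_int'[symmetric]) auto

lemma summable_on_int_two_sided: "(\<lambda>n::int. 2 powr (- \<bar>real_of_int n\<bar>)) summable_on UNIV"
proof -
  have geo: "(\<lambda>i::nat. (1/2::real) ^ i) summable_on UNIV"
    by (rule norm_summable_imp_summable_on) (simp add: summable_geometric)
  have e: "2 powr (- real i) = (1/2::real) ^ i" for i
    using powr_realpow[of 2 i] by (simp only: powr_minus power_one_over inverse_eq_divide)
  have "bij_betw int UNIV {0..}"
    by (rule bij_betw_byWitness[of _ nat]) auto
  from summable_on_reindex_bij_betw[OF this, of "\<lambda>n. 2 powr (- \<bar>real_of_int n\<bar>)"] geo
  have 1: "(\<lambda>n::int. 2 powr (- \<bar>real_of_int n\<bar>)) summable_on {0..}" by (simp add: e)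
  have "bij_betw (\<lambda>i. - int i) UNIV {..0}"
    by (rule bij_betw_byWitness[of _ "\<lambda>n. nat (- n)"]) auto
  from summable_on_reindex_bij_betw[OF this, of "\<lambda>n. 2 powr (- \<bar>real_of_int n\<bar>)"] geo
  have "(\<lambda>n::int. 2 powr (- \<bar>real_of_int n\<bar>)) summable_on {..0}" by (simp add: e)
  then have 2: "(\<lambda>n::int. 2 powr (- \<bar>real_of_int n\<bar>)) summable_on {..<0}"
    by (rule summable_on_subset_banach) auto
  have "(\<lambda>n::int. 2 powr (- \<bar>real_of_int n\<bar>)) summable_on ({..<0} \<union> {0..})"
    by (rule summable_on_Un_disjoint[OF 2 1]) auto
  moreover have "{..<0} \<union> {0..} = (UNIV :: int set)" by auto
  ultimately show ?thesis by simp
qed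

text \<open>The terms are dominated by \<open>K A * 2\<^bsup>-\<bar>n\<bar>\<^esup>\<close> with \<open>K A \<rightarrow> 0\<close> as \<open>A \<rightarrow> \<infinity>\<close>, since \<open>exp (- y)\<close> is at most
  \<open>256 / y\<^sup>4\<close> and at most \<open>1 / y\<close>. So the sum converges, depends continuously on \<open>A\<close>, and becomes
  small. It becomes large as \<open>A \<rightarrow> 0\<close>: for \<open>A = ln 2 / 2\<^sup>n\<close> the term with index \<open>n\<close> alone is
  \<open>c n / 2\<close>, which is unbounded. Strict monotonicity in \<open>A\<close> gives uniqueness.\<close>

lemma mass_equation_unique_solution:
  fixes c :: "int \<Rightarrow> real"
  assumes C: "0 < C" and c1: "0 < c1"
    and c_pos: "\<And>n. 0 < c n"
    and right: "\<And>n. 0 \<le> n \<Longrightarrow> c n \<le> C * dyad 3 n"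
    and left: "\<And>n. n \<le> 0 \<Longrightarrow> c n \<le> C * dyad 2 n"
    and lower: "\<And>n. 0 \<le> n \<Longrightarrow> c1 * two_to n \<le> c n"
    and M: "0 < M"
  shows "\<exists>!A. 0 < A \<and> ((\<lambda>n. exp (- A * two_to n) * c n) has_sum M) UNIV"
proof -
  define f where "f = (\<lambda>A n. exp (- A * two_to n) * c n)"
  define d where "d = (\<lambda>n::int. 2 powr (- \<bar>real_of_int n\<bar>))"
  define K where "K = (\<lambda>A. C * (256 / A ^ 4 + 1 / A))"
  have f_pos: "0 < f A n" for A n using c_pos by (simp add: f_def)
  have f_le: "f A n \<le> K A * d n" if A: "0 < A" for A n
  proof -
    define x where "x = two_to n"
    have x: "0 < x" by (simp add: x_def)
    show ?thesis
    proof (cases "0 \<le> n")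
      case True
      define y where "y = A * x / 4"
      have y: "0 < y" using A x by (simp add: y_def)
      have "y \<le> exp y" using exp_ge_add_one_self[of y] by linarith
      then have "y ^ 4 \<le> exp y ^ 4" using y by (intro power_mono) auto
      also have "\<dots> = exp (A * x)" by (simp add: y_def flip: exp_of_nat_mult)
      finally have "inverse (exp (A * x)) \<le> inverse (y ^ 4)" using y by (intro le_imp_inverse_le) auto
      also have "\<dots> = 256 / (A * x) ^ 4" by (simp add: y_def power_divide)
      finally have "exp (- A * x) \<le> 256 / (A * x) ^ 4" by (simp add: exp_minus)
      then have "f A n \<le> 256 / (A * x) ^ 4 * (C * dyad 3 n)"
        unfolding f_def x_def[symmetric] using right[OF True] c_pos[of n] by (intro mult_mono) auto
      also have "dyad 3 n = x ^ 3" by (simp add: x_def powr_power mult.commute)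
      also have "256 / (A * x) ^ 4 * (C * x ^ 3) = C * (256 / A ^ 4) * (1 / x)"
        using A x by (simp add: power_mult_distrib power_eq_if mult_ac)
      also have "1 / x = d n" using True by (simp add: x_def d_def powr_minus inverse_eq_divide)
      also have "C * (256 / A ^ 4) * d n \<le> K A * d n"
        unfolding K_def using C A by (intro mult_right_mono mult_left_mono) (auto simp: d_def)
      finally show ?thesis .
    next
      case False
      have "A * x \<le> exp (A * x)" using exp_ge_add_one_self[of "A * x"] by linarith
      then have "inverse (exp (A * x)) \<le> inverse (A * x)" using A x by (intro le_imp_inverse_le) auto
      then have "exp (- A * x) \<le> 1 / (A * x)" by (simp add: exp_minus inverse_eq_divide)
      then have "f A n \<le> 1 / (A * x) * (C * dyad 2 n)"
        unfolding f_def x_def[symmetric] using left[of n] False c_pos[of n] A x by (intro mult_mono) auto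
      also have "dyad 2 n = x ^ 2" by (simp add: x_def powr_power mult.commute)
      also have "1 / (A * x) * (C * x ^ 2) = C * (1 / A) * x" using A x by (simp add: power2_eq_square)
      also have "x = d n" using False by (simp add: x_def d_def)
      also have "C * (1 / A) * d n \<le> K A * d n"
        unfolding K_def using C A by (intro mult_right_mono mult_left_mono) (auto simp: d_def)
      finally show ?thesis .
    qed
  qed
  have d_sum: "d summable_on UNIV" unfolding d_def by (rule summable_on_int_two_sided)
  have Kd_sum: "(\<lambda>n. K A * d n) summable_on UNIV" for A by (rule summable_on_cmult_right[OF d_sum])
  have f_sum: "f A summable_on UNIV" if "0 < A" for A
    by (rule summable_on_comparison_test[OF Kd_sum[of A]]) (use f_le[OF that] less_imp_le[OF f_pos] in auto)
  define F where "F = (\<lambda>A. infsum (f A) UNIV)"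
  have F: "(f A has_sum F A) UNIV" if "0 < A" for A unfolding F_def by (rule has_sum_infsum[OF f_sum[OF that]])
  have f_mono: "f A' n < f A n" if "A < A'" for A A' n
    using that c_pos[of n] by (simp add: f_def)
  have F_mono: "F A' < F A" if "0 < A" "A < A'" for A A'
    by (rule has_sum_strict_mono[OF F F, where x = 0]) (use that f_mono less_imp_le[OF f_mono] in auto)
  have cont: "continuous_on {a..b} F" if a: "0 < a" for a b
  proof -
    have "uniform_limit {a..b} (\<lambda>X A. \<Sum>n\<in>X. f A n) (\<lambda>A. \<Sum>\<^sub>\<infinity>n. f A n) (finite_subsets_at_top UNIV)"
    proof (rule Weierstrass_m_test_general)
      show "f a summable_on UNIV" by (rule f_sum[OF a])
      show "norm (f A n) \<le> f a n" if "A \<in> {a..b}" for A n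
        using f_mono[of a A n] f_pos[of A n] that by (cases "A = a") auto
    qed
    then show ?thesis unfolding F_def
      by (rule uniform_limit_theorem[rotated]) (auto simp: f_def intro!: always_eventually continuous_intros)
  qed
  obtain i :: nat where i: "2 * M / c1 < 2 ^ i"
    using real_arch_pow[of 2 "2 * M / c1"] by auto
  \<comment> \<open>with this parameter the exponential factor of term \<open>i\<close> equals \<open>1 / 2\<close>\<close>
  define a :: real where "a = ln 2 / 2 ^ i"
  have a: "0 < a" by (simp add: a_def)
  have Fa: "M \<le> F a"
  proof -
    have e: "exp (- a * two_to (int i)) = 1 / 2"
      by (simp add: a_def powr_realpow exp_minus)
    have "f a (int i) = 1 / 2 * c (int i)" unfolding f_def by (simp only: e)
    moreover have "2 * M \<le> c (int i)"
    proof -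
      have "2 * M \<le> c1 * 2 ^ i" using i c1 by (simp add: field_simps)
      also have "\<dots> \<le> c (int i)" using lower[of "int i"] by (simp add: powr_realpow)
      finally show ?thesis .
    qed
    ultimately have "M \<le> sum (f a) {int i}" by simp
    also have "\<dots> \<le> F a" by (rule finite_sum_le_has_sum[OF F[OF a]]) (use less_imp_le[OF f_pos] in auto)
    finally show ?thesis .
  qed
  define S where "S = infsum d UNIV"
  have S: "0 \<le> S" unfolding S_def by (rule infsum_nonneg) (simp add: d_def)
  \<comment> \<open>large enough for \<open>K b * S \<le> M\<close>, since \<open>K b \<le> C * 257 / b\<close> for \<open>b \<ge> 1\<close>\<close>
  define b where "b = a + 1 + 257 * C * S / M"
  have b: "a \<le> b" "1 \<le> b" "257 * C * S / M \<le> b" using a C S M by (auto simp: b_def)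
  have Fb: "F b \<le> M"
  proof -
    have b0: "0 < b" using b by simp
    have "F b \<le> K b * S"
    proof (rule has_sum_mono[OF F[OF b0]])
      show "((\<lambda>n. K b * d n) has_sum K b * S) UNIV"
        unfolding S_def by (rule has_sum_cmult_right[OF has_sum_infsum[OF d_sum]])
    qed (use f_le[OF b0] in auto)
    also have "K b \<le> C * (257 / b)"
    proof -
      have "b ^ 1 \<le> b ^ 4" using b by (intro power_increasing) auto
      then have "256 / b ^ 4 \<le> 256 / b" using b0 by (intro divide_left_mono) auto
      then have "256 / b ^ 4 + 1 / b \<le> 257 / b" by (simp add: add_divide_distrib[symmetric])
      then show ?thesis unfolding K_def using C by (intro mult_left_mono) auto
    qed
    then have "K b * S \<le> C * (257 / b) * S" using S by (rule mult_right_mono)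
    also have "\<dots> \<le> M" using b(3) b0 M by (simp add: field_simps)
    finally show ?thesis .
  qed
  obtain A where A: "a \<le> A" "F A = M"
    using IVT2'[of F b M a, OF Fb Fa b(1) cont[OF a]] by auto
  show ?thesis
  proof (rule ex1I[of _ A])
    show "0 < A \<and> ((\<lambda>n. exp (- A * two_to n) * c n) has_sum M) UNIV"
      using F[of A] A a by (simp add: f_def)
    fix A' assume A': "0 < A' \<and> ((\<lambda>n. exp (- A' * two_to n) * c n) has_sum M) UNIV"
    then have "(f A' has_sum M) UNIV" "0 < A'" by (auto simp: f_def)
    then have "F A' = M" using F[of A'] has_sum_unique by blast
    then show "A' = A" using F_mono[of A A'] F_mono[of A' A] A a \<open>0 < A'\<close> by (smt (verit))
  qed
qed

text \<open>For \<open>l n = ln \<vartheta>\<^sub>n\<close> this is, up to sign, the second exponent in \<open>\<alpha>\<^sub>n\<close>. It is an average of the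
  values of \<open>l\<close> from \<open>n\<close> on, with geometric weights of total mass one.\<close>

definition discounted :: "(int \<Rightarrow> real) \<Rightarrow> int \<Rightarrow> real" where
  "discounted l n = (\<Sum>i. (1/2) ^ Suc i * l (n + int i))"

lemma discounted_eq_infsum:
  assumes B: "\<And>n. \<bar>l n\<bar> \<le> B"
  shows "2 powi n * (\<Sum>\<^sub>\<infinity>j\<in>{n+1..}. 2 powi (- j) * l (j - 1)) = discounted l n"
proof -
  define h where "h = (\<lambda>i. 2 powi (- (n + 1 + int i)) * l (n + int i))"
  have bij: "bij_betw (\<lambda>i. n + 1 + int i) UNIV {n+1..}"
    by (rule bij_betw_byWitness[of _ "\<lambda>j. nat (j - (n + 1))"]) auto
  have h_eq: "2 powi n * h i = (1/2) ^ Suc i * l (n + int i)" for i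
  proof -
    have e: "real_of_int n + real_of_int (- (n + 1 + int i)) = - real (Suc i)" by simp
    have "(2::real) powi n * 2 powi (- (n + 1 + int i)) = 2 powr (- real (Suc i))"
      unfolding two_powi powr_add[symmetric] e ..
    also have "\<dots> = (1/2) ^ Suc i"
      using powr_realpow[of 2 "Suc i"] by (simp only: powr_minus power_one_over inverse_eq_divide)
    finally have "(2::real) powi n * 2 powi (- (n + 1 + int i)) = (1/2) ^ Suc i" .
    then show ?thesis unfolding h_def mult.assoc[symmetric] by simp
  qed
  have half: "summable (\<lambda>i. B * (1/2::real) ^ Suc i)"
    by (intro summable_mult sums_summable[OF power_half_series])
  have sm: "summable (\<lambda>i. norm ((1/2) ^ Suc i * l (n + int i)))"
  proof (rule summable_comparison_test'[OF half])
    show "norm (norm ((1/2) ^ Suc i * l (n + int i))) \<le> B * (1/2) ^ Suc i" for i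
      using mult_right_mono[OF B[of "n + int i"], of "(1/2) ^ Suc i"] by (simp add: abs_mult mult.commute)
  qed
  have "2 powi n * (\<Sum>\<^sub>\<infinity>j\<in>{n+1..}. 2 powi (- j) * l (j - 1)) = 2 powi n * (\<Sum>\<^sub>\<infinity>i. h i)"
    using infsum_reindex_bij_betw[OF bij, of "\<lambda>j. 2 powi (- j) * l (j - 1)"] by (simp add: h_def)
  also have "\<dots> = (\<Sum>\<^sub>\<infinity>i. (1/2) ^ Suc i * l (n + int i))"
    by (subst infsum_cmult_right'[symmetric]) (simp only: h_eq)
  also have "\<dots> = discounted l n"
    unfolding discounted_def
    by (intro infsumI norm_summable_imp_has_sum[OF sm] summable_sums summable_norm_cancel[OF sm])
  finally show ?thesis .
qed

lemma discounted_bound: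
  assumes B: "\<And>n. \<bar>l n\<bar> \<le> B"
  shows "\<bar>discounted l n\<bar> \<le> B"
proof -
  have half: "(\<lambda>i. (1/2::real) ^ Suc i * B) sums (1 * B)"
    by (intro sums_mult2 power_half_series)
  have le: "norm ((1/2) ^ Suc i * l (n + int i)) \<le> (1/2) ^ Suc i * B" for i
    using mult_left_mono[OF B[of "n + int i"], of "(1/2) ^ Suc i"] by (simp add: abs_mult)
  have sm: "summable (\<lambda>i. norm ((1/2) ^ Suc i * l (n + int i)))"
    by (rule summable_comparison_test'[OF sums_summable[OF half]]) (use le in auto)
  have "\<bar>discounted l n\<bar> \<le> (\<Sum>i. norm ((1/2) ^ Suc i * l (n + int i)))"
    unfolding discounted_def using summable_norm[OF sm] by simp
  also have "\<dots> \<le> (\<Sum>i. (1/2::real) ^ Suc i * B)" by (intro suminf_le le sm sums_summable[OF half])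
  also have "\<dots> = B" using sums_unique[OF half] by simp
  finally show ?thesis .
qed

lemma discounted_tendsto:
  assumes B: "\<And>n. \<bar>l n\<bar> \<le> B" and lim: "(l \<longlongrightarrow> 0) at_bot"
  shows "(discounted l \<longlongrightarrow> 0) at_bot"
proof -
  have half: "summable (\<lambda>i. (1/2::real) ^ Suc i * B)"
    by (intro summable_mult2 sums_summable[OF power_half_series])
  have le: "norm ((1/2) ^ Suc i * l (n + int i)) \<le> (1/2) ^ Suc i * B" for i n
    using mult_left_mono[OF B[of "n + int i"], of "(1/2) ^ Suc i"] by (simp add: abs_mult)
  have "((\<lambda>n. \<Sum>i. (1/2) ^ Suc i * l (n + int i)) \<longlongrightarrow> (\<Sum>i::nat. (1/2) ^ Suc i * 0)) at_bot"
  proof (rule tannerys_theorem[THEN conjunct2, THEN conjunct2])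
    show "((\<lambda>n. (1/2) ^ Suc i * l (n + int i)) \<longlongrightarrow> (1/2) ^ Suc i * 0) at_bot" for i
      by (intro tendsto_mult tendsto_const tendsto_int_shift(2)[OF lim])
    show "eventually (\<lambda>(i,n). norm ((1/2) ^ Suc i * l (n + int i)) \<le> (1/2) ^ Suc i * B) (at_top \<times>\<^sub>F at_bot)"
      by (intro always_eventually) (use le in auto)
  qed (use half in auto)
  then show ?thesis unfolding discounted_def by simp
qed

section \<open>Coefficients obtained from the kernels\<close>

lemma filterlim_two_powr_at_top: "filterlim (\<lambda>n::int. two_to n :: real) at_top at_top"
proof -
  have "filterlim (\<lambda>n::int. ln 2 * real_of_int n) at_top at_top"
    by (rule filterlim_tendsto_pos_mult_at_top[OF tendsto_const _ filterlim_real_of_int_at_top]) simp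
  from filterlim_compose[OF exp_at_top this] show ?thesis by (simp add: powr_def mult.commute)
qed

lemma filterlim_two_powr_at_bot: "filterlim (\<lambda>n::int. two_to n :: real) (at_right 0) at_bot"
  using powr_int_tendsto_0_at_bot[of 1] by (simp add: filterlim_at)

lemma tendsto_along_powers:
  assumes "f \<sim>[at_top] (\<lambda>x::real. x powr a)"
  shows "((\<lambda>n. f (2 powi n) / dyad a n) \<longlongrightarrow> (1::real)) at_top"
proof -
  have "eventually (\<lambda>x::real. f x \<noteq> 0 \<or> x powr a \<noteq> 0) at_top"
    using eventually_gt_at_top[of 0] by eventually_elim simp
  from filterlim_compose[OF asymp_equivD_strong[OF assms this] filterlim_two_powr_at_top]
  show ?thesis by (simp add: two_powi powr_powr mult.commute)
qed

lemma tendsto_of_bigo_powr: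
  fixes f :: "real \<Rightarrow> real"
  assumes f: "(\<lambda>x. f x - c) \<in> O[at_right 0](\<lambda>x. x powr a)" and a: "0 < a"
  shows "(f \<longlongrightarrow> c) (at_right 0)"
proof -
  have "((\<lambda>x. x powr a) \<longlongrightarrow> 0 powr a) (at_right (0::real))"
    using a by (intro tendsto_powr' tendsto_ident_at tendsto_const) (auto simp: eventually_at_filter)
  then have p: "((\<lambda>x. x powr a) \<longlongrightarrow> 0) (at_right (0::real))" by simp
  from landau_o.bigE[OF f] obtain C where "0 < C" and C: "eventually (\<lambda>x. norm (f x - c) \<le> C * norm (x powr a)) (at_right 0)"
    by blast
  have "((\<lambda>x. f x - c) \<longlongrightarrow> 0) (at_right 0)"
  proof (rule Lim_null_comparison)
    show "eventually (\<lambda>x. norm (f x - c) \<le> C * x powr a) (at_right 0)" using C by simp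
    show "((\<lambda>x. C * x powr a) \<longlongrightarrow> 0) (at_right 0)" using tendsto_mult[OF tendsto_const p, of C] by simp
  qed
  then show ?thesis by (simp add: LIM_zero_iff)
qed

lemma exp_beats_power:
  assumes A: "0 < A" and b: "b \<le> 2"
  shows "((\<lambda>n::int. dyad b n * exp (- A * two_to n)) \<longlongrightarrow> (0::real)) at_top"
proof (rule tendsto_sandwich[of "\<lambda>_. 0"])
  have "filterlim (\<lambda>n::int. A * two_to n) at_top at_top"
    by (rule filterlim_tendsto_pos_mult_at_top[OF tendsto_const A filterlim_two_powr_at_top])
  from tendsto_mult[OF tendsto_const filterlim_compose[OF tendsto_power_div_exp_0[of 2] this], of "1 / A\<^sup>2"]
  show "((\<lambda>n::int. 1 / A\<^sup>2 * ((A * two_to n)\<^sup>2 / exp (A * two_to n))) \<longlongrightarrow> 0) at_top"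
    by simp
  show "eventually (\<lambda>n::int. dyad b n * exp (- A * two_to n)
      \<le> 1 / A\<^sup>2 * ((A * two_to n)\<^sup>2 / exp (A * two_to n))) at_top"
    using eventually_ge_at_top[of 0]
  proof eventually_elim
    case (elim n)
    have "dyad b n \<le> dyad 2 n"
      using b elim by (intro powr_mono mult_right_mono) auto
    also have "\<dots> = (two_to n)\<^sup>2" by (simp add: powr_power mult.commute)
    finally have "dyad b n * exp (- A * two_to n) \<le> (two_to n)\<^sup>2 * exp (- A * two_to n)"
      by (intro mult_right_mono) auto
    also have "\<dots> = 1 / A\<^sup>2 * ((A * two_to n)\<^sup>2 / exp (A * two_to n))"
      using A by (simp add: power_mult_distrib exp_minus inverse_eq_divide)
    finally show ?case .
  qed
qed auto

locale kernels =
  fixes \<alpha> \<beta> \<alpha>' \<beta>' k0 \<gamma>0 :: real and k \<gamma> :: "real \<Rightarrow> real"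
  assumes alpha: "0 < \<alpha>" "\<alpha> < 1" and beta: "1 < \<beta>" "\<beta> < 2" and ex: "1 < \<alpha>'" "1 < \<beta>'"
    and k0: "0 < k0" and \<gamma>0: "0 < \<gamma>0"
    and k_pos: "\<And>\<xi>. 0 \<le> \<xi> \<Longrightarrow> 0 < k \<xi>"
    and k_inf: "k \<sim>[at_top] (\<lambda>\<xi>. \<xi> powr (\<alpha> + 1))"
    and k_zero: "(\<lambda>\<xi>. k \<xi> - k0) \<in> O[at_right 0](\<lambda>\<xi>. \<xi> powr \<alpha>')"
    and \<gamma>_pos: "\<And>\<xi>. 0 < \<xi> \<Longrightarrow> 0 < \<gamma> \<xi>"
    and \<gamma>_inf: "\<gamma> \<sim>[at_top] (\<lambda>\<xi>. \<xi> powr \<beta>)"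
    and \<gamma>_zero: "(\<lambda>\<xi>. \<gamma> \<xi> - \<gamma>0) \<in> O[at_right 0](\<lambda>\<xi>. \<xi> powr \<beta>')"
begin

definition K :: "int \<Rightarrow> real" where "K n = k (2 powi n)"
definition g :: "int \<Rightarrow> real" where "g n = \<gamma> (2 powi n)"
definition log_vartheta :: "int \<Rightarrow> real" where "log_vartheta n = ln (vartheta k \<gamma> n)"

lemma K_pos: "0 < K n" and g_pos: "0 < g n"
  using k_pos \<gamma>_pos by (auto simp: K_def g_def)

lemma K_top: "((\<lambda>n. K n / dyad (\<alpha> + 1) n) \<longlongrightarrow> 1) at_top"
  and g_top: "((\<lambda>n. g n / dyad \<beta> n) \<longlongrightarrow> 1) at_top"
  unfolding K_def g_def by (rule tendsto_along_powers[OF k_inf] tendsto_along_powers[OF \<gamma>_inf])+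

lemma K_bot: "(K \<longlongrightarrow> k0) at_bot"
  using filterlim_compose[OF tendsto_of_bigo_powr[OF k_zero] filterlim_two_powr_at_bot] ex
  by (simp add: K_def[abs_def] two_powi)

lemma g_bot: "(g \<longlongrightarrow> \<gamma>0) at_bot"
  using filterlim_compose[OF tendsto_of_bigo_powr[OF \<gamma>_zero] filterlim_two_powr_at_bot] ex
  by (simp add: g_def[abs_def] two_powi)

lemma zeta_eq: "zeta k \<gamma> n = ln 2 / two_to n * (K n / g (n + 1))"
  by (simp add: zeta_def K_def g_def two_powi)

lemma vartheta_eq: "vartheta k \<gamma> n = K (n + 1) / K n * (g (n + 1) / g (n + 2))"
proof -
  have alg: "2 * (q / (2 * p) * (b / d)) / (q / p * (a / c)) = b / a * (c / d)"
    if "p \<noteq> 0" "q \<noteq> 0" "a \<noteq> 0" "b \<noteq> 0" "c \<noteq> 0" "d \<noteq> 0" for p q a b c d :: real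
    using that by (simp add: field_simps)
  have "two_to (n + 1) = 2 * two_to n" by (simp add: powr_add)
  then have z: "zeta k \<gamma> (n + 1) = ln 2 / (2 * two_to n) * (K (n + 1) / g (n + 2))"
    unfolding zeta_eq by (simp add: add.assoc)
  show ?thesis unfolding vartheta_def z zeta_eq[of n]
    by (rule alg) (use K_pos[of n] K_pos[of "n+1"] g_pos[of "n+1"] g_pos[of "n+2"] in auto)
qed

lemma log_vartheta_top: "(log_vartheta \<longlongrightarrow> ln (2 powr (\<alpha> + 1) * inverse (2 powr \<beta>))) at_top"
proof -
  have "((\<lambda>n. inverse (g (n + 1 + 1) / g (n + 1))) \<longlongrightarrow> inverse (2 powr \<beta>)) at_top"
    by (intro tendsto_inverse tendsto_int_shift(1)[OF tendsto_ratio_of_power_like[OF g_top]]) simp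
  then have "((\<lambda>n. g (n + 1) / g (n + 2)) \<longlongrightarrow> inverse (2 powr \<beta>)) at_top"
    by (simp add: add.assoc)
  from tendsto_mult[OF tendsto_ratio_of_power_like[OF K_top] this]
  show ?thesis unfolding log_vartheta_def[abs_def] vartheta_eq by (intro tendsto_ln) auto
qed

lemma log_vartheta_bot: "(log_vartheta \<longlongrightarrow> 0) at_bot"
proof -
  have "((\<lambda>n. K (n + 1) / K n * (g (n + 1) / g (n + 2))) \<longlongrightarrow> k0 / k0 * (\<gamma>0 / \<gamma>0)) at_bot"
    using k0 \<gamma>0 by (intro tendsto_mult tendsto_divide tendsto_int_shift(2)[OF K_bot] tendsto_int_shift(2)[OF g_bot] K_bot) auto
  then have "((\<lambda>n. ln (K (n + 1) / K n * (g (n + 1) / g (n + 2)))) \<longlongrightarrow> ln (k0 / k0 * (\<gamma>0 / \<gamma>0))) at_bot"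
    by (rule tendsto_ln) (use k0 \<gamma>0 in simp)
  then show ?thesis using k0 \<gamma>0 by (simp add: log_vartheta_def[abs_def] vartheta_eq)
qed

lemma log_vartheta_bounded: obtains B where "\<And>n. \<bar>log_vartheta n\<bar> \<le> B"
proof (rule bounded_of_limits[OF log_vartheta_top log_vartheta_bot])
  fix B assume "\<And>n. \<bar>log_vartheta n\<bar> \<le> B"
  then show thesis by (rule that)
qed

lemma alpha_coeff_eq: "alpha_coeff k \<gamma> A n = exp (- A * two_to n) * exp (- discounted log_vartheta n)"
proof (rule log_vartheta_bounded)
  fix B assume "\<And>n. \<bar>log_vartheta n\<bar> \<le> B"
  from discounted_eq_infsum[OF this, of n] show ?thesis
    unfolding alpha_coeff_def log_vartheta_def[symmetric] mult_minus_left by (simp add: two_powi)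
qed

lemma alpha_coeff_bot: "(alpha_coeff k \<gamma> A \<longlongrightarrow> 1) at_bot"
proof (rule log_vartheta_bounded)
  fix B assume B: "\<And>n. \<bar>log_vartheta n\<bar> \<le> B"
  have "((\<lambda>n. exp (- A * dyad 1 n) * exp (- discounted log_vartheta n)) \<longlongrightarrow> exp (- A * 0) * exp (- 0)) at_bot"
    by (intro tendsto_mult tendsto_exp tendsto_minus tendsto_const powr_int_tendsto_0_at_bot
        discounted_tendsto[OF B log_vartheta_bot]) simp
  moreover have "alpha_coeff k \<gamma> A = (\<lambda>n. exp (- A * two_to n) * exp (- discounted log_vartheta n))"
    by (rule ext) (rule alpha_coeff_eq)
  ultimately show ?thesis by simp
qed

text \<open>\<open>A_of_mass\<close> is a definite description, so its positivity rests on unique solvability of the mass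
  equation. The coefficients of that equation grow like \<open>2\<^bsup>(1 + \<beta> - \<alpha>)n\<^esup>\<close> at \<open>+\<infinity>\<close>, with an exponent
  between \<open>1\<close> and \<open>3\<close>, and decay like \<open>2\<^bsup>2n\<^esup>\<close> at \<open>-\<infinity>\<close>.\<close>

lemma A_of_mass_pos:
  assumes M: "0 < M"
  shows "0 < A_of_mass k \<gamma> M"
proof (rule log_vartheta_bounded)
  fix B assume B: "\<And>n. \<bar>log_vartheta n\<bar> \<le> B"
  have dB: "- B \<le> - discounted log_vartheta n" "- discounted log_vartheta n \<le> B" for n
    using discounted_bound[of log_vartheta B n] B by (auto simp: abs_le_iff)
  define \<rho> where "\<rho> = (\<lambda>n. g (n + 1) / K n)"
  have \<rho>_pos: "0 < \<rho> n" for n using g_pos K_pos by (simp add: \<rho>_def)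
  have \<rho>_bot: "(\<rho> \<longlongrightarrow> \<gamma>0 / k0) at_bot" unfolding \<rho>_def
    using k0 by (intro tendsto_divide tendsto_int_shift(2)[OF g_bot] K_bot) auto
  define e where "e = \<beta> - \<alpha> - 1"
  have "((\<lambda>n. 2 powr \<beta> * (g (n + 1) / dyad \<beta> (n + 1)) / (K n / dyad (\<alpha> + 1) n)) \<longlongrightarrow> 2 powr \<beta> * 1 / 1) at_top"
    by (intro tendsto_mult tendsto_divide tendsto_const tendsto_int_shift(1)[OF g_top] K_top) simp
  moreover have "2 powr \<beta> * (g (n + 1) / dyad \<beta> (n + 1)) / (K n / dyad (\<alpha> + 1) n)
      = \<rho> n / dyad e n" for n
  proof -
    have 1: "dyad \<beta> (n + 1) = 2 powr \<beta> * dyad \<beta> n"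
      by (simp add: algebra_simps flip: powr_add)
    have 2: "dyad \<beta> n = dyad e n * dyad (\<alpha> + 1) n"
      by (simp add: e_def algebra_simps flip: powr_add)
    have alg: "p * (c / (p * (q * r))) / (d / r) = c / d / q" if "p \<noteq> 0" "q \<noteq> 0" "r \<noteq> 0" "d \<noteq> 0" for p q r c d :: real
      using that by (simp add: field_simps)
    show ?thesis unfolding 1 2 \<rho>_def by (rule alg) (use K_pos[of n] in auto)
  qed
  ultimately have \<rho>_top: "((\<lambda>n. \<rho> n / dyad e n) \<longlongrightarrow> 2 powr \<beta>) at_top" by simp
  define c where "c = (\<lambda>n. two_to n * (2 * exp (- discounted log_vartheta n) / zeta k \<gamma> n))"
  have c_eq: "c n = 2 / ln 2 * exp (- discounted log_vartheta n) * \<rho> n * dyad 2 n" for n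
  proof -
    have alg: "p * (2 * q / (r / p * (a / b))) = 2 / r * q * (b / a) * (p * p)"
      if "p \<noteq> 0" "r \<noteq> 0" "a \<noteq> 0" "b \<noteq> 0" for p q r a b :: real
      using that by (simp add: field_simps)
    have "c n = 2 / ln 2 * exp (- discounted log_vartheta n) * \<rho> n * (two_to n * two_to n)"
      unfolding c_def zeta_eq \<rho>_def by (rule alg) (use K_pos[of n] g_pos[of "n + 1"] in auto)
    then show ?thesis by (simp flip: powr_add)
  qed
  have unique: "\<exists>!A. 0 < A \<and> ((\<lambda>n. exp (- A * two_to n) * c n) has_sum M) UNIV"
  proof (rule pos_bounds_at_bot[OF \<rho>_pos \<rho>_bot, of 0], simp add: k0 \<gamma>0, rule pos_bounds_at_top[OF _ \<rho>_top, of 0])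
    fix r1 R1 r2 R2 assume R1: "0 < R1" "\<And>n. n \<le> 0 \<Longrightarrow> \<rho> n \<le> R1"
      and R2: "0 < r2" "0 < R2" "\<And>n. 0 \<le> n \<Longrightarrow> r2 \<le> \<rho> n / dyad e n"
        "\<And>n. 0 \<le> n \<Longrightarrow> \<rho> n / dyad e n \<le> R2"
    define q where "q = 2 / ln 2 * exp B"
    define q1 where "q1 = 2 / ln 2 * exp (- B)"
    have q: "0 < q" "0 < q1" by (simp_all add: q_def q1_def)
    have cq: "c n \<le> q * \<rho> n * dyad 2 n" "q1 * \<rho> n * dyad 2 n \<le> c n" for n
      unfolding c_eq q_def q1_def using dB \<rho>_pos[of n]
      by (intro mult_right_mono mult_left_mono; simp)+
    show ?thesis
    proof (rule mass_equation_unique_solution[where C = "q * (R1 + R2)" and ?c1.0 = "q1 * r2"])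
      show "0 < q * (R1 + R2)" "0 < q1 * r2" using q R1 R2 by auto
      show "0 < c n" for n unfolding c_eq using \<rho>_pos[of n] by simp
      show "c n \<le> q * (R1 + R2) * dyad 3 n" if n: "0 \<le> n" for n
      proof -
        have "\<rho> n \<le> R2 * dyad e n" using R2(4)[OF n] by (simp add: pos_divide_le_eq)
        also have "\<dots> \<le> (R1 + R2) * dyad 1 n"
          using R1 R2 n beta alpha by (intro mult_mono powr_mono mult_right_mono) (auto simp: e_def)
        finally have "q * \<rho> n * dyad 2 n \<le> q * ((R1 + R2) * dyad 1 n) * dyad 2 n"
          using q by (intro mult_right_mono mult_left_mono) auto
        also have "\<dots> = q * (R1 + R2) * (dyad 1 n * dyad 2 n)" by (simp add: mult_ac)
        also have "dyad 1 n * dyad 2 n = dyad 3 n" by (simp flip: powr_add)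
        finally show ?thesis using cq(1)[of n] by simp
      qed
      show "c n \<le> q * (R1 + R2) * dyad 2 n" if n: "n \<le> 0" for n
      proof -
        have "q * \<rho> n * dyad 2 n \<le> q * (R1 + R2) * dyad 2 n"
          using q R1(2)[OF n] R2(2) by (intro mult_right_mono mult_left_mono) auto
        then show ?thesis using cq(1)[of n] by simp
      qed
      show "q1 * r2 * two_to n \<le> c n" if n: "0 \<le> n" for n
      proof -
        have "r2 * dyad (-1) n \<le> r2 * dyad e n"
          using R2 n beta alpha by (intro mult_left_mono powr_mono mult_right_mono) (auto simp: e_def)
        also have "\<dots> \<le> \<rho> n" using R2(3)[OF n] by (simp add: pos_le_divide_eq)
        finally have "q1 * (r2 * dyad (-1) n) * dyad 2 n \<le> q1 * \<rho> n * dyad 2 n"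
          using q by (intro mult_right_mono mult_left_mono) auto
        note le = this
        have e: "two_to n = dyad (-1) n * dyad 2 n" by (simp flip: powr_add)
        have "q1 * r2 * two_to n = q1 * (r2 * dyad (-1) n) * dyad 2 n"
          unfolding e by (simp only: mult_ac)
        also have "\<dots> \<le> q1 * \<rho> n * dyad 2 n" by (rule le)
        also have "\<dots> \<le> c n" by (rule cq(2))
        finally show ?thesis .
      qed
    qed (rule M)
  qed (use \<rho>_pos in auto)
  have mass_term: "2 powi n * a_coeff k \<gamma> A n = exp (- A * two_to n) * c n" for A n
    by (simp add: a_coeff_def alpha_coeff_eq c_def two_powi)
  from theI'[OF unique] show ?thesis unfolding A_of_mass_def mass_term by blast
qed

text \<open>At \<open>-\<infinity>\<close> the coefficients \<open>\<alpha>\<^sub>n\<close> tend to \<open>1\<close>, whence \<open>\<sigma>\<^sub>n \<rightarrow> 8\<close>. At \<open>+\<infinity>\<close> the product \<open>\<gamma>(2\<^sup>n) \<sigma>\<^sub>n\<close>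
  is at most a multiple of \<open>2\<^bsup>\<beta>n\<^esup> * exp (- A\<^sub>M * 2\<^sup>n)\<close>.\<close>

lemma chain_kernels:
  assumes M: "0 < M"
  shows "chain (\<lambda>n. \<gamma> (2 powi n)) (sigma k \<gamma> M) \<beta> \<gamma>0"
proof (rule log_vartheta_bounded)
  fix B assume B: "\<And>n. \<bar>log_vartheta n\<bar> \<le> B"
  define A where "A = A_of_mass k \<gamma> M"
  have A: "0 < A" unfolding A_def by (rule A_of_mass_pos[OF M])
  have s_eq: "sigma k \<gamma> M n = 8 * alpha_coeff k \<gamma> A n * (g (n + 1) / g n)" for n
    by (simp add: sigma_def A_def g_def)
  have gs_eq: "g n * sigma k \<gamma> M n = 8 * alpha_coeff k \<gamma> A n * g (n + 1)" for n
    using g_pos[of n] by (simp add: s_eq)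
  have a_pos: "0 < alpha_coeff k \<gamma> A n" for n by (simp add: alpha_coeff_eq)
  have "chain g (sigma k \<gamma> M) \<beta> \<gamma>0"
  proof
    show "0 < \<beta>" using beta by simp
    show "0 < g n" for n by (rule g_pos)
    show "0 < sigma k \<gamma> M n" for n unfolding s_eq using a_pos[of n] g_pos[of n] g_pos[of "n+1"] by simp
    show "((\<lambda>n. g n / dyad \<beta> n) \<longlongrightarrow> 1) at_top" by (rule g_top)
    show "(g \<longlongrightarrow> \<gamma>0) at_bot" by (rule g_bot)
    show "0 < \<gamma>0" by (rule \<gamma>0)
    have "((\<lambda>n. 8 * alpha_coeff k \<gamma> A n * (g (n + 1) / g n)) \<longlongrightarrow> 8 * 1 * (\<gamma>0 / \<gamma>0)) at_bot"
      using \<gamma>0 by (intro tendsto_mult tendsto_divide tendsto_const alpha_coeff_bot tendsto_int_shift(2)[OF g_bot] g_bot) auto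
    then show "(sigma k \<gamma> M \<longlongrightarrow> 8) at_bot" using \<gamma>0 by (simp add: s_eq[abs_def])
    show "((\<lambda>n. g n * sigma k \<gamma> M n) \<longlongrightarrow> 0) at_top"
    proof (rule tendsto_sandwich[of "\<lambda>_. 0"])
      define r where "r = (\<lambda>n. g n / dyad \<beta> n)"
      have r: "(r \<longlongrightarrow> 1) at_top" unfolding r_def by (rule g_top)
      define Z where "Z = (\<lambda>n. 8 * exp B * 2 powr \<beta> * (r (n + 1) * (dyad \<beta> n * exp (- A * two_to n))))"
      have "(Z \<longlongrightarrow> 8 * exp B * 2 powr \<beta> * (1 * 0)) at_top"
        unfolding Z_def using beta
        by (intro tendsto_mult tendsto_const tendsto_int_shift(1)[OF r] exp_beats_power[OF A]) simp
      then show "(Z \<longlongrightarrow> 0) at_top" by simp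
      have "g n * sigma k \<gamma> M n \<le> Z n" for n
      proof -
        have "alpha_coeff k \<gamma> A n \<le> exp (- A * two_to n) * exp B"
          unfolding alpha_coeff_eq using discounted_bound[of log_vartheta B n] B by (intro mult_left_mono) (auto simp: abs_le_iff)
        then have "g n * sigma k \<gamma> M n \<le> 8 * (exp (- A * two_to n) * exp B) * g (n + 1)"
          unfolding gs_eq using g_pos[of "n + 1"] by (intro mult_right_mono mult_left_mono) auto
        also have "g (n + 1) = r (n + 1) * (2 powr \<beta> * dyad \<beta> n)"
          by (simp add: r_def algebra_simps powr_add)
        finally show ?thesis by (simp add: Z_def mult_ac)
      qed
      then show "eventually (\<lambda>n. g n * sigma k \<gamma> M n \<le> Z n) at_top"
        by (rule always_eventually[OF allI])
      show "eventually (\<lambda>n. 0 \<le> g n * sigma k \<gamma> M n) at_top"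
        unfolding gs_eq using a_pos g_pos by (intro always_eventually allI) (simp add: less_imp_le)
    qed auto
  qed
  then show ?thesis by (simp add: g_def[abs_def])
qed

end

section \<open>Weighted norms and the linear problem\<close>

lemma powr_inverse_cancel: "2 powr x * (X * 2 powr (- x)) = (X::real)"
  using powr_add[of 2 x "- x"] by (simp add: mult.left_commute[of _ X])

lemma le_wt_iff:
  "n \<le> 0 \<Longrightarrow> b \<le> X * wt \<theta> n \<longleftrightarrow> 2 powi n * b \<le> X"
  "0 < n \<Longrightarrow> b \<le> X * wt \<theta> n \<longleftrightarrow> (dyad \<theta> n) * b \<le> X"
proof -
  have *: "b \<le> X * 2 powr (- x) \<longleftrightarrow> 2 powr x * b \<le> X" for x
    using mult_le_cancel_left_pos[of "2 powr x" b "X * 2 powr (- x)"] by (simp add: powr_inverse_cancel)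
  show "n \<le> 0 \<Longrightarrow> b \<le> X * wt \<theta> n \<longleftrightarrow> 2 powi n * b \<le> X"
    using *[of "real_of_int n"] by (simp add: wt_def two_powi)
  show "0 < n \<Longrightarrow> b \<le> X * wt \<theta> n \<longleftrightarrow> (dyad \<theta> n) * b \<le> X"
    using *[of "\<theta> * real_of_int n"] by (simp add: wt_def)
qed

text \<open>The factor \<open>2\<close> appears because the norm is a sum of two suprema.\<close>

lemma ynorm_le_of_wt_bound:
  assumes y: "\<And>n. \<bar>y n\<bar> \<le> X * wt \<theta> n"
  shows "ynorm \<theta> y \<le> ennreal (2 * X)"
proof -
  have X: "0 \<le> X" by (rule wt_bound_nonneg[OF y])
  have "ynorm \<theta> y \<le> ennreal X + ennreal X" unfolding ynorm_def
    using y le_wt_iff by (intro add_mono SUP_least ennreal_leI) (simp_all, blast+)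
  then show ?thesis using X by (simp add: ennreal_plus[symmetric] del: ennreal_plus)
qed

lemma wt_bound_of_ynorm_le:
  assumes y: "ynorm \<theta> y \<le> ennreal X" and X: "0 \<le> X"
  shows "\<bar>y n\<bar> \<le> X * wt \<theta> n"
proof (cases "n \<le> 0")
  case True
  have "ennreal (2 powi n * \<bar>y n\<bar>) \<le> (SUP n\<in>{..0}. ennreal (2 powi n * \<bar>y n\<bar>))"
    using True by (intro SUP_upper) auto
  also have "\<dots> \<le> ynorm \<theta> y" unfolding ynorm_def by simp
  finally have "ennreal (2 powi n * \<bar>y n\<bar>) \<le> ennreal X" using y by (rule order_trans)
  then show ?thesis using X True by (simp add: le_wt_iff(1))
next
  case False
  have "ennreal (dyad \<theta> n * \<bar>y n\<bar>) \<le> (SUP n\<in>{0<..}. ennreal (dyad \<theta> n * \<bar>y n\<bar>))"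
    using False by (intro SUP_upper) auto
  also have "\<dots> \<le> ynorm \<theta> y" unfolding ynorm_def by simp
  finally have "ennreal (dyad \<theta> n * \<bar>y n\<bar>) \<le> ennreal X" using y by (rule order_trans)
  then show ?thesis using X False by (simp add: le_wt_iff(2))
qed

lemma Y_spaceI:
  assumes "\<And>n. \<bar>y n\<bar> \<le> X * wt 0 n" "\<And>n. \<bar>y n\<bar> \<le> X * wt \<theta> n"
  shows "y \<in> Y_space \<theta>"
  using ynorm_le_of_wt_bound[OF assms(1)] ynorm_le_of_wt_bound[OF assms(2)]
  by (auto simp: Y_space_def intro: le_less_trans)

theorem theorem5p1:
  fixes \<alpha> \<beta> \<alpha>' \<beta>' k0 \<gamma>0 M :: real and k \<gamma> :: "real \<Rightarrow> real"
  assumes "0 < \<alpha>" "\<alpha> < 1" "1 < \<beta>" "\<beta> < 2" "1 < \<alpha>'" "1 < \<beta>'" "0 < k0" "0 < \<gamma>0"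
    and "continuous_on {0..} k" "\<And>\<xi>. \<xi> \<ge> 0 \<Longrightarrow> k \<xi> > 0"
    and "k \<sim>[at_top] (\<lambda>\<xi>. \<xi> powr (\<alpha> + 1))"
    and "(\<lambda>\<xi>. k \<xi> - k0) \<in> O[at_right 0](\<lambda>\<xi>. \<xi> powr \<alpha>')"
    and "continuous_on {0<..} \<gamma>" "\<And>\<xi>. \<xi> > 0 \<Longrightarrow> \<gamma> \<xi> > 0"
    and "\<gamma> \<sim>[at_top] (\<lambda>\<xi>. \<xi> powr \<beta>)"
    and "(\<lambda>\<xi>. \<gamma> \<xi> - \<gamma>0) \<in> O[at_right 0](\<lambda>\<xi>. \<xi> powr \<beta>')"
    and "0 < M"
  shows "\<exists>\<nu>>0. \<forall>\<theta> \<theta>'. -1 < \<theta> \<and> \<theta> < \<beta> \<and> \<theta> \<le> \<theta>' \<and> \<theta>' \<le> \<beta> \<and> \<theta>' - \<theta> < \<beta> \<longrightarrow>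
    (\<exists>C1>0. \<forall>y0 \<in> Y_space \<theta>. \<exists>S.
      linear_solution k \<gamma> M \<theta> y0 S \<and>
      (\<forall>z. linear_solution k \<gamma> M \<theta> y0 z \<longrightarrow> (\<forall>t\<ge>0. z t = S t)) \<and>
      (\<forall>t>0. ynorm \<theta>' (Dplus (S t))
         \<le> ennreal C1 * ynorm \<theta> y0
            * ennreal ((1 + t powr (- (\<theta>' - \<theta>) / \<beta>)) * exp (- \<nu> * t))) \<and>
      (\<exists>S_inf. \<forall>t>0.
         (S t \<longlongrightarrow> S_inf t) at_top \<and>
         (0 < \<theta> \<longrightarrow> (\<lambda>n. S t n - S_inf t) \<in> Y_space \<theta>) \<and>
         (0 < \<theta>' \<longrightarrow> ynorm \<theta>' (\<lambda>n. S t n - S_inf t)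
            \<le> ennreal C1 * ynorm \<theta> y0
               * ennreal ((1 + t powr (- (\<theta>' - \<theta>) / \<beta>)) * exp (- \<nu> * t))) \<and>
         (\<exists>D_inf. 
            ((\<lambda>n. 2 powr (\<beta> * real_of_int n) * (S t n - S_inf t)) \<longlongrightarrow> D_inf) at_top \<and>
            ((\<lambda>n. lin_op k \<gamma> M (S t) n) \<longlongrightarrow> (2 powr \<beta> - 1) / 4 * D_inf) at_top)))"
proof -
  interpret kernels \<alpha> \<beta> \<alpha>' \<beta>' k0 \<gamma>0 k \<gamma>
    by (rule kernels.intro) (use assms in auto)
  interpret C: chain "\<lambda>n. \<gamma> (2 powi n)" "sigma k \<gamma> M" \<beta> \<gamma>0
    by (rule chain_kernels) (rule assms)
  have lin: "lin_op k \<gamma> M y n = C.L y n" for y n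
    by (simp add: lin_op_def C.L_eq)
  obtain \<nu> where \<nu>: "0 < \<nu>" and est: "\<forall>\<theta> \<theta>'. \<theta> < \<beta> \<and> \<theta> \<le> \<theta>' \<and> \<theta>' \<le> \<beta> \<longrightarrow>
    (\<exists>C>0. C.controls (\<lambda>t. C * C.time_factor \<nu> \<theta> \<theta>' t) \<theta> \<theta>')"
    using C.Dplus_estimate by (elim exE conjE)
  define E where "E = (\<lambda>\<theta> \<theta>' t. (1 + t powr (- (\<theta>' - \<theta>) / \<beta>)) * exp (- \<nu> * t))"
  have E: "0 \<le> E \<theta> \<theta>' t" for \<theta> \<theta>' t by (simp add: E_def)
  define lims where "lims = (\<lambda>\<theta> \<theta>' C1 y0 S S_inf t.
         (S t \<longlongrightarrow> S_inf t) at_top \<and>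
         (0 < \<theta> \<longrightarrow> (\<lambda>n. S t n - S_inf t) \<in> Y_space \<theta>) \<and>
         (0 < \<theta>' \<longrightarrow> ynorm \<theta>' (\<lambda>n. S t n - S_inf t) \<le> ennreal C1 * ynorm \<theta> y0 * ennreal (E \<theta> \<theta>' t)) \<and>
         (\<exists>D_inf.
            ((\<lambda>n. dyad \<beta> n * (S t n - S_inf t)) \<longlongrightarrow> D_inf) at_top \<and>
            ((\<lambda>n. lin_op k \<gamma> M (S t) n) \<longlongrightarrow> (2 powr \<beta> - 1) / 4 * D_inf) at_top))"
  define good where "good = (\<lambda>\<theta> \<theta>' C1 y0 S.
      linear_solution k \<gamma> M \<theta> y0 S \<and>
      (\<forall>z. linear_solution k \<gamma> M \<theta> y0 z \<longrightarrow> (\<forall>t\<ge>0. z t = S t)) \<and>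
      (\<forall>t>0. ynorm \<theta>' (Dplus (S t)) \<le> ennreal C1 * ynorm \<theta> y0 * ennreal (E \<theta> \<theta>' t)) \<and>
      (\<exists>S_inf. \<forall>t>0. lims \<theta> \<theta>' C1 y0 S S_inf t))"
  have adm: "C.admissible z \<and> z 0 = y0" if "-1 < \<theta>" and z: "linear_solution k \<gamma> M \<theta> y0 z" for \<theta> y0 z
  proof
    show "z 0 = y0" using z by (simp add: linear_solution_def solves_linear_def)
    have "bounded_upto T (min \<theta> 0) z" for T
    proof -
      obtain B where B: "\<forall>t\<in>{0..T}. ynorm (min \<theta> 0) (z t) \<le> ennreal B"
        using z unfolding linear_solution_def loc_bounded_in_def by blast
      have "\<bar>z t n\<bar> \<le> max B 0 * wt (min \<theta> 0) n" if "t \<in> {0..T}" for t n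
      proof (rule wt_bound_of_ynorm_le)
        show "ynorm (min \<theta> 0) (z t) \<le> ennreal (max B 0)"
          using B that ennreal_leI[of B "max B 0"] by (meson max.cobounded1 order_trans)
      qed simp
      then show ?thesis by blast
    qed
    then have "\<forall>T\<ge>0. bounded_upto T (min \<theta> 0) z" by blast
    then have "\<exists>\<rho>>-1. \<forall>T\<ge>0. bounded_upto T \<rho> z"
      by (intro exI[of _ "min \<theta> 0"] conjI) (use that in simp)
    then show "C.admissible z" using z unfolding C.admissible_def linear_solution_def solves_linear_def lin
      by blast
  qed
  have main: "\<exists>C1>0. \<forall>y0 \<in> Y_space \<theta>. \<exists>S. good \<theta> \<theta>' C1 y0 S"
    if \<theta>: "-1 < \<theta>" "\<theta> < \<beta>" "\<theta> \<le> \<theta>'" "\<theta>' \<le> \<beta>" for \<theta> \<theta>'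
  proof -
    have \<theta>\<beta>: "\<theta> \<le> \<beta>" using \<theta> by simp
    obtain C where C: "0 < C" "C.controls (\<lambda>t. C * E \<theta> \<theta>' t) \<theta> \<theta>'"
      using est[rule_format, of \<theta> \<theta>'] \<theta> unfolding E_def by auto
    obtain C\<beta> where C\<beta>: "C.controls (\<lambda>t. C\<beta> * E \<theta> \<beta> t) \<theta> \<beta>"
      using est[rule_format, of \<theta> \<beta>] \<theta> unfolding E_def by auto
    \<comment> \<open>for \<open>\<theta>' \<le> 0\<close> any positive constant will do, since then there is nothing to bound\<close>
    have "\<exists>Cl>0. 0 < \<theta>' \<longrightarrow> tail_bound Cl \<theta>'"
      using limit_of_Dplus_bound[of \<theta>'] by (cases "0 < \<theta>'") (auto intro: exI[of _ 1])
    then obtain Cl where Cl: "0 < Cl" "0 < \<theta>' \<longrightarrow> tail_bound Cl \<theta>'" by (elim exE conjE)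
    define C1 where "C1 = 6 * C * (1 + Cl)"
    have C1: "0 < C1" "2 * (3 * C) \<le> C1" "2 * (Cl * (3 * C)) \<le> C1" using C(1) Cl(1) by (simp_all add: C1_def distrib_left add_pos_pos)
    show ?thesis
    proof (intro exI[of _ C1] conjI ballI)
      fix y0 assume y0: "y0 \<in> Y_space \<theta>"
      define B where "B = enn2real (ynorm \<theta> y0)"
      have NB: "ynorm \<theta> y0 = ennreal B" "0 \<le> B" using y0 by (auto simp: B_def Y_space_def less_top[symmetric])
      define B0 where "B0 = enn2real (ynorm 0 y0)"
      have NB0: "ynorm 0 y0 = ennreal B0" "0 \<le> B0" using y0 by (auto simp: B0_def Y_space_def less_top[symmetric])
      have y0\<theta>: "\<bar>y0 n\<bar> \<le> B * wt \<theta> n" for n by (rule wt_bound_of_ynorm_le) (simp_all add: NB)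
      have y00: "\<bar>y0 n\<bar> \<le> B0 * wt 0 n" for n by (rule wt_bound_of_ynorm_le) (simp_all add: NB0)
      show "\<exists>S. good \<theta> \<theta>' C1 y0 S"
      proof (rule C.solution_exists[OF y00])
        fix S K assume S: "C.admissible S" "\<And>n. S 0 n = y0 n" and K: "0 \<le> K"
          and S_bd: "\<And>t n. 0 \<le> t \<Longrightarrow> \<bar>S t n\<bar> \<le> B0 * exp (K * t) * wt 0 n"
        have S0: "S 0 = y0" by (rule ext) (rule S(2))
        have S0\<theta>: "\<bar>S 0 n\<bar> \<le> B * wt \<theta> n" for n using y0\<theta> S(2) by simp
        have S_bd': "\<bar>S t n\<bar> \<le> (B0 * exp (K * t)) * wt (min \<theta> 0) n" if "0 \<le> t" for t n
          using S_bd[OF that, of n] mult_left_mono[OF wt_antimono[of "min \<theta> 0" 0 n], of "B0 * exp (K * t)"] NB0(2)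
          by simp
        have sol: "linear_solution k \<gamma> M \<theta> y0 S"
          unfolding linear_solution_def solves_linear_def loc_bounded_in_def
        proof (intro conjI allI impI)
          show "S 0 = y0" by (rule S0)
          show "((\<lambda>s. S s n) has_real_derivative lin_op k \<gamma> M (S t) n) (at t within {0..})" if "0 \<le> t" for t n
            unfolding lin by (rule C.admissible_deriv[OF S(1) that])
          show "S t \<in> Y_space (min \<theta> 0)" if "0 \<le> t" for t
            by (rule Y_spaceI[OF S_bd[OF that] S_bd'[OF that]])
          show "\<exists>B. \<forall>t\<in>{0..T}. ynorm (min \<theta> 0) (S t) \<le> ennreal B" for T
          proof (intro exI ballI)
            fix t assume t: "t \<in> {0..T}"
            then have "ynorm (min \<theta> 0) (S t) \<le> ennreal (2 * (B0 * exp (K * t)))"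
              by (intro ynorm_le_of_wt_bound S_bd') simp
            also have "\<dots> \<le> ennreal (2 * (B0 * exp (K * T)))"
              using t K NB0(2) by (intro ennreal_leI mult_left_mono) (auto intro!: mult_left_mono)
            finally show "ynorm (min \<theta> 0) (S t) \<le> ennreal (2 * (B0 * exp (K * T)))" .
          qed
        qed
        have uniq: "\<forall>z. linear_solution k \<gamma> M \<theta> y0 z \<longrightarrow> (\<forall>t\<ge>0. z t = S t)"
        proof (intro allI impI ext)
          fix z t n assume z: "linear_solution k \<gamma> M \<theta> y0 z" and t: "0 \<le> (t::real)"
          have "C.admissible (\<lambda>t n. z t n - S t n)"
            using adm[OF \<theta>(1) z] S(1) by (intro C.admissible_diff) auto
          from C.admissible_zero[OF this _ t, of n] adm[OF \<theta>(1) z] S0 show "z t n = S t n" by simp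
        qed
        have DS0: "\<bar>Dplus (S 0) n\<bar> \<le> (3 * B) * wt \<theta> n" for n
          by (rule C.Dplus_wt_bound[OF \<theta>(1) S0\<theta>])
        have DS: "\<bar>Dplus (S t) n\<bar> \<le> (3 * C * B * E \<theta> \<theta>' t) * wt \<theta>' n" if "0 < t" for t n
          using C.controlsD[OF C(2) S(1) DS0 that, of n] by (simp add: mult_ac)
        have fold_norm: "ynorm \<theta>' y \<le> ennreal C1 * ynorm \<theta> y0 * ennreal (E \<theta> \<theta>' t)"
          if "\<And>n. \<bar>y n\<bar> \<le> (Q * B * E \<theta> \<theta>' t) * wt \<theta>' n" "2 * Q \<le> C1" for y Q t
        proof -
          have "ynorm \<theta>' y \<le> ennreal (2 * (Q * B * E \<theta> \<theta>' t))" by (rule ynorm_le_of_wt_bound[OF that(1)])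
          also have "\<dots> \<le> ennreal (C1 * B * E \<theta> \<theta>' t)"
            using mult_right_mono[OF that(2), of "B * E \<theta> \<theta>' t"] NB(2) E[of \<theta> \<theta>' t] by (intro ennreal_leI) (simp add: mult_ac)
          also have "\<dots> = ennreal C1 * ynorm \<theta> y0 * ennreal (E \<theta> \<theta>' t)"
            using C1(1) NB E[of \<theta> \<theta>' t] by (simp add: ennreal_mult)
          finally show ?thesis .
        qed
        have est1: "\<forall>t>0. ynorm \<theta>' (Dplus (S t)) \<le> ennreal C1 * ynorm \<theta> y0 * ennreal (E \<theta> \<theta>' t)"
          using fold_norm[OF DS C1(2)] by blast
        obtain Clb where Clb: "tail_bound Clb \<beta>" using limit_of_Dplus_bound[OF C.beta] by (elim exE conjE)
        \<comment> \<open>the estimate with target exponent \<open>\<beta>\<close> makes the differences summable for every \<open>\<theta>'\<close>\<close>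
        define S_inf where "S_inf = (\<lambda>t. Lim at_top (S t))"
        have lim: "(S t \<longlongrightarrow> S_inf t) at_top \<and> (\<exists>X. \<forall>n. \<bar>S t n - S_inf t\<bar> \<le> X * wt \<beta> n)" if t: "0 < t" for t
        proof -
          from Clb[unfolded tail_bound_def, rule_format, OF C.controlsD[OF C\<beta> S(1) DS0 t]] obtain l X where
            l: "(S t \<longlongrightarrow> l) at_top" "\<forall>n. \<bar>S t n - l\<bar> \<le> X * wt \<beta> n" by blast
          have "S_inf t = l" unfolding S_inf_def by (rule tendsto_Lim[OF _ l(1)]) simp
          then show ?thesis using l by blast
        qed
        have "\<forall>t>0. lims \<theta> \<theta>' C1 y0 S S_inf t" unfolding lims_def
        proof (intro allI impI conjI)
          fix t :: real assume t: "0 < t"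
          show l: "(S t \<longlongrightarrow> S_inf t) at_top" using lim[OF t] by simp
          obtain X where X: "\<And>n. \<bar>S t n - S_inf t\<bar> \<le> X * wt \<beta> n" using lim[OF t] by blast
          have X0: "0 \<le> X" using X[of 0] wt_pos[of \<beta> 0] by (smt (verit) zero_le_mult_iff mult_neg_pos)
          show "(\<lambda>n. S t n - S_inf t) \<in> Y_space \<theta>"
          proof (rule Y_spaceI[where X = X])
            show "\<bar>S t n - S_inf t\<bar> \<le> X * wt 0 n" for n
              using X[of n] mult_left_mono[OF wt_antimono[of 0 \<beta> n] X0] C.beta by simp
            show "\<bar>S t n - S_inf t\<bar> \<le> X * wt \<theta> n" for n
              using X[of n] mult_left_mono[OF wt_antimono[OF \<theta>\<beta>, of n] X0] by simp
          qed
          show "\<exists>D_inf.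
            ((\<lambda>n. dyad \<beta> n * (S t n - S_inf t)) \<longlongrightarrow> D_inf) at_top \<and>
            ((\<lambda>n. lin_op k \<gamma> M (S t) n) \<longlongrightarrow> (2 powr \<beta> - 1) / 4 * D_inf) at_top"
            unfolding lin by (rule C.flux_at_infinity[OF \<theta>(1,2) S(1) S0\<theta> t l])
          assume \<theta>': "0 < \<theta>'"
          from Cl(2)[rule_format, OF \<theta>', unfolded tail_bound_def, rule_format, OF DS[OF t]] obtain l' where
            l': "(S t \<longlongrightarrow> l') at_top" "\<And>n. \<bar>S t n - l'\<bar> \<le> Cl * (3 * C * B * E \<theta> \<theta>' t) * wt \<theta>' n" by blast
          have "l' = S_inf t" using l'(1) l by (intro tendsto_unique[OF trivial_limit_at_top_linorder])
          then show "ynorm \<theta>' (\<lambda>n. S t n - S_inf t) \<le> ennreal C1 * ynorm \<theta> y0 * ennreal (E \<theta> \<theta>' t)"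
            using l'(2) by (intro fold_norm[OF _ C1(3)]) (simp add: mult.assoc)
        qed
        then show ?thesis
          using sol uniq est1 unfolding good_def by (intro exI[of _ S] conjI exI[of _ S_inf])
      qed
    qed (rule C1(1))
  qed
  show ?thesis
    by (rule exI[of _ \<nu>], rule conjI[OF \<nu>], intro allI impI, elim conjE,
        rule main[unfolded good_def lims_def E_def])
qed

end
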